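(* Let $(r_\ell)_{\ell\in\mathbb{N}}\subset\mathbb{R}_+$ be a sequence such that $$\lim_{\ell\to\infty}r_\ell=+\infty,\qquad \lim_{\ell\to\infty}\frac{r_\ell}{\ell}=0 .$$ For $\ell$ large enough that $r_\ell\le\ell/2$, define the following operators on $L^2(\mathbb{S}^2)$ (sums over integers $m$): $$\gamma_\ell^{(2)}:=\sum_{\ell-2r_\ell<m\le\ell-r_\ell}|Y_\ell^m\rangle\langle Y_\ell^m|,\qquad \gamma_\ell^{(\infty)}:=\sum_{r_\ell\le m<2r_\ell}|Y_\ell^m\rangle\langle Y_\ell^m| .$$ Then there are $c>0$ and $L\ge1$ such that for all $\ell\ge L$ and all $2\le p\le\infty$, $$\left\|\rho_{\gamma_\ell^{(2)}}\right\|_{L^{p/2}(\mathbb{S}^2)}\ge c\,\ell^{\frac12-\frac1p}r_\ell^{\frac12+\frac1p},\qquad \left\|\rho_{\gamma_\ell^{(\infty)}}\right\|_{L^{p/2}(\mathbb{S}^2)}\ge c\,\ell^{1-\frac4p}r_\ell^{\frac4p} .$$ In particular, there is $c'>0$ such that for all sufficiently large $\ell$, $$\left\|\rho_{\gamma_\ell^{(2)}}\right\|_{L^{p/2}(\mathbb{S}^2)}\ge c'\,\ell^{\frac12-\frac1p}\left\|\gamma_\ell^{(2)}\right\|_{\mathfrak{S}^{\frac{2p}{p+2}}}\ \text{ for }2\le p\le6,\qquad \left\|\rho_{\gamma_\ell^{(\infty)}}\right\|_{L^{p/2}(\mathbb{S}^2)}\ge c'\,\ell^{1-\frac4p}\left\|\gamma_\ell^{(\infty)}\right\|_{\mathfrak{S}^{\frac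 p4}}\ \text{ for }6\le p\le\infty .$$
   Context: $Y_\ell^m$, $\ell\in\mathbb{N}$, $-\ell\le m\le\ell$, are the $L^2(\mathbb{S}^2)$-normalized spherical harmonics, $$Y_\ell^m(\theta,\phi)=\sqrt{\tfrac{2\ell+1}{4\pi}\tfrac{(\ell-m)!}{(\ell+m)!}}\,P_\ell^m(\cos\theta)e^{im\phi},$$ with $P_\ell^m$ the associated Legendre polynomials; $(\theta,\phi)\in(0,\pi)\times(0,2\pi)$ denotes the point $(\sin\theta\cos\phi,\sin\theta\sin\phi,\cos\theta)$, and $\mathbb{S}^2$ carries its standard area measure $\sin\theta\,d\theta\,d\phi$. They satisfy $\Delta_{\mathbb{S}^2}Y_\ell^m=\ell(\ell+1)Y_\ell^m$, where $\Delta_{\mathbb{S}^2}\ge0$ is the Laplace--Beltrami operator. $|u\rangle\langle u|$ is the operator $f\mapsto\langle u,f\rangle u$. For $\gamma=\sum_m|Y_\ell^m\rangle\langle Y_\ell^m|$ (finite sum) the density is $\rho_\gamma(\omega)=\sum_m|Y_\ell^m(\omega)|^2$. $\mathfrak{S}^\alpha$ is the Schatten class on $L^2(\mathbb{S}^2)$ with norm $\|A\|_{\mathfrak{S}^\alpha}=(\operatorname{Tr}(A^*A)^{\alpha/2})^{1/\alpha}$, and $\mathfrak{S}^\infty$ carries the operator norm. (For $p=\infty$, $1/p=0$.) *)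

theory Defs
  imports "HOL-Analysis.Analysis" "HOL-Probability.Essential_Supremum"
begin

section \<open>The sphere and its area measure\<close>

definition sphere_param :: "real \<times> real \<Rightarrow> real^3" where
  "sphere_param = (\<lambda>(\<theta>, \<phi>). vector [sin \<theta> * cos \<phi>, sin \<theta> * sin \<phi>, cos \<theta>])"

text \<open>The parametrized part of the sphere omits only a half great circle, which is a null set.\<close>

definition sphere_measure :: "(real^3) measure" where
  "sphere_measure =
     distr (density (restrict_space lborel ({0<..<pi} \<times> {0<..<2*pi})) (\<lambda>(\<theta>, \<phi>). ennreal (sin \<theta>)))
           (restrict_space borel (sphere 0 1)) sphere_param"

lemma sphere_param_in_sphere: "sphere_param x \<in> sphere 0 1"
proof -
  obtain \<theta> \<phi> where x: "x = (\<theta>, \<phi>)"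
    by (cases x)
  have "(sin \<theta> * cos \<phi>)\<^sup>2 + (sin \<theta> * sin \<phi>)\<^sup>2 + (cos \<theta>)\<^sup>2
      = (sin \<theta>)\<^sup>2 * ((sin \<phi>)\<^sup>2 + (cos \<phi>)\<^sup>2) + (cos \<theta>)\<^sup>2"
    unfolding power_mult_distrib distrib_left by (rule arg_cong2[OF add.commute refl])
  also have "\<dots> = 1"
    unfolding sin_cos_squared_add by simp
  finally show ?thesis
    unfolding x sphere_param_def by (simp add: norm_vec_def L2_set_def sum_3)
qed

lemma sphere_param_measurable:
  "sphere_param \<in> lborel \<rightarrow>\<^sub>M restrict_space borel (sphere 0 1)"
proof -
  have "continuous_on UNIV (\<lambda>x. sin (fst x) * cos (snd x :: real) :: real)"
    "continuous_on UNIV (\<lambda>x. sin (fst x) * sin (snd x :: real) :: real)"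
    "continuous_on UNIV (\<lambda>x::real \<times> real. cos (fst x))"
    by (intro continuous_intros)+
  then have "continuous_on UNIV (\<lambda>x. sphere_param x $ i)" for i
    using exhaust_3[of i] by (elim disjE) (simp_all add: sphere_param_def case_prod_beta)
  then have "continuous_on UNIV (\<lambda>x. \<chi> i. sphere_param x $ i)"
    by (rule continuous_on_vec_lambda)
  then have "sphere_param \<in> borel_measurable borel"
    by (intro borel_measurable_continuous_onI) simp
  then show ?thesis
    by (intro measurable_restrict_space2) (use sphere_param_in_sphere in auto)
qed


section \<open>Spherical harmonics\<close>

text \<open>Rodrigues' formula, with the Condon--Shortley phase. It covers \<open>-l \<le> m \<le> l\<close>, including
  negative \<open>m\<close>. The power is an integer power of the square root, rather than
  \<^const>\<open>powr\<close>, because of the case \<open>m = 0\<close>, \<open>x = \<plusminus>1\<close>.\<close>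

definition assoc_legendre :: "nat \<Rightarrow> int \<Rightarrow> real \<Rightarrow> real" where
  "assoc_legendre l m x =
     (-1) powi m / (2 ^ l * fact l) * sqrt (1 - x\<^sup>2) powi m
     * poly ((pderiv ^^ nat (int l + m)) ([:-1, 0, 1:] ^ l)) x"

definition sph_harm :: "nat \<Rightarrow> int \<Rightarrow> real^3 \<Rightarrow> complex" where
  "sph_harm l m \<omega> =
     complex_of_real
       (sqrt ((2 * real l + 1) / (4 * pi) * (fact (nat (int l - m)) / fact (nat (int l + m))))
        * assoc_legendre l m (\<omega> $ 3))
     * cis (of_int m * Arg2pi (Complex (\<omega> $ 1) (\<omega> $ 2)))"

lemma sph_harm_spherical_coordinates:
  assumes "0 < \<theta>" "\<theta> < pi" "0 < \<phi>" "\<phi> < 2 * pi"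
  shows "sph_harm l m (sphere_param (\<theta>, \<phi>)) =
     complex_of_real
       (sqrt ((2 * real l + 1) / (4 * pi) * (fact (nat (int l - m)) / fact (nat (int l + m))))
        * assoc_legendre l m (cos \<theta>))
     * exp (\<i> * of_int m * complex_of_real \<phi>)"
proof -
  have "Complex (sin \<theta> * cos \<phi>) (sin \<theta> * sin \<phi>) = of_real (sin \<theta>) * exp (\<i> * of_real \<phi>)"
    by (simp add: complex_eq_iff Re_exp Im_exp)
  moreover have "sin \<theta> > 0"
    using assms by (simp add: sin_gt_zero)
  ultimately have "Arg2pi (Complex (sin \<theta> * cos \<phi>) (sin \<theta> * sin \<phi>)) = \<phi>"
    using assms Arg2pi_unique[of "sin \<theta>" \<phi>] by simp
  then show ?thesis
    by (simp add: sph_harm_def sphere_param_def vector_3 cis_conv_exp mult_ac)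
qed


section \<open>Lebesgue norms\<close>

definition Lp_norm :: "'a measure \<Rightarrow> ereal \<Rightarrow> ('a \<Rightarrow> real) \<Rightarrow> real" where
  "Lp_norm M q f =
     (if q = \<infinity> then real_of_ereal (esssup M (\<lambda>x. ereal \<bar>f x\<bar>))
      else (LINT x|M. \<bar>f x\<bar> powr real_of_ereal q) powr (1 / real_of_ereal q))"


section \<open>Operators on complex \<open>L\<^sup>2\<close> spaces\<close>

text \<open>Elements of \<open>L\<^sup>2\<close> are represented by functions, and operators by maps between representatives;
  equality in \<open>L\<^sup>2\<close> is equality almost everywhere.\<close>

definition L2_space :: "'a measure \<Rightarrow> ('a \<Rightarrow> complex) set" where
  "L2_space M = {f \<in> borel_measurable M. integrable M (\<lambda>x. (cmod (f x))\<^sup>2)}"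

definition L2_inner :: "'a measure \<Rightarrow> ('a \<Rightarrow> complex) \<Rightarrow> ('a \<Rightarrow> complex) \<Rightarrow> complex" where
  "L2_inner M f g = (LINT x|M. cnj (f x) * g x)"

definition L2_norm :: "'a measure \<Rightarrow> ('a \<Rightarrow> complex) \<Rightarrow> real" where
  "L2_norm M f = sqrt (LINT x|M. (cmod (f x))\<^sup>2)"

type_synonym 'a L2_operator = "('a \<Rightarrow> complex) \<Rightarrow> ('a \<Rightarrow> complex)"

definition bounded_L2_operator :: "'a measure \<Rightarrow> 'a L2_operator \<Rightarrow> bool" where
  "bounded_L2_operator M A \<longleftrightarrow>
     (\<forall>f\<in>L2_space M. A f \<in> L2_space M) \<and>
     (\<forall>f\<in>L2_space M. \<forall>g\<in>L2_space M. \<forall>a b.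
        AE x in M. A (\<lambda>y. a * f y + b * g y) x = a * A f x + b * A g x) \<and>
     (\<exists>C. \<forall>f\<in>L2_space M. L2_norm M (A f) \<le> C * L2_norm M f)"

text \<open>The operator \<open>|u\<rangle>\<langle>u|\<close>.\<close>

definition rank_one :: "'a measure \<Rightarrow> ('a \<Rightarrow> complex) \<Rightarrow> 'a L2_operator" where
  "rank_one M u f = (\<lambda>x. L2_inner M u f * u x)"

definition L2_opnorm :: "'a measure \<Rightarrow> 'a L2_operator \<Rightarrow> real" where
  "L2_opnorm M A = Sup {L2_norm M (A f) | f. f \<in> L2_space M \<and> L2_norm M f \<le> 1}"

definition L2_adjoint :: "'a measure \<Rightarrow> 'a L2_operator \<Rightarrow> 'a L2_operator" where
  "L2_adjoint M A = (SOME B. bounded_L2_operator M B \<and>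
     (\<forall>f\<in>L2_space M. \<forall>g\<in>L2_space M. L2_inner M (B f) g = L2_inner M f (A g)))"

definition L2_orthonormal_basis :: "'a measure \<Rightarrow> ('a \<Rightarrow> complex) set \<Rightarrow> bool" where
  "L2_orthonormal_basis M B \<longleftrightarrow>
     B \<subseteq> L2_space M \<and>
     (\<forall>b\<in>B. \<forall>b'\<in>B. L2_inner M b b' = (if b = b' then 1 else 0)) \<and>
     (\<forall>f\<in>L2_space M. (\<forall>b\<in>B. L2_inner M b f = 0) \<longrightarrow> (AE x in M. f x = 0))"

definition L2_trace :: "'a measure \<Rightarrow> 'a L2_operator \<Rightarrow> complex" where
  "L2_trace M A = (\<Sum>\<^sub>\<infinity>b\<in>(SOME B. L2_orthonormal_basis M B). L2_inner M b (A b))"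

text \<open>The power \<open>T\<^sup>s\<close>, \<open>s > 0\<close>, of a nonnegative operator that has an orthonormal basis of
  eigenvectors, in particular of every compact one (spectral theorem). It is unique up to
  null sets, and does not depend on the choice of the eigenbasis.\<close>

definition L2_power :: "'a measure \<Rightarrow> 'a L2_operator \<Rightarrow> real \<Rightarrow> 'a L2_operator" where
  "L2_power M T s = (SOME S. bounded_L2_operator M S \<and>
     (\<exists>B ev. L2_orthonormal_basis M B \<and>
        (\<forall>b\<in>B. 0 \<le> ev b \<and>
           (AE x in M. T b x = complex_of_real (ev b) * b x) \<and>
           (AE x in M. S b x = complex_of_real (ev b powr s) * b x))))"

text \<open>The Schatten norm of exponent \<open>\<alpha> \<in> [1, \<infinity>]\<close>; for \<open>\<alpha> < \<infinity>\<close> it is meaningful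
  for operators of the Schatten class only, in particular for those of finite rank.\<close>

definition schatten_norm :: "'a measure \<Rightarrow> ereal \<Rightarrow> 'a L2_operator \<Rightarrow> real" where
  "schatten_norm M \<alpha> A =
     (if \<alpha> = \<infinity> then L2_opnorm M A
      else Re (L2_trace M (L2_power M (L2_adjoint M A \<circ> A) (real_of_ereal \<alpha> / 2)))
           powr (1 / real_of_ereal \<alpha>))"


section \<open>The operators and their densities\<close>

definition sph_operator :: "nat \<Rightarrow> int set \<Rightarrow> (real^3) L2_operator" where
  "sph_operator l I = (\<lambda>f \<omega>. \<Sum>m\<in>I. rank_one sphere_measure (sph_harm l m) f \<omega>)"

text \<open>The density of the operator \<^term>\<open>sph_operator l I\<close>, for finite \<open>I\<close>.\<close>

definition sph_density :: "nat \<Rightarrow> int set \<Rightarrow> real^3 \<Rightarrow> real" where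
  "sph_density l I \<omega> = (\<Sum>m\<in>I. (cmod (sph_harm l m \<omega>))\<^sup>2)"

definition orders_two :: "(nat \<Rightarrow> real) \<Rightarrow> nat \<Rightarrow> int set" where
  "orders_two r l = {m. real l - 2 * r l < of_int m \<and> of_int m \<le> real l - r l}"

definition orders_infty :: "(nat \<Rightarrow> real) \<Rightarrow> nat \<Rightarrow> int set" where
  "orders_infty r l = {m. r l \<le> of_int m \<and> of_int m < 2 * r l}"

abbreviation gamma_two :: "(nat \<Rightarrow> real) \<Rightarrow> nat \<Rightarrow> (real^3) L2_operator" where
  "gamma_two r l \<equiv> sph_operator l (orders_two r l)"

abbreviation gamma_infty :: "(nat \<Rightarrow> real) \<Rightarrow> nat \<Rightarrow> (real^3) L2_operator" where
  "gamma_infty r l \<equiv> sph_operator l (orders_infty r l)"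

abbreviation rho_two :: "(nat \<Rightarrow> real) \<Rightarrow> nat \<Rightarrow> real^3 \<Rightarrow> real" where
  "rho_two r l \<equiv> sph_density l (orders_two r l)"

abbreviation rho_infty :: "(nat \<Rightarrow> real) \<Rightarrow> nat \<Rightarrow> real^3 \<Rightarrow> real" where
  "rho_infty r l \<equiv> sph_density l (orders_infty r l)"

end

theory Submission
  imports Defs
begin

text \<open>
  Write \<open>x = cos \<theta>\<close> and let \<open>h\<^sub>m(x)\<close> be the squared associated Legendre function of order \<open>m\<close>, normalized
  independently of \<open>m\<close>. The ladder relations express both \<open>h\<^sub>m'\<close> and \<open>2 m x h\<^sub>m / (1 - x\<^sup>2)\<close> through the
  same cross terms of neighbouring orders, as a difference and as a sum. Summation by parts yields
  \<open>\<Sum>h\<^sub>m\<close>, \<open>\<Sum>m\<^sup>2 h\<^sub>m\<close> and \<open>\<Sum>m\<^sup>4 h\<^sub>m\<close> in closed form, and integration by parts yields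
  \<open>\<integral> x\<^sup>2 h\<^sub>m / (1 - x\<^sup>2) dx = (2 (l - m) + 1) / (2 m) \<integral> h\<^sub>m dx\<close>.

  For \<open>\<gamma>\<^sup>(\<^sup>2\<^sup>)\<close> the integral identity and Chebyshev's inequality put half of the mass of the density
  into a band \<open>\<bar>x\<bar> \<le> C sqrt (r / l)\<close> around the equator. For \<open>\<gamma>\<^sup>(\<^sup>\<infinity>\<^sup>)\<close> the second and fourth moments of
  the order show that, where \<open>l (l + 1) (sin \<theta>)\<^sup>2\<close> is close to \<open>10 r\<^sup>2 / 3\<close>, a fixed fraction of the total
  density \<open>(2 l + 1) / (4 \<pi>)\<close> comes from orders with \<open>r \<le> \<bar>m\<bar> < 2 r\<close>. In both cases the convexity of
  \<open>t \<mapsto> t\<^sup>q\<close> on that set gives the bound of the \<open>L\<^sup>q\<close> norm. The operators are orthogonal projections of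
  rank at most \<open>r + 1\<close>, so their Schatten norms are at most \<open>(r + 1)\<^sup>1\<^sup>/\<^sup>\<alpha>\<close>.
\<close>

section \<open>Derivatives in the Rodrigues formula\<close>

text \<open>No asymptotics of Legendre functions enter; every estimate starts from an exact
  identity. At a fixed point the weights h_m, over orders of both signs, have nearly the moments of
  the arcsine law on [-sqrt s, sqrt s] with s = l (l + 1) sin^2 \<theta>: the second is s/2, the
  fourth about 3 s^2/8 of the total. The second moment alone cannot exclude that the mass sits at
  orders near 0 and at very large ones. Together with the fourth it gives the mean of a quadratic
  polynomial in m^2. For s = \<sigma> r^2 the main term of the resulting lower bound is r^4 (-2 + 5
  \<sigma>/4 - 3 \<sigma>^2/16), which is positive for 8/3 < \<sigma> < 4 and largest at \<sigma> =
  10/3.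

  The other obstacle lies in the definitions: the adjoint, the power and the basis of the trace are
  picked by \<open>SOME\<close>, so each has to be identified almost everywhere whatever the choice
  is. This is why orthonormal bases, convergence in L^2 and uniqueness of bounded operators precede
  the Schatten norms.\<close>

definition rodrigues_deriv :: "nat \<Rightarrow> nat \<Rightarrow> real \<Rightarrow> real" where
  "rodrigues_deriv l k x = poly ((pderiv ^^ k) ([:-1, 0, 1:] ^ l)) x"

lemma DERIV_rodrigues_deriv:
  "((\<lambda>x. rodrigues_deriv l k x) has_real_derivative rodrigues_deriv l (Suc k) x) (at x within S)"
  unfolding rodrigues_deriv_def funpow.simps o_apply by (rule DERIV_subset[OF poly_DERIV]) simp

lemmas DERIV_rodrigues_deriv' [derivative_intros] = DERIV_chain2[OF DERIV_rodrigues_deriv]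

lemma continuous_on_rodrigues_deriv [continuous_intros]:
  "continuous_on S f \<Longrightarrow> continuous_on S (\<lambda>x. rodrigues_deriv l k (f x))"
  unfolding rodrigues_deriv_def by (intro continuous_intros)

lemma rodrigues_deriv_0: "rodrigues_deriv l 0 x = (x\<^sup>2 - 1) ^ l"
  by (simp add: rodrigues_deriv_def power2_eq_square algebra_simps)

lemma rodrigues_deriv_1: "rodrigues_deriv l (Suc 0) x = 2 * real l * x * (x\<^sup>2 - 1) ^ (l - 1)"
proof -
  have "((\<lambda>x::real. (x\<^sup>2 - 1) ^ l) has_real_derivative 2 * real l * x * (x\<^sup>2 - 1) ^ (l - 1)) (at x)"
    by (rule derivative_eq_intros refl | simp)+
  moreover have "((\<lambda>x. rodrigues_deriv l 0 x) has_real_derivative rodrigues_deriv l (Suc 0) x) (at x)"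
    by (rule DERIV_rodrigues_deriv)
  ultimately show ?thesis
    unfolding rodrigues_deriv_0 using DERIV_unique by blast
qed

lemma rodrigues_deriv_eq_0:
  assumes "2 * l < k" shows "rodrigues_deriv l k x = 0"
proof -
  have d: "degree ((pderiv ^^ j) p) = degree p - j" for j and p :: "real poly"
    by (induction j) (simp_all add: degree_pderiv)
  have "degree ([:-1, 0, 1:: real:] ^ l) = 2 * l"
    by (simp add: degree_power_eq)
  then have "degree ((pderiv ^^ (2*l)) ([:-1, 0, 1:: real:] ^ l)) = 0"
    by (simp add: d)
  then obtain c where c: "(pderiv ^^ (2*l)) ([:-1, 0, 1:: real:] ^ l) = [:c:]"
    using degree_eq_zeroE by blast
  have "(pderiv ^^ (Suc j + 2 * l)) ([:-1, 0, 1:: real:] ^ l) = 0" for j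
    by (induction j) (simp_all add: c pderiv_pCons)
  moreover obtain j where "k = Suc j + 2 * l"
    using assms by (metis add.commute add_Suc less_iff_Suc_add)
  ultimately show ?thesis by (simp add: rodrigues_deriv_def)
qed

text \<open>The function u = (x^2 - 1)^l solves (x^2 - 1) u' = 2 l x u. Differentiating this
  equation k + 1 times gives the claim; the induction differentiates once per step.\<close>

lemma rodrigues_deriv_recurrence:
  "(x\<^sup>2 - 1) * rodrigues_deriv l (Suc (Suc k)) x + 2 * (real (Suc k) - real l) * x * rodrigues_deriv l (Suc k) x
    + real (Suc k) * (real k - 2 * real l) * rodrigues_deriv l k x = 0"
proof -
  let ?D = "rodrigues_deriv l"
  have zero_deriv: "d = 0" if "\<And>x. f x = 0" "(f has_real_derivative d) (at x)"
    for f :: "real \<Rightarrow> real" and d x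
  proof -
    have "f = (\<lambda>x. 0)" using that(1) by (rule ext)
    with that(2) show ?thesis using DERIV_unique[of f d x 0] by simp
  qed
  have base: "(x\<^sup>2 - 1) * ?D (Suc 0) x - 2 * real l * x * ?D 0 x = 0" for x
  proof (cases l)
    case (Suc n)
    then show ?thesis unfolding rodrigues_deriv_0 rodrigues_deriv_1 by simp
  qed (simp add: rodrigues_deriv_1)
  show ?thesis
  proof (induction k arbitrary: x)
    case 0
    have "((\<lambda>x. (x\<^sup>2 - 1) * ?D (Suc 0) x - 2 * real l * x * ?D 0 x) has_real_derivative
      (2 * x * ?D (Suc 0) x + (x\<^sup>2 - 1) * ?D (Suc (Suc 0)) x - 2 * real l * (?D 0 x + x * ?D (Suc 0) x))) (at x)"
      by (rule derivative_eq_intros refl | simp add: algebra_simps)+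
    from zero_deriv[OF base this] show ?case
      by (simp add: algebra_simps)
  next
    case (Suc k)
    have "((\<lambda>x. (x\<^sup>2 - 1) * ?D (Suc (Suc k)) x + 2 * (real (Suc k) - real l) * x * ?D (Suc k) x
          + real (Suc k) * (real k - 2 * real l) * ?D k x) has_real_derivative
      (2 * x * ?D (Suc (Suc k)) x + (x\<^sup>2 - 1) * ?D (Suc (Suc (Suc k))) x
        + 2 * (real (Suc k) - real l) * (?D (Suc k) x + x * ?D (Suc (Suc k)) x)
        + real (Suc k) * (real k - 2 * real l) * ?D (Suc k) x)) (at x)"
      by (rule derivative_eq_intros refl | simp add: algebra_simps)+
    from zero_deriv[OF Suc this] show ?case
      by (simp add: algebra_simps)
  qed
qed


section \<open>Moments of the order\<close>

lemma rodrigues_deriv_recurrence_order: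
  "(1 - x\<^sup>2) * rodrigues_deriv l (l + Suc (Suc n)) x =
     2 * real (Suc n) * x * rodrigues_deriv l (l + Suc n) x
     - (real l - real n) * (real l + real n + 1) * rodrigues_deriv l (l + n) x"
  using rodrigues_deriv_recurrence[of x l "l + n"] by (simp add: algebra_simps)

text \<open>Write (x^2 - 1)^l = (x - 1)^l (x + 1)^l. Each derivative lowers the order of the zero at
  1 by one and multiplies the cofactor's value at 1 by the old exponent, so that value times the
  factorial of the remaining exponent stays 2^l l!.\<close>

lemma rodrigues_deriv_at_1: "rodrigues_deriv l l 1 = 2 ^ l * fact l"
proof -
  have "\<exists>r. (pderiv ^^ k) ([:-1, 0, 1::real:] ^ l) = [:-1, 1:] ^ (l - k) * r
      \<and> poly r 1 * fact (l - k) = 2 ^ l * fact l" if "k \<le> l" for k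
    using that
  proof (induction k)
    case 0
    have "[:-1, 0, 1::real:] = [:-1, 1:] * [:1, 1:]" by simp
    then have "[:-1, 0, 1::real:] ^ l = [:-1, 1:] ^ l * [:1, 1:] ^ l"
      by (simp only: power_mult_distrib)
    then show ?case by (intro exI[of _ "[:1, 1:] ^ l"]) simp
  next
    case (Suc k)
    then obtain r where r: "(pderiv ^^ k) ([:-1, 0, 1::real:] ^ l) = [:-1, 1:] ^ (l - k) * r"
      "poly r 1 * fact (l - k) = 2 ^ l * fact l" by auto
    define j where "j = l - Suc k"
    have j: "l - k = Suc j" using Suc.prems by (simp add: j_def)
    have "(pderiv ^^ Suc k) ([:-1, 0, 1::real:] ^ l) = pderiv ([:-1, 1:] ^ Suc j * r)"
      by (simp add: r(1) j)
    also have "\<dots> = [:-1, 1:] ^ j * (smult (1 + real j) r + [:-1, 1:] * pderiv r)"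
      by (simp only: pderiv_mult pderiv_power_Suc) (simp add: pderiv_pCons algebra_simps)
    finally show ?case
      using r(2) unfolding j j_def[symmetric]
      by (intro exI[of _ "smult (1 + real j) r + [:-1, 1:] * pderiv r"]) (simp add: algebra_simps)
  qed
  from this[of l] show ?thesis by (auto simp: rodrigues_deriv_def)
qed

text \<open>Up to normalization, \<^term>\<open>legendre_sq 0 l m (cos \<theta>)\<close> is the density of \<open>Y\<^sub>l\<^sup>m\<close>. The index \<open>j\<close>
  divides it by \<open>(sin \<theta>)\<^sup>2\<^sup>j\<close>; because of truncated subtraction this is meaningful for \<open>j \<le> m\<close> only.\<close>

definition legendre_sq :: "nat \<Rightarrow> nat \<Rightarrow> nat \<Rightarrow> real \<Rightarrow> real" where
  "legendre_sq j l m x = fact (l - m) / fact (l + m) * (1 - x\<^sup>2) ^ (m - j) * (rodrigues_deriv l (l + m) x)\<^sup>2"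

text \<open>Up to sign and normalization this is the product of the Legendre functions of orders m
  and m + 1, divided by sin \<theta>. It carries the weight of order m, so that it appears directly
  in the derivative of h_m.\<close>

definition legendre_cross :: "nat \<Rightarrow> nat \<Rightarrow> real \<Rightarrow> real" where
  "legendre_cross l m x = fact (l - m) / fact (l + m) * (1 - x\<^sup>2) ^ m
     * rodrigues_deriv l (l + m) x * rodrigues_deriv l (l + Suc m) x"

lemma continuous_on_legendre_sq [continuous_intros]:
  "continuous_on S f \<Longrightarrow> continuous_on S (\<lambda>x. legendre_sq j l m (f x))"
  unfolding legendre_sq_def by (intro continuous_intros)

lemma continuous_on_legendre_cross [continuous_intros]:
  "continuous_on S f \<Longrightarrow> continuous_on S (\<lambda>x. legendre_cross l m (f x))"
  unfolding legendre_cross_def by (intro continuous_intros)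

lemma legendre_sq_reduce:
  "j \<le> i \<Longrightarrow> i \<le> m \<Longrightarrow> legendre_sq j l m x = (1 - x\<^sup>2) ^ (i - j) * legendre_sq i l m x"
proof -
  assume "j \<le> i" "i \<le> m"
  then have "(1 - x\<^sup>2) ^ (m - j) = (1 - x\<^sup>2) ^ (i - j) * (1 - x\<^sup>2) ^ (m - i)"
    by (simp flip: power_add)
  then show ?thesis by (simp add: legendre_sq_def)
qed

section \<open>Ladder relations between neighbouring orders\<close>

lemma legendre_cross_top: "legendre_cross l l x = 0"
  by (simp add: legendre_cross_def rodrigues_deriv_eq_0)

text \<open>The extra factor is the coefficient of the lowest derivative in
  \<open>rodrigues_deriv_recurrence_order\<close>. The normalization therefore absorbs it, and cross
  terms of neighbouring orders combine with coefficients 1.\<close>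

lemma order_weight_Suc:
  assumes "n < l"
  shows "fact (l - n) / fact (l + n) =
    (fact (l - Suc n) / fact (l + Suc n) :: real) * ((real l - real n) * (real l + real n + 1))"
proof -
  have "fact (l - n) = (real l - real n) * fact (l - Suc n)"
    using assms by (simp add: fact_reduce of_nat_diff)
  moreover have "fact (l + Suc n) = (real l + real n + 1) * (fact (l + n) :: real)"
    by (simp add: algebra_simps)
  moreover have "real l + real n + 1 \<noteq> 0" by linarith
  ultimately show ?thesis by (simp add: divide_simps)
qed

text \<open>Multiplying the three-term recurrence by its middle derivative and by the weight of
  order n + 1 turns the two outer terms into cross terms.\<close>

lemma legendre_sq_cross:
  assumes "n < l"
  shows "2 * real (Suc n) * x * legendre_sq 1 l (Suc n) x = legendre_cross l (Suc n) x + legendre_cross l n x"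
proof -
  define w where "w = (fact (l - Suc n) / fact (l + Suc n) :: real)"
  define D where "D = (\<lambda>k. rodrigues_deriv l (l + k) x)"
  define e where "e = (real l - real n) * (real l + real n + 1)"
  have rec: "2 * real (Suc n) * x * D (Suc n) = (1 - x\<^sup>2) * D (Suc (Suc n)) + e * D n"
    using rodrigues_deriv_recurrence_order[of x l n] by (simp add: D_def e_def)
  have "2 * real (Suc n) * x * legendre_sq 1 l (Suc n) x = w * (1 - x\<^sup>2) ^ n * D (Suc n) * (2 * real (Suc n) * x * D (Suc n))"
    by (simp add: legendre_sq_def w_def D_def power2_eq_square)
  also have "\<dots> = w * (1 - x\<^sup>2) ^ Suc n * D (Suc n) * D (Suc (Suc n)) + (w * e) * (1 - x\<^sup>2) ^ n * D n * D (Suc n)"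
    unfolding rec by (simp add: algebra_simps)
  also have "w * e = fact (l - n) / fact (l + n)"
    unfolding w_def e_def using order_weight_Suc[OF assms] by simp
  finally show ?thesis
    by (simp add: legendre_cross_def w_def D_def)
qed

text \<open>Order 0 carries no power of 1 - x^2, so nothing cancels the second copy of the cross
  term.\<close>

lemma DERIV_legendre_sq_0:
  "(legendre_sq 0 l 0 has_real_derivative 2 * legendre_cross l 0 x) (at x within S)"
  unfolding legendre_sq_def legendre_cross_def
  by (rule derivative_eq_intros refl | simp)+

text \<open>Differentiating the power of 1 - x^2 produces exactly the left side of
  \<open>legendre_sq_cross\<close>, which removes one of the two copies of
  \<open>legendre_cross l (Suc n)\<close>.\<close>

lemma DERIV_legendre_sq:
  assumes "n < l"
  shows "(legendre_sq 0 l (Suc n) has_real_derivative legendre_cross l (Suc n) x - legendre_cross l n x) (at x within S)"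
proof -
  have "(legendre_sq 0 l (Suc n) has_real_derivative
     2 * legendre_cross l (Suc n) x - 2 * real (Suc n) * x * legendre_sq 1 l (Suc n) x) (at x within S)"
    unfolding legendre_sq_def legendre_cross_def
    by (rule derivative_eq_intros refl | simp)+ (simp add: algebra_simps power2_eq_square)
  then show ?thesis unfolding legendre_sq_cross[OF assms] by simp
qed

text \<open>Abel summation with the increments of \<open>c\<close> expressed through neighbouring
  sums of \<open>d\<close>. It converts the differences of cross terms, which come from derivatives,
  into the sums that \<open>legendre_sq_cross\<close> evaluates. The boundary term is
  \<open>(c N + j * d N) * T N\<close>.\<close>

lemma sum_differences_eq_sum_means:
  fixes T c d :: "nat \<Rightarrow> real"
  assumes "T N = 0" "c 0 = 0" "d 0 = 0" "\<And>n. c (Suc n) - c n = j * (d n + d (Suc n))"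
  shows "(\<Sum>n<N. c (Suc n) * (T (Suc n) - T n)) = - j * (\<Sum>n<N. d (Suc n) * (T (Suc n) + T n))"
proof -
  have "(\<Sum>n<N. c (Suc n) * (T (Suc n) - T n)) + j * (\<Sum>n<N. d (Suc n) * (T (Suc n) + T n))
     = (c N + j * d N) * T N" for N
  proof (induction N)
    case (Suc N)
    have c: "c (Suc N) = c N + j * (d N + d (Suc N))"
      using assms(4)[of N] by simp
    show ?case using Suc unfolding c sum.lessThan_Suc by (simp add: algebra_simps)
  qed (simp add: assms)
  from this[of N] show ?thesis using assms(1) by simp
qed

text \<open>Only orders \<open>m \<ge> 0\<close> are used; the factor 2 accounts for the orders \<open>-m\<close>, which have the
  same density.\<close>

lemma sum_legendre_sq:
  "legendre_sq 0 l 0 x + 2 * (\<Sum>n<l. legendre_sq 0 l (Suc n) x) = (2 ^ l * fact l)\<^sup>2"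
proof -
  let ?F = "\<lambda>x. legendre_sq 0 l 0 x + 2 * (\<Sum>n<l. legendre_sq 0 l (Suc n) x)"
  have "(?F has_real_derivative 0) (at x)" for x
  proof -
    have "(?F has_real_derivative 2 * legendre_cross l 0 x
        + 2 * (\<Sum>n<l. legendre_cross l (Suc n) x - legendre_cross l n x)) (at x)"
      by (intro DERIV_add DERIV_cmult DERIV_sum DERIV_legendre_sq DERIV_legendre_sq_0) auto
    moreover have "(\<Sum>n<l. legendre_cross l (Suc n) x - legendre_cross l n x) = - legendre_cross l 0 x"
      using sum_lessThan_telescope[of "\<lambda>n. legendre_cross l n x" l] legendre_cross_top by simp
    ultimately show ?thesis by simp
  qed
  \<comment> \<open>The constant is read off at the pole, where every order but 0 vanishes. This is
    the addition theorem on the diagonal.\<close>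
  then have "?F x = ?F 1" by (intro DERIV_isconst_all allI)
  also have "\<dots> = (2 ^ l * fact l)\<^sup>2"
    by (simp add: legendre_sq_def rodrigues_deriv_at_1)
  finally show ?thesis .
qed

lemma legendre_sq_differentiable: "(\<lambda>x. legendre_sq j l m x) differentiable (at x)"
proof -
  have "(\<lambda>x. rodrigues_deriv l k x) differentiable (at x)" for k
    using DERIV_rodrigues_deriv real_differentiable_def by blast
  then show ?thesis
    unfolding legendre_sq_def by (intro derivative_intros) auto
qed

text \<open>The moment \<open>F = \<Sum>c(m) h\<^sub>m\<close> satisfies \<open>(1 - x\<^sup>2) F' = - 2 j x F\<close>, so \<open>F\<close> is a multiple of
  \<open>(1 - x\<^sup>2)\<^sup>j\<close>; the constant is read off at the pole \<open>x = 1\<close>.\<close>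

lemma sum_reduced_legendre_sq_eq:
  fixes c d :: "nat \<Rightarrow> real"
  assumes j: "1 \<le> j" and c: "\<And>m. c m = real m * d m" "\<And>m. m < j \<Longrightarrow> c m = 0" and d0: "d 0 = 0"
    and cd: "\<And>n. c (Suc n) - c n = real j * (d n + d (Suc n))"
    and x: "-1 < x" "x < 1"
  shows "(\<Sum>n<l. c (Suc n) * legendre_sq j l (Suc n) x) = (\<Sum>n<l. c (Suc n) * legendre_sq j l (Suc n) 1)"
proof -
  define G where "G = (\<lambda>x. \<Sum>n<l. c (Suc n) * legendre_sq j l (Suc n) x)"
  \<comment> \<open>Orders below \<open>j\<close>, for which truncated subtraction spoils the
    division by a power of 1 - y^2, have coefficient 0.\<close>
  have red: "(\<Sum>n<l. c (Suc n) * legendre_sq i l (Suc n) y) = (1 - y\<^sup>2) ^ (j - i) * G y" if "i \<le> j" for i y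
    unfolding G_def sum_distrib_left
  proof (rule sum.cong[OF refl])
    fix n
    show "c (Suc n) * legendre_sq i l (Suc n) y = (1 - y\<^sup>2) ^ (j - i) * (c (Suc n) * legendre_sq j l (Suc n) y)"
      using c(2)[of "Suc n"] legendre_sq_reduce[OF that, of "Suc n" l y] by (cases "j \<le> Suc n") auto
  qed
  obtain k where k: "j = Suc k" using j by (cases j) auto
  have "(G has_real_derivative 0) (at y)" if "y \<in> {x<..<1}" for y
  proof -
    from that x have y: "1 - y\<^sup>2 \<noteq> 0" by (auto simp: power2_eq_1_iff)
    have "G differentiable (at y)"
      unfolding G_def using legendre_sq_differentiable by (intro derivative_intros) auto
    then obtain G' where G': "(G has_real_derivative G') (at y)"
      using real_differentiable_def by auto
    have "((\<lambda>y. \<Sum>n<l. c (Suc n) * legendre_sq 0 l (Suc n) y) has_real_derivative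
       (\<Sum>n<l. c (Suc n) * (legendre_cross l (Suc n) y - legendre_cross l n y))) (at y)"
      by (intro DERIV_cmult DERIV_sum DERIV_legendre_sq) auto
    \<comment> \<open>Summation by parts replaces \<open>c\<close> by \<open>d\<close>; the ladder
      relation contributes the factor m, and m d(m) = c(m) restores the moment, now divided by 1 -
      y^2.\<close>
    also have "(\<Sum>n<l. c (Suc n) * (legendre_cross l (Suc n) y - legendre_cross l n y))
       = - real j * (\<Sum>n<l. d (Suc n) * (legendre_cross l (Suc n) y + legendre_cross l n y))"
      by (rule sum_differences_eq_sum_means) (use c cd d0 legendre_cross_top in auto)
    also have "\<dots> = - real j * (\<Sum>n<l. d (Suc n) * (2 * real (Suc n) * y * legendre_sq 1 l (Suc n) y))"
      using legendre_sq_cross by (intro arg_cong2[where f="(*)"] sum.cong) auto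
    also have "\<dots> = - 2 * real j * y * (\<Sum>n<l. c (Suc n) * legendre_sq 1 l (Suc n) y)"
      unfolding c(1) sum_distrib_left by (intro sum.cong) (auto simp: algebra_simps)
    also have "(\<Sum>n<l. c (Suc n) * legendre_sq 1 l (Suc n) y) = (1 - y\<^sup>2) ^ k * G y"
      using red[of 1 y] j k by simp
    also have "(\<lambda>y. \<Sum>n<l. c (Suc n) * legendre_sq 0 l (Suc n) y) = (\<lambda>y. (1 - y\<^sup>2) ^ j * G y)"
      using red[of 0] by auto
    finally have "((\<lambda>y. (1 - y\<^sup>2) ^ j * G y) has_real_derivative - 2 * real j * y * ((1 - y\<^sup>2) ^ k * G y)) (at y)" .
    \<comment> \<open>The product rule gives the same derivative plus (1 - y^2)^j G', hence G' =
      0.\<close>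
    moreover have "((\<lambda>y. (1 - y\<^sup>2) ^ j * G y) has_real_derivative
        (- 2 * real j * y * ((1 - y\<^sup>2) ^ k * G y)) + (1 - y\<^sup>2) ^ j * G') (at y)"
      unfolding k by (rule derivative_eq_intros G' refl | simp)+ algebra
    ultimately have "- 2 * real j * y * ((1 - y\<^sup>2) ^ k * G y) =
        (- 2 * real j * y * ((1 - y\<^sup>2) ^ k * G y)) + (1 - y\<^sup>2) ^ j * G'"
      by (rule DERIV_unique)
    then have "(1 - y\<^sup>2) ^ j * G' = 0" by linarith
    with y G' show ?thesis by simp
  qed
  \<comment> \<open>At the pole itself the factor (1 - y^2)^j vanishes and the identity says nothing
    about G', so the value there is reached by continuity.\<close>
  moreover have "continuous_on {x..1} G"
    unfolding G_def by (intro continuous_intros)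
  ultimately have "G 1 = G x"
    by (intro DERIV_isconst_end[of x 1 G]) (use x in auto)
  then show ?thesis by (simp add: G_def)
qed

lemma rodrigues_deriv_at_1_Suc:
  "rodrigues_deriv l (l + Suc n) 1 = (real l - real n) * (real l + real n + 1) / (2 * real (Suc n)) * rodrigues_deriv l (l + n) 1"
  using rodrigues_deriv_recurrence_order[of 1 l n] by (simp add: field_simps del: of_nat_Suc)

text \<open>The case j = 1, c(m) = m^2, d(m) = m: at the pole only order 1 survives. Over all orders
  the coefficient would be l (l + 1) / 2; the positive ones carry half of it.\<close>

lemma sum_square_order_legendre_sq:
  assumes "-1 < x" "x < 1"
  shows "(\<Sum>n<l. (real (Suc n))\<^sup>2 * legendre_sq 0 l (Suc n) x) =
    (1 - x\<^sup>2) * (real l * (real l + 1) / 4 * (2 ^ l * fact l)\<^sup>2)"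
proof (cases l)
  case (Suc k)
  have "(\<Sum>n<l. (real (Suc n))\<^sup>2 * legendre_sq 0 l (Suc n) x) = (1 - x\<^sup>2) * (\<Sum>n<l. (real (Suc n))\<^sup>2 * legendre_sq 1 l (Suc n) x)"
    unfolding sum_distrib_left by (intro sum.cong) (auto simp: legendre_sq_reduce[of 0 1] algebra_simps)
  also have "(\<Sum>n<l. (real (Suc n))\<^sup>2 * legendre_sq 1 l (Suc n) x) = (\<Sum>n<l. (real (Suc n))\<^sup>2 * legendre_sq 1 l (Suc n) 1)"
    by (rule sum_reduced_legendre_sq_eq[where c="\<lambda>m. (real m)\<^sup>2" and d=real])
      (use assms in \<open>auto simp: power2_eq_square algebra_simps\<close>)
  also have "\<dots> = (\<Sum>n<l. if n = 0 then fact (l - 1) / fact (l + 1) * (rodrigues_deriv l (l + 1) 1)\<^sup>2 else 0)"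
    by (intro sum.cong) (auto simp: legendre_sq_def)
  also have "\<dots> = fact (l - 1) / fact (l + 1) * (rodrigues_deriv l (l + 1) 1)\<^sup>2"
    using Suc by simp
  also have "\<dots> = real l * (real l + 1) / 4 * (2 ^ l * fact l)\<^sup>2"
  proof -
    define w where "w = (fact (l - 1) / fact (l + 1) :: real)"
    define A where "A = (2 ^ l * fact l :: real)"
    have w: "w * (real l * (real l + 1)) = 1"
      using order_weight_Suc[of 0 l] Suc by (simp add: w_def)
    have "rodrigues_deriv l (l + 1) 1 = real l * (real l + 1) / 2 * A"
      using rodrigues_deriv_at_1_Suc[of l 0] rodrigues_deriv_at_1[of l] by (simp add: A_def)
    then have D: "(rodrigues_deriv l (l + 1) 1)\<^sup>2 = (real l * (real l + 1) / 2 * A)\<^sup>2"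
      by (simp only:)
    have "w * (rodrigues_deriv l (l + 1) 1)\<^sup>2 =
       (w * (real l * (real l + 1))) * (real l * (real l + 1) / 4 * A\<^sup>2)"
      unfolding D by (simp add: power2_eq_square)
    then show ?thesis unfolding w by (simp add: w_def A_def)
  qed
  finally show ?thesis .
qed simp

text \<open>The case j = 2, d(m) = m^3 - m. The coefficient m^4 - m^2 stands in for m^4 because it
  vanishes at orders 0 and 1, which do not contain the factor (1 - x^2)^2. At the pole only order 2
  survives, with coefficient 2^4 - 2^2 = 12.\<close>

lemma sum_fourth_order_legendre_sq:
  assumes "-1 < x" "x < 1" "2 \<le> l"
  shows "(\<Sum>n<l. ((real (Suc n))^4 - (real (Suc n))\<^sup>2) * legendre_sq 0 l (Suc n) x) =
    (1 - x\<^sup>2)\<^sup>2 * (3 * (real l - 1) * real l * (real l + 1) * (real l + 2) / 16 * (2 ^ l * fact l)\<^sup>2)"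
proof -
  have "(\<Sum>n<l. ((real (Suc n))^4 - (real (Suc n))\<^sup>2) * legendre_sq 0 l (Suc n) x)
     = (1 - x\<^sup>2)\<^sup>2 * (\<Sum>n<l. ((real (Suc n))^4 - (real (Suc n))\<^sup>2) * legendre_sq 2 l (Suc n) x)"
    unfolding sum_distrib_left
  proof (rule sum.cong[OF refl])
    fix n
    show "((real (Suc n))^4 - (real (Suc n))\<^sup>2) * legendre_sq 0 l (Suc n) x
      = (1 - x\<^sup>2)\<^sup>2 * (((real (Suc n))^4 - (real (Suc n))\<^sup>2) * legendre_sq 2 l (Suc n) x)"
      by (cases n) (auto simp: legendre_sq_reduce[of 0 2 _ l x])
  qed
  also have "(\<Sum>n<l. ((real (Suc n))^4 - (real (Suc n))\<^sup>2) * legendre_sq 2 l (Suc n) x)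
    = (\<Sum>n<l. ((real (Suc n))^4 - (real (Suc n))\<^sup>2) * legendre_sq 2 l (Suc n) 1)"
    by (rule sum_reduced_legendre_sq_eq[where c="\<lambda>m. (real m)^4 - (real m)\<^sup>2" and d="\<lambda>m. (real m)^3 - real m"])
      (use assms in \<open>auto simp: power2_eq_square power4_eq_xxxx power3_eq_cube algebra_simps less_2_cases_iff\<close>)
  also have "\<dots> = (\<Sum>n<l. if n = 1 then 12 * (fact (l - 2) / fact (l + 2) * (rodrigues_deriv l (l + 2) 1)\<^sup>2) else 0)"
  proof (rule sum.cong[OF refl])
    fix n
    consider "n = 0" | "n = 1" | k where "n = Suc (Suc k)" by (metis One_nat_def not0_implies_Suc)
    then show "((real (Suc n))^4 - (real (Suc n))\<^sup>2) * legendre_sq 2 l (Suc n) 1 =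
      (if n = 1 then 12 * (fact (l - 2) / fact (l + 2) * (rodrigues_deriv l (l + 2) 1)\<^sup>2) else 0)"
      by cases (auto simp: legendre_sq_def numeral_2_eq_2)
  qed
  also have "\<dots> = 12 * (fact (l - 2) / fact (l + 2) * (rodrigues_deriv l (l + 2) 1)\<^sup>2)"
    using assms by simp
  also have "\<dots> = 3 * (real l - 1) * real l * (real l + 1) * (real l + 2) / 16 * (2 ^ l * fact l)\<^sup>2"
  proof -
    define w where "w = (fact (l - 2) / fact (l + 2) :: real)"
    define A where "A = (2 ^ l * fact l :: real)"
    have "1 = (fact (l - 1) / fact (l + 1) :: real) * (real l * (real l + 1))"
      using order_weight_Suc[of 0 l] assms by simp
    also have "(fact (l - 1) / fact (l + 1) :: real) = w * ((real l - 1) * (real l + 2))"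
      using order_weight_Suc[of 1 l] assms by (simp add: w_def numeral_2_eq_2 algebra_simps)
    finally have w: "w * ((real l - 1) * (real l + 2) * (real l * (real l + 1))) = 1" by simp
    have "rodrigues_deriv l (l + 1) 1 = real l * (real l + 1) / 2 * A"
      using rodrigues_deriv_at_1_Suc[of l 0] rodrigues_deriv_at_1[of l] by (simp add: A_def)
    moreover have "rodrigues_deriv l (l + 2) 1 = (real l - 1) * (real l + 2) / 4 * rodrigues_deriv l (l + 1) 1"
      using rodrigues_deriv_at_1_Suc[of l 1] by (simp add: numeral_2_eq_2 add_ac)
    ultimately have "rodrigues_deriv l (l + 2) 1 = (real l - 1) * (real l + 2) / 4 * (real l * (real l + 1) / 2 * A)"
      by (simp only:)
    then have "rodrigues_deriv l (l + 2) 1 = (real l - 1) * (real l + 2) * (real l * (real l + 1)) / 8 * A"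
      by simp
    then have D: "(rodrigues_deriv l (l + 2) 1)\<^sup>2 = ((real l - 1) * (real l + 2) * (real l * (real l + 1)) / 8 * A)\<^sup>2"
      by (simp only:)
    have "12 * (w * (rodrigues_deriv l (l + 2) 1)\<^sup>2) =
       (w * ((real l - 1) * (real l + 2) * (real l * (real l + 1)))) * (3 / 16 * ((real l - 1) * (real l + 2) * (real l * (real l + 1))) * A\<^sup>2)"
      unfolding D by (simp add: power2_eq_square)
    also have "\<dots> = 3 * (real l - 1) * real l * (real l + 1) * (real l + 2) / 16 * A\<^sup>2"
      unfolding w by simp
    finally show ?thesis by (simp add: w_def A_def)
  qed
  finally show ?thesis .
qed


section \<open>Integrals of the squared Legendre functions\<close>

lemma integral_real_derivative:
  fixes f f' :: "real \<Rightarrow> real"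
  assumes "\<And>x. (f has_real_derivative f' x) (at x)"
  shows "(f' has_integral (f 1 - f (-1))) {-1..1}"
  by (rule fundamental_theorem_of_calculus)
    (use assms in \<open>auto simp: has_real_derivative_iff_has_vector_derivative[symmetric] intro: DERIV_subset\<close>)

lemma legendre_sq_nonneg: "x \<in> {-1..1} \<Longrightarrow> 0 \<le> legendre_sq j l m x"
  unfolding legendre_sq_def
  by (intro mult_nonneg_nonneg zero_le_power zero_le_power2 divide_nonneg_nonneg) (auto simp: abs_square_le_1)

lemma legendre_sq_at_ends: "legendre_sq 0 l (Suc m) 1 = 0" "legendre_sq 0 l (Suc m) (-1) = 0"
  by (simp_all add: legendre_sq_def)

text \<open>Integration by parts. In Sturm-Liouville form the recurrence says that (1 - x^2)^(m+1)
  D_(m+1) has derivative -e (1 - x^2)^m D_m. The primitive vanishes at both ends, and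
  \<open>w * e\<close> is the weight of order m.\<close>

lemma integral_legendre_sq_Suc:
  assumes "m < l"
  shows "integral {-1..1} (legendre_sq 0 l (Suc m)) = integral {-1..1} (legendre_sq 0 l m)"
proof -
  define w where "w = (fact (l - Suc m) / fact (l + Suc m) :: real)"
  define e where "e = (real l - real m) * (real l + real m + 1)"
  let ?D = "\<lambda>k x. rodrigues_deriv l (l + k) x"
  have w: "fact (l - m) / fact (l + m) = w * e"
    using order_weight_Suc[OF assms] by (simp add: w_def e_def)
  have "((\<lambda>x. w * (1 - x\<^sup>2) ^ Suc m * ?D m x * ?D (Suc m) x) has_real_derivative
      legendre_sq 0 l (Suc m) x - legendre_sq 0 l m x) (at x)" for x
  proof -
    have "((\<lambda>x. w * (1 - x\<^sup>2) ^ Suc m * ?D m x * ?D (Suc m) x) has_real_derivative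
        w * (1 - x\<^sup>2) ^ Suc m * (?D (Suc m) x)\<^sup>2
        + w * (1 - x\<^sup>2) ^ m * ?D m x * ((1 - x\<^sup>2) * ?D (Suc (Suc m)) x - 2 * real (Suc m) * x * ?D (Suc m) x)) (at x)"
      by (rule derivative_eq_intros refl | simp)+ (simp add: algebra_simps power2_eq_square)
    also have "(1 - x\<^sup>2) * ?D (Suc (Suc m)) x - 2 * real (Suc m) * x * ?D (Suc m) x = - e * ?D m x"
      using rodrigues_deriv_recurrence_order[of x l m] by (simp add: e_def)
    finally show ?thesis
      unfolding legendre_sq_def w by (simp add: w_def power2_eq_square algebra_simps)
  qed
  from integral_real_derivative[OF this]
  have "integral {-1..1} (\<lambda>x. legendre_sq 0 l (Suc m) x - legendre_sq 0 l m x) = 0"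
    by (auto simp: has_integral_iff)
  then show ?thesis
    by (subst (asm) integral_diff) (auto intro!: integrable_continuous_real continuous_intros)
qed

text \<open>No single integral is evaluated: the 2 l + 1 orders have equal integrals, and
  \<open>sum_legendre_sq\<close> makes their sum the integral of a constant.\<close>

lemma integral_legendre_sq:
  assumes "m \<le> l"
  shows "integral {-1..1} (legendre_sq 0 l m) = 2 * (2 ^ l * fact l)\<^sup>2 / (2 * real l + 1)"
proof -
  let ?H = "\<lambda>m. integral {-1..1} (legendre_sq 0 l m)"
  have eq: "?H m = ?H 0" if "m \<le> l" for m
    using that by (induction m) (simp_all add: integral_legendre_sq_Suc)
  have int: "legendre_sq 0 l m integrable_on {-1..1}" for m
    by (intro integrable_continuous_real continuous_intros)
  have "2 * (2 ^ l * fact l)\<^sup>2 = integral {-1..1::real} (\<lambda>x. (2 ^ l * fact l)\<^sup>2 :: real)" by simp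
  also have "\<dots> = integral {-1..1} (\<lambda>x. legendre_sq 0 l 0 x + 2 * (\<Sum>n<l. legendre_sq 0 l (Suc n) x))"
    unfolding sum_legendre_sq ..
  also have "\<dots> = ?H 0 + 2 * (\<Sum>n<l. ?H (Suc n))"
  proof -
    have "(\<lambda>x. 2 * (\<Sum>n<l. legendre_sq 0 l (Suc n) x)) integrable_on {-1..1}"
      by (intro integrable_continuous_real continuous_intros)
    from integral_add[OF int this] show ?thesis
      by (simp add: integral_sum int)
  qed
  also have "(\<Sum>n<l. ?H (Suc n)) = (\<Sum>n<l. ?H 0)"
    by (intro sum.cong refl eq) auto
  also have "?H 0 + 2 * (\<Sum>n<l. ?H 0) = (2 * real l + 1) * ?H m"
    unfolding eq[OF assms] by (simp add: algebra_simps)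
  finally show ?thesis by (simp add: field_simps)
qed

text \<open>Downward induction from m = l, where the cross term vanishes. Integrating the derivative
  of x h_(m+1) shows that each step down adds one copy of the integral common to all orders.\<close>

lemma integral_times_legendre_cross:
  assumes "m \<le> l"
  shows "integral {-1..1} (\<lambda>x. x * legendre_cross l m x) =
    (real l - real m) * integral {-1..1} (legendre_sq 0 l l)"
  using assms
proof (induction m rule: inc_induct)
  case base
  then show ?case by (simp add: legendre_cross_top)
next
  case (step m)
  have int: "legendre_sq 0 l k integrable_on {-1..1}" "(\<lambda>x. x * legendre_cross l k x) integrable_on {-1..1}" for k
    by (intro integrable_continuous_real continuous_intros)+
  have "((\<lambda>x. x * legendre_sq 0 l (Suc m) x) has_real_derivative
     legendre_sq 0 l (Suc m) x + (x * legendre_cross l (Suc m) x - x * legendre_cross l m x)) (at x)" for x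
    using DERIV_mult[OF DERIV_ident DERIV_legendre_sq[OF \<open>m < l\<close>]] by (simp add: algebra_simps)
  from integral_real_derivative[OF this]
  have "0 = integral {-1..1} (\<lambda>x. legendre_sq 0 l (Suc m) x + (x * legendre_cross l (Suc m) x - x * legendre_cross l m x))"
    unfolding legendre_sq_at_ends by (simp add: has_integral_iff)
  also have "\<dots> = integral {-1..1} (legendre_sq 0 l (Suc m)) + (integral {-1..1} (\<lambda>x. x * legendre_cross l (Suc m) x)
     - integral {-1..1} (\<lambda>x. x * legendre_cross l m x))"
    unfolding integral_add[OF int(1) integrable_diff[OF int(2) int(2)]] integral_diff[OF int(2) int(2)] ..
  also have "integral {-1..1} (legendre_sq 0 l (Suc m)) = integral {-1..1} (legendre_sq 0 l l)"
    using step.hyps by (simp add: integral_legendre_sq)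
  finally show ?case
    unfolding step.IH by (simp add: algebra_simps)
qed

text \<open>For m close to l this expresses concentration at the equator. Only a factor 1 - x^2 is
  lost; then the ladder relation makes the integral exact, its two cross terms contributing l - m
  and l - m + 1 copies of the common integral.\<close>

lemma integral_square_times_legendre_sq:
  assumes "1 \<le> m" "m \<le> l"
  shows "integral {-1..1} (\<lambda>x. x\<^sup>2 * legendre_sq 0 l m x)
    \<le> (2 * (real l - real m) + 1) / (2 * real m) * integral {-1..1} (legendre_sq 0 l m)"
proof -
  obtain n where n: "m = Suc n" "n < l" using assms by (cases m) auto
  have int: "(\<lambda>x. x * legendre_cross l k x) integrable_on {-1..1}" for k
    by (intro integrable_continuous_real continuous_intros)
  have "integral {-1..1} (\<lambda>x. x\<^sup>2 * legendre_sq 0 l m x) \<le> integral {-1..1} (\<lambda>x. x\<^sup>2 * legendre_sq 1 l m x)"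
  proof (rule integral_le)
    fix x :: real assume x: "x \<in> {-1..1}"
    have "legendre_sq 0 l m x = (1 - x\<^sup>2) * legendre_sq 1 l m x"
      using legendre_sq_reduce[of 0 1 m l x] assms by simp
    also have "\<dots> \<le> 1 * legendre_sq 1 l m x"
      using legendre_sq_nonneg[OF x] by (intro mult_right_mono) auto
    finally show "x\<^sup>2 * legendre_sq 0 l m x \<le> x\<^sup>2 * legendre_sq 1 l m x"
      by (intro mult_left_mono) auto
  qed (intro integrable_continuous_real continuous_intros)+
  also have "(\<lambda>x. x\<^sup>2 * legendre_sq 1 l m x) =
     (\<lambda>x. (x * legendre_cross l (Suc n) x + x * legendre_cross l n x) / (2 * real m))"
  proof
    fix x
    have "x * legendre_cross l (Suc n) x + x * legendre_cross l n x = x * (2 * real (Suc n) * x * legendre_sq 1 l (Suc n) x)"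
      unfolding legendre_sq_cross[OF n(2)] by (simp add: algebra_simps)
    then show "x\<^sup>2 * legendre_sq 1 l m x = (x * legendre_cross l (Suc n) x + x * legendre_cross l n x) / (2 * real m)"
      using n by (simp add: power2_eq_square field_simps del: of_nat_Suc)
  qed
  also have "integral {-1..1} \<dots> = (integral {-1..1} (\<lambda>x. x * legendre_cross l (Suc n) x)
      + integral {-1..1} (\<lambda>x. x * legendre_cross l n x)) / (2 * real m)"
    using int by (simp add: integral_add)
  also have "\<dots> = (2 * (real l - real m) + 1) / (2 * real m) * integral {-1..1} (legendre_sq 0 l l)"
    using n by (simp add: integral_times_legendre_cross field_simps)
  also have "integral {-1..1} (legendre_sq 0 l l) = integral {-1..1} (legendre_sq 0 l m)"
    using assms by (simp add: integral_legendre_sq)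
  finally show ?thesis .
qed


section \<open>Orthonormal systems in \<open>L\<^sup>2\<close>\<close>

lemma borel_measurable_cnj [measurable]: "cnj \<in> borel_measurable borel"
  by (intro borel_measurable_continuous_onI continuous_intros)

lemma L2_spaceD:
  assumes "f \<in> L2_space M"
  shows L2_space_measurable: "f \<in> borel_measurable M"
    and L2_space_integrable: "integrable M (\<lambda>x. (cmod (f x))\<^sup>2)"
  using assms by (auto simp: L2_space_def)

lemma cmod_add_square_le: "(cmod (a + b))\<^sup>2 \<le> 2 * (cmod a)\<^sup>2 + 2 * (cmod b)\<^sup>2"
proof -
  have "(cmod (a + b))\<^sup>2 \<le> (cmod a + cmod b)\<^sup>2"
    by (intro power_mono norm_triangle_ineq norm_ge_zero)
  also have "\<dots> \<le> 2 * (cmod a)\<^sup>2 + 2 * (cmod b)\<^sup>2"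
    using zero_le_power2[of "cmod a - cmod b"] by (simp add: power2_eq_square algebra_simps)
  finally show ?thesis .
qed

lemma L2_space_zero: "(\<lambda>x. 0) \<in> L2_space M"
  by (simp add: L2_space_def)

lemma L2_space_cmult:
  assumes "f \<in> L2_space M"
  shows "(\<lambda>x. a * f x) \<in> L2_space M"
  using L2_spaceD[OF assms] by (auto simp: L2_space_def norm_mult power_mult_distrib)

lemma L2_space_add:
  assumes f: "f \<in> L2_space M" and g: "g \<in> L2_space M"
  shows "(\<lambda>x. f x + g x) \<in> L2_space M"
proof -
  note [measurable] = L2_space_measurable[OF f] L2_space_measurable[OF g]
  have "integrable M (\<lambda>x. (cmod (f x + g x))\<^sup>2)"
  proof (rule Bochner_Integration.integrable_bound)
    show "integrable M (\<lambda>x. 2 * (cmod (f x))\<^sup>2 + 2 * (cmod (g x))\<^sup>2)"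
      using L2_space_integrable[OF f] L2_space_integrable[OF g] by auto
  qed (use cmod_add_square_le in auto)
  then show ?thesis by (simp add: L2_space_def)
qed

lemma L2_space_lincomb:
  assumes f: "f \<in> L2_space M" and g: "g \<in> L2_space M"
  shows "(\<lambda>x. a * f x + b * g x) \<in> L2_space M"
  by (intro L2_space_add L2_space_cmult assms)

lemma L2_space_diff:
  assumes f: "f \<in> L2_space M" and g: "g \<in> L2_space M"
  shows "(\<lambda>x. f x - g x) \<in> L2_space M"
  using L2_space_lincomb[OF assms, of 1 "-1"] by simp

lemma L2_space_sum:
  assumes "\<And>b. b \<in> F \<Longrightarrow> u b \<in> L2_space M"
  shows "(\<lambda>x. \<Sum>b\<in>F. c b * u b x) \<in> L2_space M"
  using assms
  by (induction F rule: infinite_finite_induct) (auto intro!: L2_space_zero L2_space_add L2_space_cmult)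

lemma L2_inner_integrable:
  assumes f: "f \<in> L2_space M" and g: "g \<in> L2_space M"
  shows "integrable M (\<lambda>x. cnj (f x) * g x)"
proof (rule Bochner_Integration.integrable_bound)
  note [measurable] = L2_space_measurable[OF f] L2_space_measurable[OF g]
  show "integrable M (\<lambda>x. (cmod (f x))\<^sup>2 + (cmod (g x))\<^sup>2)"
    using L2_space_integrable[OF f] L2_space_integrable[OF g] by auto
  show "(\<lambda>x. cnj (f x) * g x) \<in> borel_measurable M"
    by (intro borel_measurable_times measurable_compose[OF _ borel_measurable_cnj]) measurable
  have "cmod a * cmod b \<le> (cmod a)\<^sup>2 + (cmod b)\<^sup>2" for a b
  proof -
    have "0 \<le> cmod a * cmod b" by simp
    moreover have "2 * (cmod a * cmod b) \<le> (cmod a)\<^sup>2 + (cmod b)\<^sup>2"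
      using sum_squares_bound[of "cmod a" "cmod b"] by (simp only: mult.assoc)
    ultimately show ?thesis by linarith
  qed
  then show "AE x in M. norm (cnj (f x) * g x) \<le> norm ((cmod (f x))\<^sup>2 + (cmod (g x))\<^sup>2)"
    by (simp add: norm_mult)
qed

lemma L2_inner_commute: "L2_inner M g f = cnj (L2_inner M f g)"
  unfolding L2_inner_def by (subst Bochner_Integration.integral_cnj[symmetric]) (simp add: mult.commute)

lemma L2_inner_cmult_right: "L2_inner M f (\<lambda>x. a * g x) = a * L2_inner M f g"
  unfolding L2_inner_def by (simp add: mult.left_commute)

lemma L2_inner_add_right:
  assumes "f \<in> L2_space M" "g \<in> L2_space M" "h \<in> L2_space M"
  shows "L2_inner M f (\<lambda>x. g x + h x) = L2_inner M f g + L2_inner M f h"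
  unfolding L2_inner_def distrib_left
  by (intro Bochner_Integration.integral_add L2_inner_integrable assms)

lemma L2_inner_diff_right:
  assumes "f \<in> L2_space M" "g \<in> L2_space M" "h \<in> L2_space M"
  shows "L2_inner M f (\<lambda>x. g x - h x) = L2_inner M f g - L2_inner M f h"
  unfolding L2_inner_def right_diff_distrib
  by (intro Bochner_Integration.integral_diff L2_inner_integrable assms)

lemma L2_inner_diff_left:
  assumes "f \<in> L2_space M" "g \<in> L2_space M" "h \<in> L2_space M"
  shows "L2_inner M (\<lambda>x. g x - h x) f = L2_inner M g f - L2_inner M h f"
  using L2_inner_diff_right[OF assms]
  by (simp add: L2_inner_commute[of M _ f])

lemma L2_inner_sum_right:
  assumes "f \<in> L2_space M" "\<And>b. b \<in> F \<Longrightarrow> u b \<in> L2_space M"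
  shows "L2_inner M f (\<lambda>x. \<Sum>b\<in>F. c b * u b x) = (\<Sum>b\<in>F. c b * L2_inner M f (u b))"
  using assms(2)
  by (induction F rule: infinite_finite_induct)
    (simp_all add: L2_inner_add_right L2_inner_cmult_right L2_space_sum L2_space_cmult assms(1),
      simp_all add: L2_inner_def)

lemma L2_inner_sum_left:
  assumes "f \<in> L2_space M" "\<And>b. b \<in> F \<Longrightarrow> u b \<in> L2_space M"
  shows "L2_inner M (\<lambda>x. \<Sum>b\<in>F. c b * u b x) f = (\<Sum>b\<in>F. cnj (c b) * L2_inner M (u b) f)"
proof -
  have "L2_inner M f (\<lambda>x. \<Sum>b\<in>F. c b * u b x) = (\<Sum>b\<in>F. c b * L2_inner M f (u b))"
    by (rule L2_inner_sum_right[OF assms])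
  then show ?thesis by (simp add: L2_inner_commute[of M _ f])
qed

lemma L2_norm_nonneg: "0 \<le> L2_norm M f"
  by (simp add: L2_norm_def)

lemma L2_norm_square: "(L2_norm M f)\<^sup>2 = (LINT x|M. (cmod (f x))\<^sup>2)"
  by (simp add: L2_norm_def)

lemma L2_inner_self: "L2_inner M f f = complex_of_real ((L2_norm M f)\<^sup>2)"
  unfolding L2_inner_def L2_norm_square integral_complex_of_real[symmetric]
  by (intro arg_cong2[where f=lebesgue_integral] refl ext) (simp only: complex_norm_square mult.commute)

lemma L2_norm_cmult: "L2_norm M (\<lambda>x. a * f x) = cmod a * L2_norm M f"
  by (simp add: L2_norm_def norm_mult power_mult_distrib real_sqrt_mult)

lemma L2_norm_eq_0_iff:
  assumes "f \<in> L2_space M"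
  shows "L2_norm M f = 0 \<longleftrightarrow> (AE x in M. f x = 0)"
  unfolding L2_norm_def using integral_nonneg_eq_0_iff_AE[OF L2_space_integrable[OF assms]] by simp

lemma L2_norm_diff_square_le:
  assumes "f \<in> L2_space M" "g \<in> L2_space M"
  shows "(L2_norm M (\<lambda>x. f x - g x))\<^sup>2 \<le> 2 * (L2_norm M f)\<^sup>2 + 2 * (L2_norm M g)\<^sup>2"
proof -
  have "(LINT x|M. (cmod (f x - g x))\<^sup>2) \<le> (LINT x|M. 2 * (cmod (f x))\<^sup>2 + 2 * (cmod (g x))\<^sup>2)"
    using assms L2_space_diff[OF assms]
    by (intro integral_mono Bochner_Integration.integrable_add integrable_mult_right L2_space_integrable)
      (use cmod_add_square_le[of "f _" "- g _"] in auto)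
  also have "\<dots> = 2 * (LINT x|M. (cmod (f x))\<^sup>2) + 2 * (LINT x|M. (cmod (g x))\<^sup>2)"
    using assms[THEN L2_space_integrable] by simp
  finally show ?thesis by (simp add: L2_norm_square)
qed

lemma L2_norm_cong_AE:
  assumes "f \<in> borel_measurable M" "g \<in> borel_measurable M" "AE x in M. f x = g x"
  shows "L2_norm M f = L2_norm M g"
proof -
  note [measurable] = assms(1,2)
  have "(LINT x|M. (cmod (f x))\<^sup>2) = (LINT x|M. (cmod (g x))\<^sup>2)"
    by (intro integral_cong_AE) (use assms(3) in auto)
  then show ?thesis by (simp add: L2_norm_def)
qed

lemma L2_inner_cong_AE:
  assumes "f \<in> borel_measurable M" "g \<in> borel_measurable M" "h \<in> borel_measurable M" "AE x in M. g x = h x"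
  shows "L2_inner M f g = L2_inner M f h"
proof -
  note [measurable] = assms(1-3)
  show ?thesis unfolding L2_inner_def
    by (intro integral_cong_AE) (use assms(4) in auto)
qed

section \<open>Bessel's inequality and extension to an orthonormal basis\<close>

definition L2_orthonormal :: "'a measure \<Rightarrow> ('a \<Rightarrow> complex) set \<Rightarrow> bool" where
  "L2_orthonormal M B \<longleftrightarrow> B \<subseteq> L2_space M \<and>
     (\<forall>b\<in>B. \<forall>b'\<in>B. L2_inner M b b' = (if b = b' then 1 else 0))"

lemma L2_orthonormalD:
  assumes "L2_orthonormal M B"
  shows "b \<in> B \<Longrightarrow> b \<in> L2_space M"
    and "b \<in> B \<Longrightarrow> b' \<in> B \<Longrightarrow> L2_inner M b b' = (if b = b' then 1 else 0)"
  using assms by (auto simp: L2_orthonormal_def)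

lemma L2_orthonormal_subset: "L2_orthonormal M B \<Longrightarrow> F \<subseteq> B \<Longrightarrow> L2_orthonormal M F"
  unfolding L2_orthonormal_def by blast

lemma L2_orthonormal_norm:
  assumes "L2_orthonormal M B" "b \<in> B"
  shows "L2_norm M b = 1"
proof -
  have "complex_of_real ((L2_norm M b)\<^sup>2) = complex_of_real 1"
    using L2_orthonormalD(2)[OF assms(1) assms(2) assms(2)] by (simp add: L2_inner_self)
  then have "(L2_norm M b)\<^sup>2 = 1" by (simp only: of_real_eq_iff)
  then show ?thesis using L2_norm_nonneg[of M b] by (simp add: power2_eq_1_iff)
qed

definition L2_projection :: "'a measure \<Rightarrow> ('a \<Rightarrow> complex) set \<Rightarrow> 'a L2_operator" where
  "L2_projection M F f = (\<lambda>x. \<Sum>b\<in>F. L2_inner M b f * b x)"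

lemma L2_projection_space:
  assumes "L2_orthonormal M F"
  shows "L2_projection M F f \<in> L2_space M"
  unfolding L2_projection_def using L2_orthonormalD(1)[OF assms] by (intro L2_space_sum)

lemma L2_inner_orthonormal_sum:
  assumes "L2_orthonormal M B" "finite F" "F \<subseteq> B" "b \<in> B"
  shows "L2_inner M b (\<lambda>x. \<Sum>b'\<in>F. c b' * b' x) = (if b \<in> F then c b else 0)"
proof -
  have "L2_inner M b (\<lambda>x. \<Sum>b'\<in>F. c b' * b' x) = (\<Sum>b'\<in>F. c b' * L2_inner M b b')"
    using assms L2_orthonormalD(1)[OF assms(1)] by (intro L2_inner_sum_right) auto
  also have "\<dots> = (\<Sum>b'\<in>F. if b' = b then c b' else 0)"
    using assms L2_orthonormalD(2)[OF assms(1)] by (intro sum.cong) auto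
  finally show ?thesis using assms(2) by simp
qed

lemma L2_norm_orthonormal_sum:
  assumes "L2_orthonormal M F" "finite F"
  shows "(L2_norm M (\<lambda>x. \<Sum>b\<in>F. c b * b x))\<^sup>2 = (\<Sum>b\<in>F. (cmod (c b))\<^sup>2)"
proof -
  have "complex_of_real ((L2_norm M (\<lambda>x. \<Sum>b\<in>F. c b * b x))\<^sup>2) =
     (\<Sum>b\<in>F. cnj (c b) * L2_inner M b (\<lambda>x. \<Sum>b\<in>F. c b * b x))"
    unfolding L2_inner_self[symmetric] using L2_orthonormalD(1)[OF assms(1)]
    by (intro L2_inner_sum_left L2_space_sum) auto
  also have "\<dots> = (\<Sum>b\<in>F. cnj (c b) * c b)"
    using L2_inner_orthonormal_sum[OF assms(1,2) subset_refl] by (intro sum.cong) auto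
  also have "\<dots> = complex_of_real (\<Sum>b\<in>F. (cmod (c b))\<^sup>2)"
    unfolding of_real_sum by (intro sum.cong refl) (simp only: complex_norm_square mult.commute)
  finally show ?thesis by (simp only: of_real_eq_iff)
qed

lemma L2_norm_diff_projection:
  assumes "L2_orthonormal M F" "finite F" "f \<in> L2_space M"
  shows "(L2_norm M (\<lambda>x. f x - L2_projection M F f x))\<^sup>2 =
    (L2_norm M f)\<^sup>2 - (\<Sum>b\<in>F. (cmod (L2_inner M b f))\<^sup>2)"
proof -
  let ?P = "L2_projection M F f"
  let ?s = "\<Sum>b\<in>F. (cmod (L2_inner M b f))\<^sup>2"
  note P = L2_projection_space[OF assms(1), of f]
  note d = L2_space_diff[OF assms(3) P]
  have fP: "L2_inner M f ?P = complex_of_real ?s"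
  proof -
    have "L2_inner M f ?P = (\<Sum>b\<in>F. L2_inner M b f * L2_inner M f b)"
      unfolding L2_projection_def using L2_orthonormalD(1)[OF assms(1)] assms(3)
      by (intro L2_inner_sum_right) auto
    also have "\<dots> = complex_of_real ?s"
      unfolding of_real_sum by (intro sum.cong refl) (simp only: complex_norm_square L2_inner_commute[of M f])
    finally show ?thesis .
  qed
  have PP: "L2_inner M ?P ?P = complex_of_real ?s"
    unfolding L2_inner_self using L2_norm_orthonormal_sum[OF assms(1,2)] by (simp add: L2_projection_def)
  have "L2_inner M (\<lambda>x. f x - ?P x) (\<lambda>x. f x - ?P x) =
     L2_inner M f f - L2_inner M f ?P - (L2_inner M ?P f - L2_inner M ?P ?P)"
    using P assms(3) d by (simp add: L2_inner_diff_left L2_inner_diff_right)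
  also have "L2_inner M ?P f = complex_of_real ?s"
    unfolding L2_inner_commute[of M ?P f] fP by simp
  finally have "complex_of_real ((L2_norm M (\<lambda>x. f x - ?P x))\<^sup>2) = complex_of_real ((L2_norm M f)\<^sup>2 - ?s)"
    unfolding L2_inner_self fP PP[unfolded L2_inner_self] by simp
  then show ?thesis by (simp only: of_real_eq_iff)
qed

lemma L2_bessel:
  assumes "L2_orthonormal M F" "finite F" "f \<in> L2_space M"
  shows "(\<Sum>b\<in>F. (cmod (L2_inner M b f))\<^sup>2) \<le> (L2_norm M f)\<^sup>2"
  using L2_norm_diff_projection[OF assms] zero_le_power2[of "L2_norm M (\<lambda>x. f x - L2_projection M F f x)"]
  by linarith

text \<open>Bessel's inequality for the single vector f / |f|; a null function f is treated
  apart.\<close>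

lemma L2_Cauchy_Schwarz:
  assumes f: "f \<in> L2_space M" and g: "g \<in> L2_space M"
  shows "cmod (L2_inner M f g) \<le> L2_norm M f * L2_norm M g"
proof (cases "L2_norm M f = 0")
  case True
  then have "AE x in M. f x = 0" using L2_norm_eq_0_iff[OF f] by simp
  note [measurable] = L2_space_measurable[OF f] L2_space_measurable[OF g]
  have "L2_inner M f g = (LINT x|M. 0)"
    unfolding L2_inner_def by (intro integral_cong_AE) (use \<open>AE x in M. f x = 0\<close> in auto)
  then show ?thesis using True by simp
next
  case False
  define n where "n = L2_norm M f"
  have n: "n > 0" using False L2_norm_nonneg[of M f] by (simp add: n_def)
  define u where "u = (\<lambda>x. complex_of_real (1 / n) * f x)"
  have u: "u \<in> L2_space M" unfolding u_def by (intro L2_space_cmult f)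
  have "L2_norm M u = cmod (complex_of_real (1 / n)) * n"
    unfolding u_def L2_norm_cmult n_def ..
  also have "\<dots> = 1" using n by (simp add: norm_divide)
  finally have "L2_orthonormal M {u}"
    using u by (simp add: L2_orthonormal_def L2_inner_self)
  from L2_bessel[OF this _ g] have "(cmod (L2_inner M u g))\<^sup>2 \<le> (L2_norm M g)\<^sup>2" by simp
  then have "cmod (L2_inner M u g) \<le> L2_norm M g"
    using L2_norm_nonneg by (rule power2_le_imp_le)
  moreover have "L2_inner M u g = complex_of_real (1 / n) * L2_inner M f g"
    unfolding u_def L2_inner_commute[of M _ g] L2_inner_cmult_right by simp
  ultimately have "cmod (L2_inner M f g) / n \<le> L2_norm M g"
    using n by (simp add: norm_mult norm_divide)
  then show ?thesis using n by (simp add: n_def field_simps)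
qed

text \<open>Zorn's lemma: a non-null function orthogonal to a maximal orthonormal set could be
  normalized and added. With \<open>U = {}\<close> this shows that the basis chosen in
  \<open>L2_trace\<close> exists; with the vectors spanning the range of a projection it gives an
  eigenbasis.\<close>

lemma L2_orthonormal_basis_extending:
  assumes "L2_orthonormal M U"
  shows "\<exists>B. U \<subseteq> B \<and> L2_orthonormal_basis M B"
proof -
  define A where "A = {B. U \<subseteq> B \<and> L2_orthonormal M B}"
  have "\<exists>B\<in>A. \<forall>X\<in>A. B \<subseteq> X \<longrightarrow> X = B"
  proof (rule subset_Zorn_nonempty)
    show "A \<noteq> {}" using assms by (auto simp: A_def)
    fix C assume C: "C \<noteq> {}" "subset.chain A C"
    have "L2_orthonormal M (\<Union> C)"
      unfolding L2_orthonormal_def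
    proof (intro conjI ballI)
      show "\<Union> C \<subseteq> L2_space M"
        using C by (auto simp: A_def subset.chain_def L2_orthonormal_def)
      fix b b' assume "b \<in> \<Union> C" "b' \<in> \<Union> C"
      then obtain X Y where XY: "X \<in> C" "Y \<in> C" "b \<in> X" "b' \<in> Y" by auto
      then have "X \<subseteq> Y \<or> Y \<subseteq> X" using C by (auto simp: subset.chain_def)
      then obtain Z where Z: "Z \<in> C" "b \<in> Z" "b' \<in> Z" using XY by auto
      then have "L2_orthonormal M Z" using C by (auto simp: A_def subset.chain_def)
      then show "L2_inner M b b' = (if b = b' then 1 else 0)"
        using Z by (auto simp: L2_orthonormal_def)
    qed
    moreover have "U \<subseteq> \<Union> C"
      using C by (fastforce simp: A_def subset.chain_def)
    ultimately show "\<Union> C \<in> A" by (simp add: A_def)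
  qed
  then obtain B where B: "U \<subseteq> B" "L2_orthonormal M B"
    and max: "\<And>X. U \<subseteq> X \<Longrightarrow> L2_orthonormal M X \<Longrightarrow> B \<subseteq> X \<Longrightarrow> X = B"
    by (auto simp: A_def)
  have "\<forall>f\<in>L2_space M. (\<forall>b\<in>B. L2_inner M b f = 0) \<longrightarrow> (AE x in M. f x = 0)"
  proof (intro ballI impI, rule ccontr)
    fix f assume f: "f \<in> L2_space M" and orth: "\<forall>b\<in>B. L2_inner M b f = 0"
    assume "\<not> (AE x in M. f x = 0)"
    define n where "n = L2_norm M f"
    have n: "n > 0" using \<open>\<not> (AE x in M. f x = 0)\<close> L2_norm_eq_0_iff[OF f] L2_norm_nonneg[of M f] by (auto simp: n_def)
    define u where "u = (\<lambda>x. complex_of_real (1 / n) * f x)"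
    have u: "u \<in> L2_space M" unfolding u_def by (intro L2_space_cmult f)
    have "L2_norm M u = cmod (complex_of_real (1 / n)) * n"
      unfolding u_def L2_norm_cmult n_def ..
    also have "\<dots> = 1" using n by (simp add: norm_divide)
    finally have uu: "L2_inner M u u = 1"
      by (simp add: L2_inner_self)
    have bu: "L2_inner M b u = 0" if "b \<in> B" for b
      using orth that unfolding u_def L2_inner_cmult_right by simp
    have ub: "L2_inner M u b = 0" if "b \<in> B" for b
      using bu[OF that] unfolding L2_inner_commute[of M u b] by simp
    have "u \<notin> B" using bu uu by force
    then have "L2_orthonormal M (insert u B)"
      using B u uu bu ub by (auto simp: L2_orthonormal_def)
    from max[OF _ this] B \<open>u \<notin> B\<close> show False by auto
  qed
  then have "L2_orthonormal_basis M B"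
    using B(2) unfolding L2_orthonormal_basis_def L2_orthonormal_def by (elim conjE) (intro conjI)
  then show ?thesis using B(1) by blast
qed

lemma L2_orthonormal_basis_imp_orthonormal: "L2_orthonormal_basis M B \<Longrightarrow> L2_orthonormal M B"
  unfolding L2_orthonormal_basis_def L2_orthonormal_def by (elim conjE) (intro conjI)

lemma L2_orthonormal_basis_complete:
  assumes "L2_orthonormal_basis M B" "f \<in> L2_space M" "\<And>b. b \<in> B \<Longrightarrow> L2_inner M b f = 0"
  shows "AE x in M. f x = 0"
proof -
  have "\<forall>f\<in>L2_space M. (\<forall>b\<in>B. L2_inner M b f = 0) \<longrightarrow> (AE x in M. f x = 0)"
    using assms(1) unfolding L2_orthonormal_basis_def by (elim conjE)
  from bspec[OF this assms(2)] assms(3) show ?thesis by blast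
qed


section \<open>Completeness and orthonormal expansions\<close>

lemma L2_space_const:
  assumes "finite_measure M"
  shows "(\<lambda>x. c) \<in> L2_space M"
  using finite_measure.integrable_const[OF assms] by (simp add: L2_space_def)

text \<open>On a finite measure space the increments are also summable in \<open>L\<^sup>1\<close>, which gives almost
  everywhere convergence; Fatou's lemma turns it into \<open>L\<^sup>2\<close> convergence.\<close>

lemma L2_fast_Cauchy_convergent:
  assumes fin: "finite_measure M" and s: "\<And>n. s n \<in> L2_space M"
    and cauchy: "\<And>m n. n \<le> m \<Longrightarrow> L2_norm M (\<lambda>x. s m x - s n x) \<le> (1/2) ^ n"
  shows "\<exists>g\<in>L2_space M. \<forall>n. L2_norm M (\<lambda>x. g x - s n x) \<le> (1/2) ^ n"
proof -
  note [measurable] = L2_space_measurable[OF s]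
  define d where "d n x = s (Suc n) x - s n x" for n x
  have d: "d n \<in> L2_space M" for n unfolding d_def by (intro L2_space_diff s)
  note [measurable] = L2_space_measurable[OF d]
  define K where "K = L2_norm M (\<lambda>x. 1)"
  \<comment> \<open>Constants lie in L^2, so Cauchy-Schwarz against 1 bounds the L^1 norms of the
    increments by a geometric sequence.\<close>
  have int: "integrable M (\<lambda>x. cmod (d n x))" and le: "(LINT x|M. cmod (d n x)) \<le> K * (1/2) ^ n" for n
  proof -
    let ?h = "\<lambda>x. complex_of_real (cmod (d n x))"
    have h: "?h \<in> L2_space M" using L2_spaceD[OF d[of n]] by (simp add: L2_space_def)
    have "integrable M ?h"
      using L2_inner_integrable[OF L2_space_const[OF fin, of 1] h] by simp
    then show "integrable M (\<lambda>x. cmod (d n x))" by (simp add: complex_of_real_integrable_eq)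
    have "cmod (L2_inner M (\<lambda>x. 1) ?h) \<le> K * L2_norm M ?h"
      unfolding K_def by (intro L2_Cauchy_Schwarz L2_space_const fin h)
    also have "L2_norm M ?h = L2_norm M (d n)" by (simp add: L2_norm_def)
    also have "\<dots> \<le> (1/2) ^ n" unfolding d_def using cauchy[of n "Suc n"] by simp
    finally have "cmod (L2_inner M (\<lambda>x. 1) ?h) \<le> K * (1/2) ^ n"
      by (simp add: K_def L2_norm_nonneg mult_left_mono)
    moreover have "L2_inner M (\<lambda>x. 1) ?h = complex_of_real (LINT x|M. cmod (d n x))"
      by (simp add: L2_inner_def)
    ultimately show "(LINT x|M. cmod (d n x)) \<le> K * (1/2) ^ n" by simp
  qed
  have "(\<integral>\<^sup>+x. (\<Sum>n. ennreal (cmod (d n x))) \<partial>M) = (\<Sum>n. \<integral>\<^sup>+x. ennreal (cmod (d n x)) \<partial>M)"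
    by (rule nn_integral_suminf) simp
  also have "\<dots> \<le> (\<Sum>n. ennreal (K * (1/2) ^ n))"
    by (intro suminf_le summableI) (simp add: nn_integral_eq_integral int le ennreal_leI)
  also have "\<dots> < top"
  proof -
    have "summable (\<lambda>n. K * (1/2) ^ n)" by (intro summable_mult summable_geometric) auto
    moreover have "0 \<le> K * (1/2) ^ n" for n by (simp add: K_def L2_norm_nonneg)
    ultimately have "(\<Sum>n. ennreal (K * (1/2) ^ n)) \<noteq> top" by (rule ennreal_suminf_neq_top)
    then show ?thesis by (simp only: top.not_eq_extremum)
  qed
  finally have "AE x in M. (\<Sum>n. ennreal (cmod (d n x))) \<noteq> \<infinity>"
    by (intro nn_integral_PInf_AE) auto
  then have conv: "AE x in M. (\<lambda>n. s n x) \<longlonglongrightarrow> lim (\<lambda>n. s n x)"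
  proof eventually_elim
    case (elim x)
    then have "summable (\<lambda>n. cmod (d n x))"
      by (intro summable_suminf_not_top) auto
    then have "summable (\<lambda>n. d n x)" by (rule summable_norm_cancel)
    then have "convergent (\<lambda>n. (\<Sum>k<n. d k x))" by (simp add: summable_iff_convergent)
    then have "convergent (\<lambda>n. s 0 x + (\<Sum>k<n. d k x))"
      by (intro convergent_add convergent_const)
    moreover have "s 0 x + (\<Sum>k<n. d k x) = s n x" for n
      using sum_lessThan_telescope[of "\<lambda>n. s n x" n] by (simp add: d_def)
    ultimately show ?case by (simp add: convergent_LIMSEQ_iff)
  qed
  define g where "g x = lim (\<lambda>n. s n x)" for x
  have [measurable]: "g \<in> borel_measurable M" unfolding g_def by (intro borel_measurable_lim_metric) simp
  \<comment> \<open>Here n is fixed and m tends to infinity in the Cauchy bound for s m - s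
    n.\<close>
  have fatou: "(\<integral>\<^sup>+x. ennreal ((cmod (g x - s n x))\<^sup>2) \<partial>M) \<le> ennreal (((1/2) ^ n)\<^sup>2)" for n
  proof -
    have "(\<integral>\<^sup>+x. ennreal ((cmod (g x - s n x))\<^sup>2) \<partial>M)
      = (\<integral>\<^sup>+x. liminf (\<lambda>m. ennreal ((cmod (s m x - s n x))\<^sup>2)) \<partial>M)"
    proof (rule nn_integral_cong_AE)
      show "AE x in M. ennreal ((cmod (g x - s n x))\<^sup>2) = liminf (\<lambda>m. ennreal ((cmod (s m x - s n x))\<^sup>2))"
        using conv
      proof eventually_elim
        case (elim x)
        then have "(\<lambda>m. ennreal ((cmod (s m x - s n x))\<^sup>2)) \<longlonglongrightarrow> ennreal ((cmod (g x - s n x))\<^sup>2)"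
          unfolding g_def by (intro tendsto_intros)
        from lim_imp_Liminf[OF _ this] show ?case by simp
      qed
    qed
    also have "\<dots> \<le> liminf (\<lambda>m. \<integral>\<^sup>+x. ennreal ((cmod (s m x - s n x))\<^sup>2) \<partial>M)"
      by (rule nn_integral_liminf) measurable
    also have "\<dots> \<le> liminf (\<lambda>m. ennreal (((1/2) ^ n)\<^sup>2))"
    proof (rule Liminf_mono)
      show "\<forall>\<^sub>F m in sequentially. (\<integral>\<^sup>+x. ennreal ((cmod (s m x - s n x))\<^sup>2) \<partial>M) \<le> ennreal (((1/2) ^ n)\<^sup>2)"
        using eventually_ge_at_top[of n]
      proof eventually_elim
        case (elim m)
        have "(\<integral>\<^sup>+x. ennreal ((cmod (s m x - s n x))\<^sup>2) \<partial>M) = ennreal ((L2_norm M (\<lambda>x. s m x - s n x))\<^sup>2)"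
          unfolding L2_norm_square
          by (intro nn_integral_eq_integral L2_space_integrable[OF L2_space_diff] s) auto
        also have "\<dots> \<le> ennreal (((1/2) ^ n)\<^sup>2)"
          using elim by (intro ennreal_leI power_mono cauchy L2_norm_nonneg)
        finally show ?case .
      qed
    qed
    finally show ?thesis by (simp add: Liminf_const)
  qed
  have gs: "(\<lambda>x. g x - s n x) \<in> L2_space M" for n
  proof -
    have "(\<integral>\<^sup>+x. ennreal (norm ((cmod (g x - s n x))\<^sup>2)) \<partial>M) < \<infinity>"
      using le_less_trans[OF fatou[of n] ennreal_less_top] by simp
    then have "integrable M (\<lambda>x. (cmod (g x - s n x))\<^sup>2)"
      by (intro integrableI_bounded) auto
    then show ?thesis by (simp add: L2_space_def)
  qed
  have "g \<in> L2_space M" using L2_space_add[OF gs[of 0] s[of 0]] by simp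
  moreover have "L2_norm M (\<lambda>x. g x - s n x) \<le> (1/2) ^ n" for n
  proof -
    have "ennreal ((L2_norm M (\<lambda>x. g x - s n x))\<^sup>2) \<le> ennreal (((1/2) ^ n)\<^sup>2)"
      using fatou[of n] nn_integral_eq_integral[OF L2_space_integrable[OF gs[of n]]]
      by (simp add: L2_norm_square)
    then have "(L2_norm M (\<lambda>x. g x - s n x))\<^sup>2 \<le> ((1/2) ^ n)\<^sup>2"
      by (subst (asm) ennreal_le_iff) auto
    then show ?thesis by (rule power2_le_imp_le) simp
  qed
  ultimately show ?thesis by blast
qed

text \<open>\<open>B\<close> comes without an enumeration, so finite subsets that almost attain the
  supremum of the Bessel sums play the role of partial sums. The projections of \<open>f\<close>
  converge to some g, and f - g is orthogonal to \<open>B\<close>, hence null.\<close>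

lemma L2_orthonormal_basis_approx:
  assumes fin: "finite_measure M" and B: "L2_orthonormal_basis M B" and f: "f \<in> L2_space M" and e: "e > 0"
  shows "\<exists>F. finite F \<and> F \<subseteq> B \<and> L2_norm M (\<lambda>x. f x - L2_projection M F f x) < e"
proof -
  note on = L2_orthonormal_basis_imp_orthonormal[OF B]
  define c where "c b = (cmod (L2_inner M b f))\<^sup>2" for b
  define T where "T = {sum c F |F. finite F \<and> F \<subseteq> B}"
  have bdd: "bdd_above T"
    using L2_bessel[OF L2_orthonormal_subset[OF on] _ f] by (auto simp: T_def c_def bdd_above_def)
  have "T \<noteq> {}" by (auto simp: T_def)
  have "\<exists>F. finite F \<and> F \<subseteq> B \<and> Sup T - ((1/2) ^ n)\<^sup>2 < sum c F" for n :: nat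
  proof -
    have "Sup T - ((1/2) ^ n)\<^sup>2 < Sup T" by simp
    from less_cSupE[OF this \<open>T \<noteq> {}\<close>] show ?thesis unfolding T_def by blast
  qed
  then obtain F0 where F0: "\<And>n. finite (F0 n)" "\<And>n. F0 n \<subseteq> B" "\<And>n::nat. Sup T - ((1/2) ^ n)\<^sup>2 < sum c (F0 n)"
    by metis
  define F where "F n = (\<Union>k\<le>n. F0 k)" for n
  have F: "finite (F n)" "F n \<subseteq> B" "F0 n \<subseteq> F n" for n using F0(1,2) by (auto simp: F_def)
  have mono: "F n \<subseteq> F m" if "n \<le> m" for m n using that by (force simp: F_def)
  \<comment> \<open>A finite set disjoint from \<open>F n\<close> with a larger sum would, joined to
    \<open>F n\<close>, exceed the supremum.\<close>
  have tail: "sum c G \<le> ((1/2) ^ n)\<^sup>2" if "finite G" "G \<subseteq> B" "G \<inter> F n = {}" for G n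
  proof -
    have "sum c (F0 n) \<le> sum c (F n)" by (intro sum_mono2 F) (simp add: c_def)
    moreover have "sum c (G \<union> F n) \<le> Sup T"
      using that F[of n] by (intro cSup_upper bdd) (auto simp: T_def)
    moreover have "sum c (G \<union> F n) = sum c G + sum c (F n)"
      using that F[of n] by (intro sum.union_disjoint) auto
    ultimately show ?thesis using F0(3)[of n] by linarith
  qed
  define s where "s n = L2_projection M (F n) f" for n
  have s: "s n \<in> L2_space M" for n
    unfolding s_def by (intro L2_projection_space L2_orthonormal_subset[OF on] F)
  have "L2_norm M (\<lambda>x. s m x - s n x) \<le> (1/2) ^ n" if "n \<le> m" for m n
  proof -
    have "(\<lambda>x. s m x - s n x) = (\<lambda>x. \<Sum>b\<in>F m - F n. L2_inner M b f * b x)"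
      unfolding s_def L2_projection_def using mono[OF that] F(1)[of m] by (simp add: sum_diff)
    then have "(L2_norm M (\<lambda>x. s m x - s n x))\<^sup>2 = sum c (F m - F n)"
      unfolding c_def using F(1,2)[of m]
      by (simp only:) (intro L2_norm_orthonormal_sum L2_orthonormal_subset[OF on], auto)
    also have "\<dots> \<le> ((1/2) ^ n)\<^sup>2" using F[of m] by (intro tail) auto
    finally show ?thesis by (rule power2_le_imp_le) simp
  qed
  from L2_fast_Cauchy_convergent[OF fin s this]
  obtain g where g: "g \<in> L2_space M" and gs: "\<And>n. L2_norm M (\<lambda>x. g x - s n x) \<le> (1/2) ^ n" by blast
  have "L2_inner M b (\<lambda>x. f x - g x) = 0" if b: "b \<in> B" for b
  proof -
    have bL: "b \<in> L2_space M" and b1: "L2_norm M b = 1"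
      using L2_orthonormalD(1)[OF on b] L2_orthonormal_norm[OF on b] by auto
    \<comment> \<open>One half is the coefficient of f that \<open>s n\<close> may miss, the other
      the distance from \<open>s n\<close> to g.\<close>
    have le: "cmod (L2_inner M b (\<lambda>x. f x - g x)) \<le> 2 * (1/2) ^ n" for n
    proof -
      have "L2_inner M b (s n) = (if b \<in> F n then L2_inner M b f else 0)"
        unfolding s_def L2_projection_def by (rule L2_inner_orthonormal_sum[OF on F(1,2) b])
      moreover have "cmod (L2_inner M b f) \<le> (1/2) ^ n" if "b \<notin> F n"
      proof (rule power2_le_imp_le)
        show "(cmod (L2_inner M b f))\<^sup>2 \<le> ((1/2) ^ n)\<^sup>2"
          using tail[of "{b}" n] b that unfolding c_def by (simp del: power_one_over)
      qed simp
      ultimately have "cmod (L2_inner M b f - L2_inner M b (s n)) \<le> (1/2) ^ n" by auto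
      moreover have "cmod (L2_inner M b g - L2_inner M b (s n)) \<le> (1/2) ^ n"
        using L2_Cauchy_Schwarz[OF bL L2_space_diff[OF g s[of n]]] gs[of n] b1
        by (simp add: L2_inner_diff_right bL g s)
      moreover have diff: "L2_inner M b (\<lambda>x. f x - g x) = (L2_inner M b f - L2_inner M b (s n)) - (L2_inner M b g - L2_inner M b (s n))"
        by (simp add: L2_inner_diff_right bL g f)
      ultimately show ?thesis
        unfolding diff using norm_triangle_ineq4[of "L2_inner M b f - L2_inner M b (s n)" "L2_inner M b g - L2_inner M b (s n)"]
        by linarith
    qed
    have lim: "(\<lambda>n. 2 * (1/2) ^ n :: real) \<longlonglongrightarrow> 2 * 0"
      by (intro tendsto_mult tendsto_const LIMSEQ_realpow_zero) auto
    have "cmod (L2_inner M b (\<lambda>x. f x - g x)) \<le> 2 * 0"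
      by (rule LIMSEQ_le_const[OF lim]) (use le in blast)
    then show ?thesis by simp
  qed
  then have fg: "AE x in M. f x - g x = 0"
    by (rule L2_orthonormal_basis_complete[OF B L2_space_diff[OF f g]])
  obtain n where n: "(1/2) ^ n < e" using e real_arch_pow_inv[of e "1/2"] by auto
  have "L2_norm M (\<lambda>x. f x - s n x) = L2_norm M (\<lambda>x. g x - s n x)"
    using fg by (intro L2_norm_cong_AE L2_space_measurable L2_space_diff f g s) auto
  with gs[of n] n F[of n] show ?thesis
    unfolding s_def by (intro exI[of _ "F n"]) auto
qed

section \<open>Bounded operators are determined by an orthonormal basis\<close>

lemma bounded_L2_operatorD:
  assumes "bounded_L2_operator M A"
  shows "f \<in> L2_space M \<Longrightarrow> A f \<in> L2_space M"
    and "f \<in> L2_space M \<Longrightarrow> g \<in> L2_space M \<Longrightarrow> AE x in M. A (\<lambda>y. a * f y + b * g y) x = a * A f x + b * A g x"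
    and "\<exists>C\<ge>0. \<forall>f\<in>L2_space M. L2_norm M (A f) \<le> C * L2_norm M f"
proof -
  show "\<exists>C\<ge>0. \<forall>f\<in>L2_space M. L2_norm M (A f) \<le> C * L2_norm M f"
  proof -
    obtain C where C: "\<forall>f\<in>L2_space M. L2_norm M (A f) \<le> C * L2_norm M f"
      using assms by (auto simp: bounded_L2_operator_def)
    have "L2_norm M (A f) \<le> max C 0 * L2_norm M f" if "f \<in> L2_space M" for f
      using C that L2_norm_nonneg[of M f] by (meson max.cobounded1 mult_right_mono order_trans)
    then show ?thesis by (intro exI[of _ "max C 0"]) auto
  qed
qed (use assms in \<open>auto simp: bounded_L2_operator_def\<close>)

lemma bounded_L2_operator_sum:
  assumes A: "bounded_L2_operator M A" and "finite F" "F \<subseteq> L2_space M"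
  shows "AE x in M. A (\<lambda>y. \<Sum>b\<in>F. c b * b y) x = (\<Sum>b\<in>F. c b * A b x)"
  using assms(2,3)
proof (induction F)
  case empty
  from bounded_L2_operatorD(2)[OF A L2_space_zero L2_space_zero, of 0 0] show ?case by simp
next
  case (insert b F)
  have "AE x in M. A (\<lambda>y. c b * b y + 1 * (\<Sum>b\<in>F. c b * b y)) x = c b * A b x + 1 * A (\<lambda>y. \<Sum>b\<in>F. c b * b y) x"
    using insert by (intro bounded_L2_operatorD(2)[OF A] L2_space_sum) auto
  with insert.IH insert.prems show ?case
    by (auto simp: insert.hyps elim: AE_mp)
qed

text \<open>Linearity passes the agreement on \<open>B\<close> to finite combinations, up to null
  sets; boundedness of both operators then controls the remainder h, whose norm can be made
  arbitrarily small. This pins down \<open>L2_power\<close>, which is specified on an eigenbasis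
  only.\<close>

lemma bounded_L2_operator_eqI:
  assumes fin: "finite_measure M" and B: "L2_orthonormal_basis M B"
    and A: "bounded_L2_operator M A" and S: "bounded_L2_operator M S"
    and eq: "\<And>b. b \<in> B \<Longrightarrow> AE x in M. S b x = A b x" and f: "f \<in> L2_space M"
  shows "AE x in M. S f x = A f x"
proof -
  obtain C where C: "C \<ge> 0" "\<And>f. f \<in> L2_space M \<Longrightarrow> L2_norm M (A f) \<le> C * L2_norm M f"
    using bounded_L2_operatorD(3)[OF A] by blast
  obtain D where D: "D \<ge> 0" "\<And>f. f \<in> L2_space M \<Longrightarrow> L2_norm M (S f) \<le> D * L2_norm M f"
    using bounded_L2_operatorD(3)[OF S] by blast
  note Af = bounded_L2_operatorD(1)[OF A] and Sf = bounded_L2_operatorD(1)[OF S]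
  let ?n = "L2_norm M (\<lambda>x. S f x - A f x)"
  have bound: "?n\<^sup>2 \<le> (2 * D\<^sup>2 + 2 * C\<^sup>2) * e\<^sup>2" if e: "e > 0" for e
  proof -
    obtain F where F: "finite F" "F \<subseteq> B" and Fe: "L2_norm M (\<lambda>x. f x - L2_projection M F f x) < e"
      using L2_orthonormal_basis_approx[OF fin B f e] by blast
    define s where "s = L2_projection M F f"
    define h where "h = (\<lambda>x. f x - s x)"
    have on: "L2_orthonormal M F"
      by (rule L2_orthonormal_subset[OF L2_orthonormal_basis_imp_orthonormal[OF B] F(2)])
    have s: "s \<in> L2_space M" unfolding s_def by (rule L2_projection_space[OF on])
    have h: "h \<in> L2_space M" unfolding h_def by (intro L2_space_diff f s)
    have FL: "F \<subseteq> L2_space M" using on by (simp add: L2_orthonormal_def)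
    have "AE x in M. \<forall>b\<in>F. S b x = A b x"
      using eq F by (intro AE_finite_allI) auto
    with bounded_L2_operator_sum[OF S F(1) FL, of "\<lambda>b. L2_inner M b f"]
      bounded_L2_operator_sum[OF A F(1) FL, of "\<lambda>b. L2_inner M b f"]
    have ss: "AE x in M. S s x = A s x"
      unfolding s_def L2_projection_def by eventually_elim simp
    have "AE x in M. S (\<lambda>x. 1 * h x + 1 * s x) x = 1 * S h x + 1 * S s x"
      by (rule bounded_L2_operatorD(2)[OF S h s])
    moreover have "AE x in M. A (\<lambda>x. 1 * h x + 1 * s x) x = 1 * A h x + 1 * A s x"
      by (rule bounded_L2_operatorD(2)[OF A h s])
    ultimately have "AE x in M. S f x - A f x = S h x - A h x"
      using ss by eventually_elim (simp add: h_def)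
    then have "?n = L2_norm M (\<lambda>x. S h x - A h x)"
      by (intro L2_norm_cong_AE L2_space_measurable L2_space_diff Af Sf f h)
    also have "(L2_norm M (\<lambda>x. S h x - A h x))\<^sup>2 \<le> 2 * (L2_norm M (S h))\<^sup>2 + 2 * (L2_norm M (A h))\<^sup>2"
      by (intro L2_norm_diff_square_le Af Sf h)
    also have "\<dots> \<le> 2 * (D * e)\<^sup>2 + 2 * (C * e)\<^sup>2"
    proof -
      have he: "L2_norm M h \<le> e" using Fe by (simp add: h_def s_def)
      have "L2_norm M (S h) \<le> D * e" using D(2)[OF h] mult_left_mono[OF he D(1)] by linarith
      moreover have "L2_norm M (A h) \<le> C * e" using C(2)[OF h] mult_left_mono[OF he C(1)] by linarith
      ultimately show ?thesis by (intro add_mono mult_left_mono power_mono L2_norm_nonneg) auto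
    qed
    finally show ?thesis by (simp add: power_mult_distrib algebra_simps)
  qed
  have "?n\<^sup>2 = 0"
  proof (rule ccontr)
    assume "?n\<^sup>2 \<noteq> 0"
    then have pos: "?n\<^sup>2 > 0" by simp
    \<comment> \<open>With \<open>e\<close> such that K e^2 is half of the squared norm, the bound
      would halve a positive number; the summand 1 keeps \<open>K\<close> positive.\<close>
    define K where "K = 2 * D\<^sup>2 + 2 * C\<^sup>2 + 1"
    have K: "K > 0" unfolding K_def using zero_le_power2[of D] zero_le_power2[of C] by linarith
    have "?n\<^sup>2 \<le> (2 * D\<^sup>2 + 2 * C\<^sup>2) * (sqrt (?n\<^sup>2 / (2 * K)))\<^sup>2"
      using pos K by (intro bound) simp
    also have "\<dots> \<le> K * (sqrt (?n\<^sup>2 / (2 * K)))\<^sup>2"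
      by (intro mult_right_mono) (auto simp: K_def)
    also have "\<dots> = ?n\<^sup>2 / 2" using K by simp
    finally show False using pos by linarith
  qed
  then have "AE x in M. S f x - A f x = 0"
    using L2_norm_eq_0_iff[OF L2_space_diff[OF Sf[OF f] Af[OF f]]] by simp
  then show ?thesis by eventually_elim simp
qed


section \<open>Schatten norms of finite rank projections\<close>

lemma L2_norm_projection_le:
  assumes U: "L2_orthonormal M U" "finite U" and f: "f \<in> L2_space M"
  shows "L2_norm M (L2_projection M U f) \<le> L2_norm M f"
proof (rule power2_le_imp_le[OF _ L2_norm_nonneg])
  show "(L2_norm M (L2_projection M U f))\<^sup>2 \<le> (L2_norm M f)\<^sup>2"
    unfolding L2_projection_def L2_norm_orthonormal_sum[OF U] by (rule L2_bessel[OF U f])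
qed

lemma bounded_L2_operator_projection:
  assumes U: "L2_orthonormal M U" "finite U"
  shows "bounded_L2_operator M (L2_projection M U)"
  unfolding bounded_L2_operator_def
proof (intro conjI ballI allI)
  fix f assume "f \<in> L2_space M"
  show "L2_projection M U f \<in> L2_space M" by (rule L2_projection_space[OF U(1)])
next
  fix f g a b assume fg: "f \<in> L2_space M" "g \<in> L2_space M"
  have "L2_inner M u (\<lambda>y. a * f y + b * g y) = a * L2_inner M u f + b * L2_inner M u g" if "u \<in> U" for u
    using L2_inner_add_right[OF L2_orthonormalD(1)[OF U(1) that] L2_space_cmult[OF fg(1), of a] L2_space_cmult[OF fg(2), of b]]
    by (simp add: L2_inner_cmult_right)
  then show "AE x in M. L2_projection M U (\<lambda>y. a * f y + b * g y) x = a * L2_projection M U f x + b * L2_projection M U g x"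
    by (simp add: L2_projection_def sum_distrib_left sum.distrib algebra_simps)
next
  have "L2_norm M (L2_projection M U f) \<le> 1 * L2_norm M f" if "f \<in> L2_space M" for f
    using L2_norm_projection_le[OF U that] by simp
  then show "\<exists>C. \<forall>f\<in>L2_space M. L2_norm M (L2_projection M U f) \<le> C * L2_norm M f" by blast
qed

lemma L2_projection_self_adjoint:
  assumes U: "L2_orthonormal M U" and f: "f \<in> L2_space M" and g: "g \<in> L2_space M"
  shows "L2_inner M (L2_projection M U f) g = L2_inner M f (L2_projection M U g)"
proof -
  have uL: "u \<in> L2_space M" if "u \<in> U" for u using L2_orthonormalD(1)[OF U that] .
  have "L2_inner M (L2_projection M U f) g = (\<Sum>u\<in>U. cnj (L2_inner M u f) * L2_inner M u g)"
    unfolding L2_projection_def by (intro L2_inner_sum_left g uL)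
  moreover have "L2_inner M f (L2_projection M U g) = (\<Sum>u\<in>U. L2_inner M u g * L2_inner M f u)"
    unfolding L2_projection_def by (intro L2_inner_sum_right f uL)
  ultimately show ?thesis by (simp add: L2_inner_commute[of M f] mult.commute)
qed

lemma L2_projection_idem:
  assumes U: "L2_orthonormal M U" "finite U"
  shows "L2_projection M U (L2_projection M U f) = L2_projection M U f"
proof -
  have "L2_inner M u (L2_projection M U f) = L2_inner M u f" if "u \<in> U" for u
    using L2_inner_orthonormal_sum[OF U subset_refl that, of "\<lambda>b. L2_inner M b f"] that
    by (simp add: L2_projection_def)
  then show ?thesis unfolding L2_projection_def[of M U "L2_projection M U f"]
    by (simp add: L2_projection_def[of M U f])
qed

text \<open>The chosen adjoint is just some solution of its specification. The projection is another
  one, and the difference h of the two satisfies <h, h> = 0.\<close>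

lemma L2_adjoint_projection:
  assumes U: "L2_orthonormal M U" "finite U" and f: "f \<in> L2_space M"
  shows "AE x in M. L2_adjoint M (L2_projection M U) f x = L2_projection M U f x"
proof -
  let ?A = "L2_projection M U" and ?B = "L2_adjoint M (L2_projection M U)"
  let ?P = "\<lambda>B. bounded_L2_operator M B \<and>
     (\<forall>f\<in>L2_space M. \<forall>g\<in>L2_space M. L2_inner M (B f) g = L2_inner M f (?A g))"
  have "?P ?A"
    using bounded_L2_operator_projection[OF U] L2_projection_self_adjoint[OF U(1)] by blast
  then have B: "bounded_L2_operator M ?B \<and>
     (\<forall>f\<in>L2_space M. \<forall>g\<in>L2_space M. L2_inner M (?B f) g = L2_inner M f (?A g))"
    unfolding L2_adjoint_def by (rule someI[of ?P])
  have Bf: "?B f \<in> L2_space M" using B bounded_L2_operatorD(1) f by blast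
  have Af: "?A f \<in> L2_space M" by (rule L2_projection_space[OF U(1)])
  define h where "h = (\<lambda>x. ?B f x - ?A f x)"
  have h: "h \<in> L2_space M" unfolding h_def by (intro L2_space_diff Bf Af)
  have "L2_inner M h h = L2_inner M (?B f) h - L2_inner M (?A f) h"
    using L2_inner_diff_left[OF h Bf Af] by (simp add: h_def)
  also have "\<dots> = 0"
    using B f h L2_projection_self_adjoint[OF U(1) f h] by simp
  finally have "complex_of_real ((L2_norm M h)\<^sup>2) = 0" unfolding L2_inner_self .
  then have "L2_norm M h = 0" by simp
  then have "AE x in M. h x = 0" using L2_norm_eq_0_iff[OF h] by simp
  then show ?thesis by eventually_elim (simp add: h_def)
qed

text \<open>The chosen power comes with an unknown eigenbasis and unknown eigenvalues. Idempotence
  forces these to be 0 or 1, which powers do not change, so the power and the projection agree on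
  that basis. \<open>T\<close> equals the projection only almost everywhere since it will contain a
  chosen adjoint.\<close>

lemma L2_power_projection:
  assumes fin: "finite_measure M" and U: "L2_orthonormal M U" "finite U" and s: "s > 0"
    and T: "\<And>f. f \<in> L2_space M \<Longrightarrow> AE x in M. T f x = L2_projection M U f x"
    and f: "f \<in> L2_space M"
  shows "L2_power M T s f \<in> L2_space M" "AE x in M. L2_power M T s f x = L2_projection M U f x"
proof -
  let ?A = "L2_projection M U"
  let ?P = "\<lambda>S. bounded_L2_operator M S \<and>
     (\<exists>B ev. L2_orthonormal_basis M B \<and>
        (\<forall>b\<in>B. 0 \<le> ev b \<and>
           (AE x in M. T b x = complex_of_real (ev b) * b x) \<and>
           (AE x in M. S b x = complex_of_real (ev b powr s) * b x)))"
  note bA = bounded_L2_operator_projection[OF U]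
  have "?P ?A"
  proof -
    obtain B where B: "U \<subseteq> B" "L2_orthonormal_basis M B"
      using L2_orthonormal_basis_extending[OF U(1)] by blast
    note on = L2_orthonormal_basis_imp_orthonormal[OF B(2)]
    define ev where "ev b = (if b \<in> U then 1 else 0 :: real)" for b
    have Ab: "?A b = (\<lambda>x. complex_of_real (ev b) * b x)" if b: "b \<in> B" for b
    proof
      fix x
      have "?A b x = (\<Sum>u\<in>U. if u = b then b x else 0)"
        unfolding L2_projection_def using L2_orthonormalD(2)[OF on _ b] B(1)
        by (intro sum.cong) auto
      also have "\<dots> = complex_of_real (ev b) * b x" using U(2) by (simp add: ev_def)
      finally show "?A b x = complex_of_real (ev b) * b x" .
    qed
    have "\<forall>b\<in>B. 0 \<le> ev b \<and> (AE x in M. T b x = complex_of_real (ev b) * b x) \<and>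
       (AE x in M. ?A b x = complex_of_real (ev b powr s) * b x)"
    proof (intro ballI conjI)
      fix b assume b: "b \<in> B"
      show "0 \<le> ev b" by (simp add: ev_def)
      show "AE x in M. T b x = complex_of_real (ev b) * b x"
        using T[OF L2_orthonormalD(1)[OF on b]] unfolding Ab[OF b] .
      have "ev b powr s = ev b" using s by (simp add: ev_def)
      then show "AE x in M. ?A b x = complex_of_real (ev b powr s) * b x" unfolding Ab[OF b] by simp
    qed
    then show ?thesis using bA B(2) by blast
  qed
  then have "?P (L2_power M T s)" unfolding L2_power_def by (rule someI[of ?P])
  then obtain B ev where S: "bounded_L2_operator M (L2_power M T s)" and B: "L2_orthonormal_basis M B"
    and ev: "\<And>b. b \<in> B \<Longrightarrow> 0 \<le> ev b" "\<And>b. b \<in> B \<Longrightarrow> AE x in M. T b x = complex_of_real (ev b) * b x"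
      "\<And>b. b \<in> B \<Longrightarrow> AE x in M. L2_power M T s b x = complex_of_real (ev b powr s) * b x"
    by blast
  note on = L2_orthonormal_basis_imp_orthonormal[OF B]
  have "AE x in M. L2_power M T s b x = ?A b x" if b: "b \<in> B" for b
  proof -
    have bL: "b \<in> L2_space M" using L2_orthonormalD(1)[OF on b] .
    note AbL = bounded_L2_operatorD(1)[OF bA bL]
    have Ab: "AE x in M. ?A b x = complex_of_real (ev b) * b x"
      using T[OF bL] ev(2)[OF b] by eventually_elim simp
    have "L2_inner M b (?A b) = L2_inner M b (\<lambda>x. complex_of_real (ev b) * b x)"
      using Ab by (intro L2_inner_cong_AE L2_space_measurable bL AbL L2_space_cmult)
    then have 1: "L2_inner M b (?A b) = complex_of_real (ev b)"
      unfolding L2_inner_cmult_right using L2_orthonormalD(2)[OF on b b] by simp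
    \<comment> \<open>For an eigenvector b this identity reads ev b = (ev b)^2.\<close>
    have "L2_inner M b (?A b) = L2_inner M (?A b) (?A b)"
      using L2_projection_self_adjoint[OF U(1) bL AbL] L2_projection_idem[OF U, of b] by simp
    also have "\<dots> = L2_inner M (?A b) (\<lambda>x. complex_of_real (ev b) * b x)"
      using Ab by (intro L2_inner_cong_AE L2_space_measurable bL AbL L2_space_cmult)
    also have "\<dots> = complex_of_real (ev b) * cnj (L2_inner M b (?A b))"
      unfolding L2_inner_cmult_right by (simp add: L2_inner_commute[of M "?A b" b])
    finally have "complex_of_real (ev b) = complex_of_real (ev b * ev b)" unfolding 1 by simp
    then have "ev b = ev b * ev b" by (simp only: of_real_eq_iff)
    then have "ev b = 0 \<or> ev b = 1" by auto
    then have "ev b powr s = ev b" using s by auto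
    then show ?thesis using ev(3)[OF b] Ab by (auto elim: AE_mp)
  qed
  from bounded_L2_operator_eqI[OF fin B bA S this f]
  show "AE x in M. L2_power M T s f x = L2_projection M U f x" .
  show "L2_power M T s f \<in> L2_space M" by (rule bounded_L2_operatorD(1)[OF S f])
qed

text \<open>In whatever basis was chosen, the diagonal entries are sums over \<open>U\<close> of
  squared coefficients. Exchanging the two sums leaves one Bessel sum, at most 1, for each u in
  \<open>U\<close>.\<close>

lemma L2_trace_projection:
  assumes U: "L2_orthonormal M U" "finite U"
    and S: "\<And>f. f \<in> L2_space M \<Longrightarrow> S f \<in> L2_space M"
      "\<And>f. f \<in> L2_space M \<Longrightarrow> AE x in M. S f x = L2_projection M U f x"
  shows "0 \<le> Re (L2_trace M S)" "Re (L2_trace M S) \<le> card U"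
proof -
  define B where "B = (SOME B. L2_orthonormal_basis M B)"
  have "L2_orthonormal M {}" by (simp add: L2_orthonormal_def)
  from L2_orthonormal_basis_extending[OF this] have "L2_orthonormal_basis M B"
    unfolding B_def by (metis someI_ex)
  note on = L2_orthonormal_basis_imp_orthonormal[OF this]
  define t where "t b = (\<Sum>u\<in>U. (cmod (L2_inner M u b))\<^sup>2)" for b
  have t: "L2_inner M b (S b) = complex_of_real (t b)" if b: "b \<in> B" for b
  proof -
    have bL: "b \<in> L2_space M" using L2_orthonormalD(1)[OF on b] .
    have "L2_inner M b (S b) = L2_inner M b (L2_projection M U b)"
      using S[OF bL] bL by (intro L2_inner_cong_AE L2_space_measurable L2_projection_space U)
    also have "\<dots> = (\<Sum>u\<in>U. L2_inner M u b * L2_inner M b u)"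
      unfolding L2_projection_def by (intro L2_inner_sum_right bL L2_orthonormalD(1)[OF U(1)])
    also have "\<dots> = complex_of_real (t b)"
      unfolding t_def of_real_sum by (intro sum.cong refl) (simp only: complex_norm_square L2_inner_commute[of M b])
    finally show ?thesis .
  qed
  have tr: "L2_trace M S = (\<Sum>\<^sub>\<infinity>b\<in>B. complex_of_real (t b))"
    unfolding L2_trace_def B_def[symmetric] using t by (intro infsum_cong)
  have fin_le: "sum t F \<le> card U" if F: "finite F" "F \<subseteq> B" for F
  proof -
    have "sum t F = (\<Sum>u\<in>U. \<Sum>b\<in>F. (cmod (L2_inner M u b))\<^sup>2)"
      unfolding t_def by (rule sum.swap)
    also have "\<dots> \<le> (\<Sum>u\<in>U. 1)"
    proof (rule sum_mono)
      fix u assume u: "u \<in> U"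
      have "(\<Sum>b\<in>F. (cmod (L2_inner M u b))\<^sup>2) = (\<Sum>b\<in>F. (cmod (L2_inner M b u))\<^sup>2)"
        by (intro sum.cong) (simp_all add: L2_inner_commute[of M u])
      also have "\<dots> \<le> (L2_norm M u)\<^sup>2"
        by (intro L2_bessel L2_orthonormal_subset[OF on] F L2_orthonormalD(1)[OF U(1) u])
      also have "\<dots> = 1" using L2_orthonormal_norm[OF U(1) u] by simp
      finally show "(\<Sum>b\<in>F. (cmod (L2_inner M u b))\<^sup>2) \<le> 1" .
    qed
    finally show ?thesis by simp
  qed
  have nonneg: "0 \<le> t b" for b by (simp add: t_def sum_nonneg)
  \<comment> \<open>A divergent \<open>infsum\<close> is 0 by default, so convergence has to be
    established before the value means anything.\<close>
  have "t summable_on B"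
    using fin_le nonneg by (intro nonneg_bdd_above_summable_on) (auto simp: bdd_above_def)
  then have sum: "(t has_sum (\<Sum>\<^sub>\<infinity>b\<in>B. t b)) B" by (rule has_sum_infsum)
  then have "L2_trace M S = complex_of_real (\<Sum>\<^sub>\<infinity>b\<in>B. t b)"
    unfolding tr by (intro infsumI has_sum_of_real)
  then have Re: "Re (L2_trace M S) = (\<Sum>\<^sub>\<infinity>b\<in>B. t b)" by simp
  show "0 \<le> Re (L2_trace M S)" unfolding Re by (intro infsum_nonneg nonneg)
  show "Re (L2_trace M S) \<le> card U"
    unfolding Re by (rule infsum_le_finite_sums[OF \<open>t summable_on B\<close> fin_le])
qed

lemma schatten_norm_projection_le:
  assumes fin: "finite_measure M" and U: "L2_orthonormal M U" "finite U" and \<alpha>: "0 < \<alpha>"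
  shows "schatten_norm M (ereal \<alpha>) (L2_projection M U) \<le> real (card U) powr (1 / \<alpha>)"
proof -
  let ?A = "L2_projection M U"
  define T where "T = L2_adjoint M ?A \<circ> ?A"
  have T: "AE x in M. T f x = ?A f x" if "f \<in> L2_space M" for f
    using L2_adjoint_projection[OF U L2_projection_space[OF U(1)], of f] L2_projection_idem[OF U, of f]
    by (simp add: T_def)
  have s: "0 < real_of_ereal (ereal \<alpha>) / 2" using \<alpha> by simp
  note S = L2_power_projection[OF fin U s T]
  have "0 \<le> Re (L2_trace M (L2_power M T (real_of_ereal (ereal \<alpha>) / 2)))"
    "Re (L2_trace M (L2_power M T (real_of_ereal (ereal \<alpha>) / 2))) \<le> real (card U)"
    by (rule L2_trace_projection[OF U S]; assumption)+
  then show ?thesis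
    using \<alpha> by (simp add: schatten_norm_def T_def powr_mono2)
qed

lemma schatten_norm_infinity_projection_le:
  assumes U: "L2_orthonormal M U" "finite U"
  shows "schatten_norm M \<infinity> (L2_projection M U) \<le> 1"
proof -
  have "L2_opnorm M (L2_projection M U) \<le> 1"
    unfolding L2_opnorm_def
  proof (rule cSup_least)
    have "L2_norm M (\<lambda>x. 0) \<le> 1" by (simp add: L2_norm_def)
    then show "{L2_norm M (L2_projection M U f) |f. f \<in> L2_space M \<and> L2_norm M f \<le> 1} \<noteq> {}"
      using L2_space_zero by blast
  qed (use L2_norm_projection_le[OF U] in force)
  then show ?thesis by (simp add: schatten_norm_def)
qed


section \<open>The area measure of the sphere\<close>

lemma measurable_sphere_param:
  "sphere_param \<in> density (restrict_space lborel \<Omega>) w \<rightarrow>\<^sub>M restrict_space borel (sphere 0 1)"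
  using measurable_restrict_space1[OF sphere_param_measurable] by simp

lemma space_sphere_measure [simp]: "space sphere_measure = sphere 0 1"
  by (simp add: sphere_measure_def space_restrict_space)

lemma sets_sphere_measure [measurable_cong]: "sets sphere_measure = sets (restrict_space borel (sphere 0 1))"
  by (simp add: sphere_measure_def)

lemma measurable_sphere_nth [measurable]: "(\<lambda>\<omega>. \<omega> $ i) \<in> borel_measurable sphere_measure"
proof -
  have "(\<lambda>\<omega>::real^3. \<omega> $ i) \<in> borel_measurable borel"
    by (intro borel_measurable_continuous_onI continuous_intros)
  then have "(\<lambda>\<omega>::real^3. \<omega> $ i) \<in> borel_measurable (restrict_space borel (sphere 0 1))"
    by (rule measurable_restrict_space1)
  then show ?thesis by (simp cong: measurable_cong_sets add: sets_sphere_measure)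
qed

lemma sphere_abs_nth_le_1: "\<omega> \<in> sphere 0 1 \<Longrightarrow> \<bar>\<omega> $ i\<bar> \<le> (1::real)"
  using component_le_norm_cart[of \<omega> i] by simp

abbreviation sphere_rect :: "(real \<times> real) set" where
  "sphere_rect \<equiv> {0<..<pi} \<times> {0<..<2*pi}"

lemma sphere_rect_measurable [measurable]: "sphere_rect \<in> sets borel"
  by (intro borel_open open_Times) auto

lemma measurable_sin_weight [measurable]: "(\<lambda>(\<theta>, \<phi>). ennreal (sin \<theta>)) \<in> borel_measurable (restrict_space lborel \<Omega>)"
  unfolding case_prod_beta
  by (intro measurable_restrict_space1 measurable_compose[OF _ measurable_ennreal] )
    (auto intro!: borel_measurable_continuous_onI continuous_intros)

lemma nn_integral_sphere_measure:
  assumes "F \<in> borel_measurable sphere_measure"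
  shows "(\<integral>\<^sup>+\<omega>. F \<omega> \<partial>sphere_measure) =
    (\<integral>\<^sup>+x. ennreal (sin (fst x)) * F (sphere_param x) * indicator sphere_rect x \<partial>lborel)"
proof -
  have F: "F \<in> borel_measurable (restrict_space borel (sphere 0 1))"
    using assms by (simp cong: measurable_cong_sets add: sets_sphere_measure)
  have "(\<lambda>x. F (sphere_param x)) \<in> borel_measurable (restrict_space lborel sphere_rect)"
    using measurable_compose[OF measurable_restrict_space1[OF sphere_param_measurable] F] .
  then show ?thesis
    unfolding sphere_measure_def
    by (subst nn_integral_distr[OF measurable_sphere_param])
      (simp_all add: F nn_integral_density nn_integral_restrict_space case_prod_beta)
qed

text \<open>Archimedes' theorem: the height is uniformly distributed. The substitution uses -cos
  \<theta> because it is increasing on [0, pi]; the reflection this introduces is undone by the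
  symmetry of Lebesgue measure.\<close>

lemma distr_sphere_measure_height:
  "distr sphere_measure borel (\<lambda>\<omega>. \<omega> $ 3) = density lborel (\<lambda>x. ennreal (2 * pi) * indicator {-1..1} x)"
proof (rule measure_eqI)
  fix A assume "A \<in> sets (distr sphere_measure borel (\<lambda>\<omega>. \<omega> $ 3))"
  then have A [measurable]: "A \<in> sets borel" by simp
  let ?a = "\<lambda>x. indicator A x :: ennreal"
  let ?b = "\<lambda>x. indicator (uminus -` A) x :: real"
  have A' [measurable]: "uminus -` A \<in> sets (borel :: real measure)"
    using measurable_sets_borel[OF borel_measurable_uminus[OF measurable_ident] A] by (simp add: id_def)
  have "emeasure (distr sphere_measure borel (\<lambda>\<omega>. \<omega> $ 3)) A = (\<integral>\<^sup>+\<omega>. ?a (\<omega> $ 3) \<partial>sphere_measure)"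
    by (subst nn_integral_distr[symmetric, where f="?a" and T="\<lambda>\<omega>. \<omega> $ 3" and M'=borel]) simp_all
  also have "\<dots> = (\<integral>\<^sup>+x. ennreal (sin (fst x)) * ?a (cos (fst x)) * indicator sphere_rect x \<partial>(lborel \<Otimes>\<^sub>M lborel))"
    unfolding lborel_prod
    by (subst nn_integral_sphere_measure) (auto simp: sphere_param_def case_prod_beta vector_3 intro!: nn_integral_cong)
  also have "\<dots> = (\<integral>\<^sup>+\<theta>. \<integral>\<^sup>+\<phi>. ennreal (sin \<theta>) * ?a (cos \<theta>) * indicator {0<..<pi} \<theta> * indicator {0<..<2*pi} \<phi> \<partial>lborel \<partial>lborel)"
    by (subst lborel.nn_integral_fst[symmetric]) (auto simp: indicator_times mult.assoc)
  also have "\<dots> = (\<integral>\<^sup>+\<theta>. ennreal (sin \<theta>) * ?a (cos \<theta>) * indicator {0<..<pi} \<theta> * ennreal (2 * pi) \<partial>lborel)"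
    by (intro nn_integral_cong) (simp add: nn_integral_cmult)
  also have "\<dots> = (\<integral>\<^sup>+\<theta>. ennreal (sin \<theta>) * ?a (cos \<theta>) * indicator {0<..<pi} \<theta> \<partial>lborel) * ennreal (2 * pi)"
    by (intro nn_integral_multc) measurable
  also have "(\<integral>\<^sup>+\<theta>. ennreal (sin \<theta>) * ?a (cos \<theta>) * indicator {0<..<pi} \<theta> \<partial>lborel)
     = (\<integral>\<^sup>+\<theta>. ennreal (?b (- cos \<theta>) * sin \<theta> * indicator {0..pi} \<theta>) \<partial>lborel)"
  proof (rule nn_integral_cong_AE)
    show "AE \<theta> in lborel. ennreal (sin \<theta>) * ?a (cos \<theta>) * indicator {0<..<pi} \<theta> = ennreal (?b (- cos \<theta>) * sin \<theta> * indicator {0..pi} \<theta>)"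
      using AE_lborel_singleton[of 0] AE_lborel_singleton[of pi]
      by eventually_elim (auto simp: indicator_def)
  qed
  also have "\<dots> = (\<integral>\<^sup>+x. ennreal (?b x * indicator {-1..1} x) \<partial>lborel)"
  proof -
    have "((\<lambda>x. - cos x) has_real_derivative sin x) (at x)" for x :: real
      by (auto intro!: derivative_eq_intros)
    moreover have "continuous_on {0..pi} (sin :: real \<Rightarrow> real)" by (intro continuous_intros)
    ultimately show ?thesis
      using nn_integral_substitution[of "\<lambda>x. - cos x" 0 pi ?b sin]
      by (simp add: set_borel_measurable_def sin_ge_zero)
  qed
  also have "\<dots> = (\<integral>\<^sup>+x. ennreal (?b x * indicator {-1..1} x) \<partial>distr lborel borel uminus)"
    unfolding lborel_distr_uminus ..
  also have "\<dots> = (\<integral>\<^sup>+x. ?a x * indicator {-1..1} x \<partial>lborel)"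
    by (subst nn_integral_distr) (auto intro!: nn_integral_cong simp: indicator_def)
  also have "\<dots> * ennreal (2 * pi) = emeasure (density lborel (\<lambda>x. ennreal (2 * pi) * indicator {-1..1} x)) A"
    by (subst emeasure_density) (auto simp: mult.commute mult.left_commute nn_integral_cmult[symmetric])
  finally show "emeasure (distr sphere_measure borel (\<lambda>\<omega>. \<omega> $ 3)) A = emeasure (density lborel (\<lambda>x. ennreal (2 * pi) * indicator {-1..1} x)) A" .
qed simp

lemma measure_sphere_slab:
  assumes "-1 \<le> a" "a \<le> b" "b \<le> 1"
  shows "emeasure sphere_measure {\<omega> \<in> sphere 0 1. \<omega> $ 3 \<in> {a..b}} = ennreal (2 * pi * (b - a))"
proof -
  have "emeasure sphere_measure {\<omega> \<in> sphere 0 1. \<omega> $ 3 \<in> {a..b}} = emeasure (distr sphere_measure borel (\<lambda>\<omega>. \<omega> $ 3)) {a..b}"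
    by (subst emeasure_distr) (auto intro!: arg_cong[where f="emeasure sphere_measure"])
  also have "\<dots> = (\<integral>\<^sup>+x. ennreal (2 * pi) * indicator {a..b} x \<partial>lborel)"
    unfolding distr_sphere_measure_height
    by (subst emeasure_density) (use assms in \<open>auto intro!: nn_integral_cong simp: indicator_def\<close>)
  also have "\<dots> = ennreal (2 * pi * (b - a))"
    using assms by (simp add: nn_integral_cmult ennreal_mult)
  finally show ?thesis .
qed

lemma finite_measure_sphere: "finite_measure sphere_measure"
proof
  have "emeasure sphere_measure (space sphere_measure) = emeasure sphere_measure {\<omega> \<in> sphere 0 1. \<omega> $ 3 \<in> {-1..1}}"
    using sphere_abs_nth_le_1[of _ "3::3"] by (intro arg_cong[where f="emeasure sphere_measure"]) (auto simp: abs_le_iff)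
  then show "emeasure sphere_measure (space sphere_measure) \<noteq> \<infinity>"
    by (simp only: measure_sphere_slab) simp
qed

lemma integral_sphere_height:
  fixes \<phi> :: "real \<Rightarrow> real"
  assumes "continuous_on {-1..1} \<phi>"
  shows "integrable sphere_measure (\<lambda>\<omega>. \<phi> (\<omega> $ 3))"
    and "(LINT \<omega>|sphere_measure. \<phi> (\<omega> $ 3)) = 2 * pi * integral {-1..1} \<phi>"
proof -
  \<comment> \<open>Continuity of \<open>\<phi>\<close> is known on [-1, 1] only; the extension by 0
    is Borel on the line and agrees with it at all heights of the sphere.\<close>
  define \<psi> where "\<psi> x = indicator {-1..1} x *\<^sub>R \<phi> x" for x
  have [measurable]: "\<psi> \<in> borel_measurable borel"
    unfolding \<psi>_def using borel_measurable_continuous_on_indicator[OF _ assms] by simp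
  have \<psi>int: "integrable lborel \<psi>"
    unfolding \<psi>_def using borel_integrable_compact[OF compact_Icc assms] by simp
  have dens: "density lborel (\<lambda>x. ennreal (2 * pi) * indicator {-1..1} x) = density lborel (\<lambda>x. ennreal (2 * pi * indicator {-1..1::real} x))"
    by (intro density_cong) (auto simp: indicator_def)
  have eq: "\<phi> (\<omega> $ 3) = \<psi> (\<omega> $ 3)" if "\<omega> \<in> space sphere_measure" for \<omega>
    using sphere_abs_nth_le_1[of \<omega> 3] that by (auto simp: \<psi>_def abs_le_iff)
  have *: "(\<lambda>x. (2 * pi * indicator {-1..1} x) *\<^sub>R \<psi> x) = (\<lambda>x. 2 * pi * \<psi> x)"
    by (auto simp: \<psi>_def indicator_def)
  have "integrable (distr sphere_measure borel (\<lambda>\<omega>. \<omega> $ 3)) \<psi>"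
    unfolding distr_sphere_measure_height dens
    by (subst integrable_density, simp, simp, simp, unfold *) (use \<psi>int in simp)
  then have "integrable sphere_measure (\<lambda>\<omega>. \<psi> (\<omega> $ 3))"
    by (subst (asm) integrable_distr_eq) auto
  moreover have "integrable sphere_measure (\<lambda>\<omega>. \<phi> (\<omega> $ 3)) = integrable sphere_measure (\<lambda>\<omega>. \<psi> (\<omega> $ 3))"
    by (rule Bochner_Integration.integrable_cong[OF refl]) (rule eq)
  ultimately show "integrable sphere_measure (\<lambda>\<omega>. \<phi> (\<omega> $ 3))" by simp
  have "(LINT \<omega>|sphere_measure. \<phi> (\<omega> $ 3)) = (LINT \<omega>|sphere_measure. \<psi> (\<omega> $ 3))"
    using eq by (intro Bochner_Integration.integral_cong) auto
  also have "\<dots> = (LINT x|distr sphere_measure borel (\<lambda>\<omega>. \<omega> $ 3). \<psi> x)"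
    by (subst integral_distr) auto
  also have "\<dots> = (LINT x|lborel. 2 * pi * \<psi> x)"
    unfolding distr_sphere_measure_height dens
    by (subst integral_density, simp, simp, simp, unfold *) simp
  also have "\<dots> = 2 * pi * (LINT x|lborel. \<psi> x)" by simp
  also have "(LINT x|lborel. \<psi> x) = integral {-1..1} \<phi>"
    using set_borel_integral_eq_integral(2)[of "{-1..1}" \<phi>] \<psi>int
    by (simp add: \<psi>_def[abs_def] set_lebesgue_integral_def set_integrable_def)
  finally show "(LINT \<omega>|sphere_measure. \<phi> (\<omega> $ 3)) = 2 * pi * integral {-1..1} \<phi>" .
qed


section \<open>Lower bounds of Lebesgue norms\<close>

text \<open>The tangent at t lies below the convex function y^q. This follows from Young's
  inequality with exponents q and q / (q - 1); at q = 1, where there is no finite conjugate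
  exponent, both sides are equal.\<close>

lemma powr_ge_tangent:
  fixes q :: real
  assumes q: "1 \<le> q" and y: "0 \<le> y" and t: "0 < t"
  shows "t powr q + q * t powr (q - 1) * (y - t) \<le> y powr q"
proof (cases "q = 1")
  case True
  then show ?thesis using y t by simp
next
  case False
  define s where "s = q / (q - 1)"
  have s: "s > 1" "1 / q + 1 / s = 1" using q False by (auto simp: s_def field_simps)
  have "y * t powr (q - 1) \<le> y powr q / q + (t powr (q - 1)) powr s / s"
    using q False s y by (intro Youngs_inequality) auto
  also have "(t powr (q - 1)) powr s = t powr q"
    using q False by (simp add: powr_powr s_def)
  finally have "q * (y * t powr (q - 1)) \<le> q * (y powr q / q + t powr q / s)"
    using q by (intro mult_left_mono) auto
  also have "\<dots> = y powr q + (q - 1) * t powr q"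
    using q False by (simp add: s_def field_simps)
  finally have "q * (y * t powr (q - 1)) \<le> y powr q + (q - 1) * t powr q" .
  moreover have "t powr q = t powr (q - 1) * t"
    using t by (simp add: powr_diff)
  ultimately show ?thesis by (simp add: algebra_simps)
qed

text \<open>The tangent inequality at t is integrated over \<open>E\<close>; its linear term is
  nonnegative by \<open>avg\<close>. The bound \<open>C\<close> secures integrability, without which
  the integral in \<open>Lp_norm\<close> would be 0 by default.\<close>

lemma Lp_norm_ge_average:
  fixes f :: "'a \<Rightarrow> real" and q :: real
  assumes fin: "finite_measure M" and f [measurable]: "f \<in> borel_measurable M"
    and bounds: "\<And>x. x \<in> space M \<Longrightarrow> 0 \<le> f x" "\<And>x. x \<in> space M \<Longrightarrow> f x \<le> C"
    and E [measurable]: "E \<in> sets M" and t: "0 < t"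
    and avg: "t * measure M E \<le> (LINT x|M. indicator E x * f x)" and q: "1 \<le> q"
  shows "t * measure M E powr (1 / q) \<le> Lp_norm M (ereal q) f"
proof -
  interpret finite_measure M by (rule fin)
  have intE: "integrable M (\<lambda>x. indicator E x :: real)"
    by (rule integrable_const_bound[of _ 1]) (auto simp: indicator_def)
  have intf: "integrable M (\<lambda>x. indicator E x * f x)"
  proof (rule integrable_const_bound[of _ "\<bar>C\<bar>"])
    show "AE x in M. norm (indicator E x * f x) \<le> \<bar>C\<bar>"
      using bounds by (intro AE_I2) (fastforce simp: indicator_def)
  qed measurable
  have intq: "integrable M (\<lambda>x. \<bar>f x\<bar> powr q)"
  proof (rule integrable_const_bound[of _ "\<bar>C\<bar> powr q"])
    show "AE x in M. norm (\<bar>f x\<bar> powr q) \<le> \<bar>C\<bar> powr q"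
    proof (rule AE_I2)
      fix x assume "x \<in> space M"
      from bounds[OF this] have "\<bar>f x\<bar> \<le> \<bar>C\<bar>" by auto
      then show "norm (\<bar>f x\<bar> powr q) \<le> \<bar>C\<bar> powr q" using q by (simp add: powr_mono2)
    qed
  qed measurable
  have "t powr q * measure M E \<le>
    t powr q * measure M E + q * t powr (q - 1) * ((LINT x|M. indicator E x * f x) - t * measure M E)"
    using avg q by simp
  also have "\<dots> = (LINT x|M. t powr q * indicator E x + q * t powr (q - 1) * (indicator E x * f x - t * indicator E x))"
    using intE intf by simp
  also have "\<dots> \<le> (LINT x|M. \<bar>f x\<bar> powr q)"
  proof (rule integral_mono)
    fix x assume "x \<in> space M"
    from bounds(1)[OF this] powr_ge_tangent[OF q _ t, of "f x"]
    show "t powr q * indicator E x + q * t powr (q - 1) * (indicator E x * f x - t * indicator E x) \<le> \<bar>f x\<bar> powr q"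
      by (simp add: indicator_def)
  qed (use intE intf intq in auto)
  finally have "(t powr q * measure M E) powr (1 / q) \<le> (LINT x|M. \<bar>f x\<bar> powr q) powr (1 / q)"
    using q by (intro powr_mono2) auto
  moreover have "(t powr q * measure M E) powr (1 / q) = t * measure M E powr (1 / q)"
    using t q by (simp add: powr_mult powr_powr)
  ultimately show ?thesis by (simp add: Lp_norm_def)
qed

lemma Lp_norm_infinity_ge_average:
  fixes f :: "'a \<Rightarrow> real"
  assumes fin: "finite_measure M" and f [measurable]: "f \<in> borel_measurable M"
    and bounds: "\<And>x. x \<in> space M \<Longrightarrow> 0 \<le> f x" "\<And>x. x \<in> space M \<Longrightarrow> f x \<le> C"
    and E [measurable]: "E \<in> sets M" and pos: "0 < measure M E"
    and avg: "t * measure M E \<le> (LINT x|M. indicator E x * f x)"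
  shows "t \<le> Lp_norm M \<infinity> f"
proof (rule ccontr)
  interpret finite_measure M by (rule fin)
  define S where "S = esssup M (\<lambda>x. ereal \<bar>f x\<bar>)"
  assume "\<not> t \<le> Lp_norm M \<infinity> f"
  then have t: "real_of_ereal S < t" by (simp add: Lp_norm_def S_def)
  \<comment> \<open>\<open>real_of_ereal\<close> sends both infinities to 0, so the essential
    supremum must be shown finite: \<open>C\<close> bounds it above, and it is -\<infinity> only if
    the whole space is null.\<close>
  have "AE x in M. ereal \<bar>f x\<bar> \<le> ereal C"
    using bounds by (intro AE_I2) auto
  then have SC: "S \<le> ereal C" unfolding S_def by (intro esssup_I) auto
  have AE: "AE x in M. ereal \<bar>f x\<bar> \<le> S" unfolding S_def by (rule esssup_AE)
  have "S \<noteq> -\<infinity>"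
  proof
    assume "S = -\<infinity>"
    with AE have "AE x in M. False" by simp
    then have "emeasure M (space M) = 0" by (simp add: AE_iff_null_sets null_setsD1)
    then have "measure M E \<le> 0" using bounded_measure[of E] by (simp add: measure_def)
    with pos show False by simp
  qed
  with SC obtain s where s: "S = ereal s" by (cases S) auto
  have intE: "integrable M (\<lambda>x. indicator E x :: real)"
    by (rule integrable_const_bound[of _ 1]) (auto simp: indicator_def)
  have "(LINT x|M. indicator E x * f x) \<le> (LINT x|M. s * indicator E x)"
  proof (rule integral_mono_AE)
    show "integrable M (\<lambda>x. indicator E x * f x)"
    proof (rule integrable_const_bound[of _ "\<bar>C\<bar>"])
      show "AE x in M. norm (indicator E x * f x) \<le> \<bar>C\<bar>"
        using bounds by (intro AE_I2) (fastforce simp: indicator_def)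
    qed measurable
    show "AE x in M. indicator E x * f x \<le> s * indicator E x"
      using AE by eventually_elim (auto simp: s indicator_def)
  qed (use intE in auto)
  also have "\<dots> = s * measure M E" by simp
  finally have "t * measure M E \<le> s * measure M E" using avg by simp
  with pos t s show False by simp
qed


section \<open>Spherical harmonics as an orthonormal system\<close>

lemma integral_sphere_measure:
  fixes F :: "real^3 \<Rightarrow> complex"
  assumes "F \<in> borel_measurable sphere_measure"
  shows "(LINT \<omega>|sphere_measure. F \<omega>) =
    (LINT x|lborel. indicator sphere_rect x *\<^sub>R (sin (fst x) *\<^sub>R F (sphere_param x)))"
proof -
  have F: "F \<in> borel_measurable (restrict_space borel (sphere 0 1))"
    using assms by (simp cong: measurable_cong_sets add: sets_sphere_measure)
  have FP: "(\<lambda>x. F (sphere_param x)) \<in> borel_measurable (restrict_space lborel sphere_rect)"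
    using measurable_compose[OF measurable_restrict_space1[OF sphere_param_measurable] F] .
  have sin: "(\<lambda>x. sin (fst x)) \<in> borel_measurable (restrict_space lborel sphere_rect)"
    by (intro measurable_restrict_space1) (auto intro!: borel_measurable_continuous_onI continuous_intros)
  have "(LINT \<omega>|sphere_measure. F \<omega>) =
    (LINT x|density (restrict_space lborel sphere_rect) (\<lambda>x. ennreal (sin (fst x))). F (sphere_param x))"
    unfolding sphere_measure_def case_prod_beta by (rule integral_distr[OF measurable_sphere_param F])
  also have "\<dots> = (LINT x|restrict_space lborel sphere_rect. sin (fst x) *\<^sub>R F (sphere_param x))"
    by (rule integral_density[OF FP sin], rule AE_I2) (auto simp: space_restrict_space sin_ge_zero)
  also have "\<dots> = (LINT x|lborel. indicator sphere_rect x *\<^sub>R (sin (fst x) *\<^sub>R F (sphere_param x)))"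
    by (rule integral_restrict_space) simp
  finally show ?thesis .
qed

lemma integral_exp_period:
  assumes "k \<noteq> (0::int)"
  shows "(LINT \<phi>|lborel. indicator {0<..<2*pi} \<phi> *\<^sub>R exp (\<i> * of_int k * complex_of_real \<phi>)) = 0"
proof -
  let ?e = "\<lambda>\<phi>::real. exp (\<i> * of_int k * complex_of_real \<phi>)"
  have cont: "continuous_on UNIV ?e" by (intro continuous_intros)
  then have [measurable]: "?e \<in> borel_measurable borel" by (rule borel_measurable_continuous_onI)
  have "(LINT \<phi>|lborel. indicator {0<..<2*pi} \<phi> *\<^sub>R ?e \<phi>) = (LINT \<phi>|lborel. indicator {0..2*pi} \<phi> *\<^sub>R ?e \<phi>)"
  proof (rule integral_cong_AE)
    show "AE \<phi> in lborel. indicator {0<..<2*pi} \<phi> *\<^sub>R ?e \<phi> = indicator {0..2*pi} \<phi> *\<^sub>R ?e \<phi>"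
      using AE_lborel_singleton[of 0] AE_lborel_singleton[of "2*pi"]
      by eventually_elim (auto simp: indicator_def)
  qed measurable
  also have "\<dots> = ?e (2 * pi) / (\<i> * of_int k) - ?e 0 / (\<i> * of_int k)"
  proof (rule integral_FTC_Icc)
    fix x :: real
    have "((\<lambda>z. exp (\<i> * of_int k * z) / (\<i> * of_int k)) has_field_derivative ?e x) (at (complex_of_real x))"
      using assms by (auto intro!: derivative_eq_intros)
    then show "((\<lambda>\<phi>. ?e \<phi> / (\<i> * of_int k)) has_vector_derivative ?e x) (at x within {0..2*pi})"
      by (rule has_vector_derivative_real_field)
  qed (use cont in \<open>auto intro: continuous_on_subset\<close>)
  also have "?e (2 * pi) = 1"
    using exp_integer_2pi[of "of_int k"] by (simp add: mult_ac)
  finally show ?thesis by simp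
qed

lemma assoc_legendre_square:
  assumes "n \<le> l" "\<bar>x\<bar> \<le> 1"
  shows "fact (l - n) / fact (l + n) * (assoc_legendre l (int n) x)\<^sup>2 = legendre_sq 0 l n x / (2 ^ l * fact l)\<^sup>2"
proof -
  have "(sqrt (1 - x\<^sup>2))\<^sup>2 = 1 - x\<^sup>2" using assms(2) by (simp add: abs_square_le_1)
  moreover have "(sqrt (1 - x\<^sup>2) ^ n)\<^sup>2 = ((sqrt (1 - x\<^sup>2))\<^sup>2) ^ n"
    by (simp only: power_mult[symmetric] mult.commute)
  ultimately have "(sqrt (1 - x\<^sup>2) ^ n)\<^sup>2 = (1 - x\<^sup>2) ^ n" by (simp only:)
  moreover have "(((-1) ^ n)\<^sup>2 :: real) = 1" by (simp add: power_mult[symmetric])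
  ultimately show ?thesis
    by (simp add: assoc_legendre_def legendre_sq_def power_mult_distrib power_divide rodrigues_deriv_def nat_int_add)
qed

lemma cmod_sph_harm_square:
  assumes "n \<le> l" "\<bar>\<omega> $ 3\<bar> \<le> 1"
  shows "(cmod (sph_harm l (int n) \<omega>))\<^sup>2 = (2 * real l + 1) / (4 * pi * (2 ^ l * fact l)\<^sup>2) * legendre_sq 0 l n (\<omega> $ 3)"
proof -
  have nat: "nat (int l - int n) = l - n" "nat (int l + int n) = l + n" by auto
  have "(cmod (sph_harm l (int n) \<omega>))\<^sup>2 =
     (2 * real l + 1) / (4 * pi) * (fact (l - n) / fact (l + n) * (assoc_legendre l (int n) (\<omega> $ 3))\<^sup>2)"
    unfolding sph_harm_def norm_mult norm_of_real norm_cis nat by (simp add: power_mult_distrib)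
  also have "\<dots> = (2 * real l + 1) / (4 * pi * (2 ^ l * fact l)\<^sup>2) * legendre_sq 0 l n (\<omega> $ 3)"
    unfolding assoc_legendre_square[OF assms] by simp
  finally show ?thesis .
qed

text \<open>\<open>Arg2pi\<close> jumps across the positive real axis, but its integer multiples
  inside \<open>cis\<close> are powers of z / |z|, which are plainly Borel. The value at 0 reflects
  \<open>Arg2pi 0 = 0\<close>.\<close>

lemma cis_Arg2pi_power:
  "cis (real n * Arg2pi z) = (if z = 0 then 1 else (z / complex_of_real (cmod z)) ^ n)"
proof (cases "z = 0")
  case False
  have "z = of_real (cmod z) * cis (Arg2pi z)"
    using Arg2pi_eq[of z] by (simp add: cis_conv_exp)
  then have "z / complex_of_real (cmod z) = cis (Arg2pi z)"
    using False by (metis mult.commute nonzero_mult_div_cancel_left norm_eq_zero of_real_eq_0_iff)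
  then show ?thesis using False by (simp add: Complex.DeMoivre)
next
  case True
  have "Arg2pi 0 = 0" by (simp add: Arg2pi_eq_0)
  then show ?thesis using True by simp
qed

lemma measurable_sph_harm [measurable]: "sph_harm l (int n) \<in> borel_measurable sphere_measure"
proof -
  have [measurable]: "assoc_legendre l (int n) \<in> borel_measurable borel"
    unfolding assoc_legendre_def[abs_def] power_int_of_nat
    by (intro borel_measurable_continuous_onI continuous_intros) auto
  have eq: "sph_harm l (int n) = (\<lambda>\<omega>. complex_of_real
       (sqrt ((2 * real l + 1) / (4 * pi) * (fact (nat (int l - int n)) / fact (nat (int l + int n))))
        * assoc_legendre l (int n) (\<omega> $ 3))
     * (let z = complex_of_real (\<omega> $ 1) + \<i> * complex_of_real (\<omega> $ 2) in
          if z = 0 then 1 else (z / complex_of_real (cmod z)) ^ n))"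
    by (simp add: sph_harm_def[abs_def] cis_Arg2pi_power Complex_eq Let_def)
  show ?thesis unfolding eq Let_def by measurable
qed

lemma sph_harm_L2_space:
  assumes "n \<le> l"
  shows "sph_harm l (int n) \<in> L2_space sphere_measure"
    and "L2_norm sphere_measure (sph_harm l (int n)) = 1"
proof -
  define K where "K = (2 * real l + 1) / (4 * pi * (2 ^ l * fact l)\<^sup>2)"
  have eq: "(cmod (sph_harm l (int n) \<omega>))\<^sup>2 = K * legendre_sq 0 l n (\<omega> $ 3)" if "\<omega> \<in> space sphere_measure" for \<omega>
    using cmod_sph_harm_square[OF assms sphere_abs_nth_le_1[of \<omega> 3]] that by (simp add: K_def)
  have cont: "continuous_on {-1..1} (\<lambda>x. K * legendre_sq 0 l n x)" by (intro continuous_intros)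
  have "integrable sphere_measure (\<lambda>\<omega>. (cmod (sph_harm l (int n) \<omega>))\<^sup>2) = integrable sphere_measure (\<lambda>\<omega>. K * legendre_sq 0 l n (\<omega> $ 3))"
    by (rule Bochner_Integration.integrable_cong[OF refl]) (rule eq)
  then show "sph_harm l (int n) \<in> L2_space sphere_measure"
    using integral_sphere_height(1)[OF cont] by (simp add: L2_space_def)
  have "(L2_norm sphere_measure (sph_harm l (int n)))\<^sup>2 = (LINT \<omega>|sphere_measure. K * legendre_sq 0 l n (\<omega> $ 3))"
    unfolding L2_norm_square using eq by (intro Bochner_Integration.integral_cong) auto
  also have "\<dots> = 2 * pi * (K * integral {-1..1} (legendre_sq 0 l n))"
    unfolding integral_sphere_height(2)[OF cont] by simp
  also have "\<dots> = 1"
  proof -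
    have "(2 ^ l * fact l :: real)\<^sup>2 \<noteq> 0" "2 * real l + 1 \<noteq> 0" by auto
    then show ?thesis unfolding integral_legendre_sq[OF assms] K_def by (simp only: field_simps) simp
  qed
  finally show "L2_norm sphere_measure (sph_harm l (int n)) = 1"
    using L2_norm_nonneg[of sphere_measure "sph_harm l (int n)"] by (simp add: power2_eq_1_iff)
qed

text \<open>In spherical coordinates the integrand is a function of \<theta> times exp(i (n - m)
  \<phi>), whose integral over a period is 0.\<close>

lemma sph_harm_orthogonal:
  assumes "m \<noteq> n"
  shows "L2_inner sphere_measure (sph_harm l (int m)) (sph_harm l (int n)) = 0"
proof -
  define g where "g k \<theta> = sqrt ((2 * real l + 1) / (4 * pi) * (fact (nat (int l - int k)) / fact (nat (int l + int k))))
        * assoc_legendre l (int k) (cos \<theta>)" for k \<theta>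
  define A where "A \<theta> = complex_of_real (indicator {0<..<pi} \<theta> * sin \<theta> * g m \<theta> * g n \<theta>)" for \<theta>
  define B where "B \<phi> = indicator {0<..<2*pi} \<phi> *\<^sub>R exp (\<i> * of_int (int n - int m) * complex_of_real \<phi>)" for \<phi>
  have "L2_inner sphere_measure (sph_harm l (int m)) (sph_harm l (int n)) =
    (LINT x|lborel. indicator sphere_rect x *\<^sub>R (sin (fst x) *\<^sub>R
      (cnj (sph_harm l (int m) (sphere_param x)) * sph_harm l (int n) (sphere_param x))))"
    unfolding L2_inner_def
    by (rule integral_sphere_measure)
      (intro borel_measurable_times measurable_compose[OF _ borel_measurable_cnj] measurable_sph_harm)
  also have "\<dots> = (LINT x|(lborel \<Otimes>\<^sub>M lborel). A (fst x) * B (snd x))"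
    unfolding lborel_prod
  proof (rule Bochner_Integration.integral_cong[OF refl])
    fix x :: "real \<times> real"
    show "indicator sphere_rect x *\<^sub>R (sin (fst x) *\<^sub>R
      (cnj (sph_harm l (int m) (sphere_param x)) * sph_harm l (int n) (sphere_param x))) = A (fst x) * B (snd x)"
    proof (cases "x \<in> sphere_rect")
      case False
      then show ?thesis by (cases x) (auto simp: A_def B_def indicator_def)
    next
      case True
      then obtain \<theta> \<phi> where x: "x = (\<theta>, \<phi>)" "0 < \<theta>" "\<theta> < pi" "0 < \<phi>" "\<phi> < 2 * pi" by (cases x) auto
      have Y: "sph_harm l (int k) (sphere_param x) = of_real (g k \<theta>) * exp (\<i> * of_int (int k) * of_real \<phi>)" for k
        unfolding x(1) g_def by (rule sph_harm_spherical_coordinates) (use x in auto)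
      have "cnj (exp (\<i> * of_int (int m) * of_real \<phi>)) * exp (\<i> * of_int (int n) * of_real \<phi>)
        = exp (\<i> * of_int (int n - int m) * complex_of_real \<phi>)"
        by (simp add: exp_cnj exp_add[symmetric] algebra_simps)
      then show ?thesis
        using x unfolding Y by (simp add: A_def B_def indicator_def scaleR_conv_of_real mult_ac)
    qed
  qed
  also have "\<dots> = 0"
  \<comment> \<open>A Bochner integral that does not exist is 0, the desired value, so only the
    integrable case calls for Fubini.\<close>
  proof (cases "integrable (lborel \<Otimes>\<^sub>M lborel) (\<lambda>x. A (fst x) * B (snd x))")
    case True
    have "(LINT x|(lborel \<Otimes>\<^sub>M lborel). A (fst x) * B (snd x)) = (LINT \<theta>|lborel. LINT \<phi>|lborel. A \<theta> * B \<phi>)"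
      using lborel_pair.integral_fst'[OF True] by simp
    also have "\<dots> = (LINT \<theta>|lborel. A \<theta> * (LINT \<phi>|lborel. B \<phi>))"
      by simp
    also have "(LINT \<phi>|lborel. B \<phi>) = 0"
      unfolding B_def by (rule integral_exp_period) (use assms in simp)
    finally have "(LINT x|(lborel \<Otimes>\<^sub>M lborel). A (fst x) * B (snd x)) = (LINT \<theta>|lborel. A \<theta> * 0)" .
    also have "\<dots> = 0" by simp
    finally show ?thesis .
  qed (rule not_integrable_integral_eq)
  finally show ?thesis .
qed

lemma sph_harm_orthonormal:
  assumes "I \<subseteq> {0..int l}"
  shows "L2_orthonormal sphere_measure (sph_harm l ` I)" and "inj_on (sph_harm l) I"
proof -
  have nat: "\<exists>n\<le>l. m = int n" if "m \<in> I" for m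
    using assms that by (intro exI[of _ "nat m"]) auto
  have self: "L2_inner sphere_measure (sph_harm l m) (sph_harm l m) = 1" if "m \<in> I" for m
    using nat[OF that] sph_harm_L2_space(2) by (auto simp: L2_inner_self)
  have orth: "L2_inner sphere_measure (sph_harm l m) (sph_harm l m') = 0" if "m \<in> I" "m' \<in> I" "m \<noteq> m'" for m m'
    using nat[OF that(1)] nat[OF that(2)] that(3) sph_harm_orthogonal by auto
  show inj: "inj_on (sph_harm l) I"
    using self orth by (intro inj_onI) (metis zero_neq_one)
  show "L2_orthonormal sphere_measure (sph_harm l ` I)"
    unfolding L2_orthonormal_def
  proof (intro conjI ballI)
    show "sph_harm l ` I \<subseteq> L2_space sphere_measure"
      using nat sph_harm_L2_space(1) by fastforce
    fix b b' assume "b \<in> sph_harm l ` I" "b' \<in> sph_harm l ` I"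
    then obtain m m' where "m \<in> I" "b = sph_harm l m" "m' \<in> I" "b' = sph_harm l m'" by auto
    then show "L2_inner sphere_measure b b' = (if b = b' then 1 else 0)"
      using self orth by (auto simp: inj_on_eq_iff[OF inj])
  qed
qed

lemma sph_operator_eq_projection:
  assumes "I \<subseteq> {0..int l}"
  shows "sph_operator l I = L2_projection sphere_measure (sph_harm l ` I)"
  by (simp add: sph_operator_def L2_projection_def rank_one_def fun_eq_iff
      sum.reindex[OF sph_harm_orthonormal(2)[OF assms]])

lemma schatten_norm_sph_operator_le:
  assumes "I \<subseteq> {0..int l}" "0 < \<alpha>"
  shows "schatten_norm sphere_measure (ereal \<alpha>) (sph_operator l I) \<le> real (card I) powr (1 / \<alpha>)"
proof -
  have "finite I" using assms(1) by (rule finite_subset) simp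
  then show ?thesis
    using schatten_norm_projection_le[OF finite_measure_sphere sph_harm_orthonormal(1)[OF assms(1)] _ assms(2)]
    by (simp add: sph_operator_eq_projection[OF assms(1)] card_image[OF sph_harm_orthonormal(2)[OF assms(1)]])
qed

lemma schatten_norm_infinity_sph_operator_le:
  assumes "I \<subseteq> {0..int l}"
  shows "schatten_norm sphere_measure \<infinity> (sph_operator l I) \<le> 1"
proof -
  have "finite I" using assms(1) by (rule finite_subset) simp
  then show ?thesis
    using schatten_norm_infinity_projection_le[OF sph_harm_orthonormal(1)[OF assms(1)]]
    by (simp add: sph_operator_eq_projection[OF assms(1)])
qed


section \<open>Densities and their norms\<close>

lemma sph_density_eq:
  assumes "N \<subseteq> {..l}" "\<omega> \<in> sphere 0 1"
  shows "sph_density l (int ` N) \<omega> =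
    (2 * real l + 1) / (4 * pi * (2 ^ l * fact l)\<^sup>2) * (\<Sum>n\<in>N. legendre_sq 0 l n (\<omega> $ 3))"
proof -
  have "sph_density l (int ` N) \<omega> = (\<Sum>n\<in>N. (cmod (sph_harm l (int n) \<omega>))\<^sup>2)"
    by (simp add: sph_density_def sum.reindex)
  also have "\<dots> = (\<Sum>n\<in>N. (2 * real l + 1) / (4 * pi * (2 ^ l * fact l)\<^sup>2) * legendre_sq 0 l n (\<omega> $ 3))"
    using assms by (intro sum.cong refl cmod_sph_harm_square sphere_abs_nth_le_1) auto
  finally show ?thesis by (simp add: sum_distrib_left)
qed

lemma sph_density_nonneg: "0 \<le> sph_density l I \<omega>"
  by (simp add: sph_density_def sum_nonneg)

lemma measurable_sph_density: "sph_density l (int ` N) \<in> borel_measurable sphere_measure"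
proof -
  have "sph_density l (int ` N) = (\<lambda>\<omega>. \<Sum>n\<in>N. (cmod (sph_harm l (int n) \<omega>))\<^sup>2)"
    by (simp add: sph_density_def[abs_def] sum.reindex)
  then show ?thesis by simp
qed

text \<open>The sum over all orders dominates and does not depend on the point. This supplies the
  bound \<open>C\<close> in the norm estimates.\<close>

lemma sph_density_le:
  assumes N: "N \<subseteq> {..l}" and \<omega>: "\<omega> \<in> sphere 0 1"
  shows "sph_density l (int ` N) \<omega> \<le> (2 * real l + 1) / (4 * pi)"
proof -
  let ?h = "\<lambda>n. legendre_sq 0 l n (\<omega> $ 3)"
  have x: "\<omega> $ 3 \<in> {-1..1}" using sphere_abs_nth_le_1[OF \<omega>, of 3] by auto
  have h: "0 \<le> ?h n" for n by (rule legendre_sq_nonneg[OF x])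
  have "(\<Sum>n\<in>N. ?h n) \<le> (\<Sum>n\<in>{..<Suc l}. ?h n)"
    using N h by (intro sum_mono2) auto
  also have "\<dots> = ?h 0 + (\<Sum>n<l. ?h (Suc n))" by (rule sum.lessThan_Suc_shift)
  also have "\<dots> \<le> ?h 0 + 2 * (\<Sum>n<l. ?h (Suc n))" using h by (simp add: sum_nonneg)
  also have "\<dots> = (2 ^ l * fact l)\<^sup>2" by (rule sum_legendre_sq)
  finally have "sph_density l (int ` N) \<omega> \<le> (2 * real l + 1) / (4 * pi * (2 ^ l * fact l)\<^sup>2) * (2 ^ l * fact l)\<^sup>2"
    unfolding sph_density_eq[OF assms] by (intro mult_left_mono) auto
  also have "\<dots> = (2 * real l + 1) / (4 * pi)" by simp
  finally show ?thesis .
qed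

section \<open>The two sets of orders and their cardinalities\<close>

lemma orders_two_eq_image:
  assumes "2 * r l \<le> real l"
  shows "orders_two r l = int ` {n. real l - 2 * r l < real n \<and> real n \<le> real l - r l}"
proof (intro subset_antisym subsetI)
  fix m assume "m \<in> orders_two r l"
  then have m: "real l - 2 * r l < of_int m" "of_int m \<le> real l - r l" by (auto simp: orders_two_def)
  then have "0 \<le> m" using assms by linarith
  then have "m = int (nat m)" "nat m \<in> {n. real l - 2 * r l < real n \<and> real n \<le> real l - r l}"
    using m by auto
  then show "m \<in> int ` {n. real l - 2 * r l < real n \<and> real n \<le> real l - r l}" by blast
qed (auto simp: orders_two_def)

lemma orders_infty_eq_image:
  assumes "0 \<le> r l"
  shows "orders_infty r l = int ` {n. r l \<le> real n \<and> real n < 2 * r l}"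
proof (intro subset_antisym subsetI)
  fix m assume "m \<in> orders_infty r l"
  then have m: "r l \<le> of_int m" "of_int m < 2 * r l" by (auto simp: orders_infty_def)
  then have "0 \<le> m" using assms by linarith
  then have "m = int (nat m)" "nat m \<in> {n. r l \<le> real n \<and> real n < 2 * r l}" using m by auto
  then show "m \<in> int ` {n. r l \<le> real n \<and> real n < 2 * r l}" by blast
qed (auto simp: orders_infty_def)

lemma card_orders_two:
  assumes "1 \<le> r l"
  shows "r l - 1 \<le> real (card (orders_two r l))" "real (card (orders_two r l)) \<le> r l + 1"
proof -
  have "orders_two r l = {\<lfloor>real l - 2 * r l\<rfloor> + 1..\<lfloor>real l - r l\<rfloor>}"
    by (auto simp: orders_two_def le_floor_iff) linarith+
  then have "real (card (orders_two r l)) = of_int (\<lfloor>real l - r l\<rfloor> - \<lfloor>real l - 2 * r l\<rfloor>)"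
    using assms by (auto simp: of_nat_nat floor_mono)
  then show "r l - 1 \<le> real (card (orders_two r l))" "real (card (orders_two r l)) \<le> r l + 1"
    by linarith+
qed

lemma card_orders_infty:
  assumes "0 \<le> r l"
  shows "real (card (orders_infty r l)) \<le> r l + 1"
proof -
  have "orders_infty r l = {\<lceil>r l\<rceil>..<\<lceil>2 * r l\<rceil>}"
    by (auto simp: orders_infty_def ceiling_le_iff less_ceiling_iff)
  then have "real (card (orders_infty r l)) = of_int (\<lceil>2 * r l\<rceil> - \<lceil>r l\<rceil>)"
    using assms by (auto simp: of_nat_nat ceiling_mono)
  then show ?thesis by linarith
qed

text \<open>The exponent 2 * (1/p) covers finite and infinite p alike. At p = \<infinity> it is 0,
  and since \<open>E\<close> has positive measure the factor is then 1.\<close>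

lemma Lp_norm_half_ge_average:
  fixes f :: "'a \<Rightarrow> real" and p :: ereal
  assumes fin: "finite_measure M" and f: "f \<in> borel_measurable M"
    and bounds: "\<And>x. x \<in> space M \<Longrightarrow> 0 \<le> f x" "\<And>x. x \<in> space M \<Longrightarrow> f x \<le> C"
    and E: "E \<in> sets M" "0 < measure M E" and t: "0 < t"
    and avg: "t * measure M E \<le> (LINT x|M. indicator E x * f x)" and p: "2 \<le> p"
  shows "t * measure M E powr (2 * real_of_ereal (1 / p)) \<le> Lp_norm M (p / 2) f"
proof (cases p)
  case (real a)
  then have a: "2 \<le> a" using p by simp
  have "p / 2 = ereal (a / 2)" "1 / p = ereal (1 / a)"
    using real a by (simp_all add: numeral_eq_ereal one_ereal_def)
  then show ?thesis
    using Lp_norm_ge_average[OF fin f bounds E(1) t avg, of "a / 2"] a by simp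
next
  case PInf
  then have "p / 2 = \<infinity>" "1 / p = 0" by (simp_all add: numeral_eq_ereal)
  then show ?thesis
    using Lp_norm_infinity_ge_average[OF fin f bounds E avg] E(2) by simp
qed (use p in auto)

section \<open>Lower bounds for the two densities\<close>

lemma real_of_ereal_inverse_bounds:
  fixes p :: ereal
  assumes "2 \<le> p"
  shows "0 \<le> real_of_ereal (1 / p)" "real_of_ereal (1 / p) \<le> 1 / 2" "real_of_ereal (4 / p) = 4 * real_of_ereal (1 / p)"
  using assms by (cases p; simp add: numeral_eq_ereal one_ereal_def)+

text \<open>The test polynomial \<open>(t - a\<^sup>2) * (4 * a\<^sup>2 - t)\<close> at \<open>t = m\<^sup>2\<close> is positive only for orders
  \<open>a < m < 2 * a\<close>, and its mean is explicit through the second and fourth moments of the order.\<close>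

lemma sum_legendre_sq_dyadic_ge:
  fixes a x :: real
  assumes a: "9 \<le> a" "2 * a \<le> real l" and x: "-1 < x" "x < 1"
    and s: "3 * a\<^sup>2 \<le> (1 - x\<^sup>2) * (real l * (real l + 1))" "(1 - x\<^sup>2) * (real l * (real l + 1)) \<le> 18/5 * a\<^sup>2"
  shows "(2 ^ l * fact l)\<^sup>2 / 45 \<le> (\<Sum>n | a \<le> real n \<and> real n < 2 * a. legendre_sq 0 l n x)"
proof -
  define A where "A = (2 ^ l * fact l :: real)\<^sup>2"
  define s where "s = (1 - x\<^sup>2) * (real l * (real l + 1))"
  define h where "h n = legendre_sq 0 l n x" for n
  define b where "b = a\<^sup>2"
  define q where "q t = (t - b) * (4 * b - t)" for t
  have A: "A > 0" by (simp add: A_def)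
  have b: "81 \<le> b" using power_mono[OF a(1), of 2] by (simp add: b_def)
  have l2: "2 \<le> l" using a by linarith
  have h: "0 \<le> h n" for n unfolding h_def using x by (intro legendre_sq_nonneg) auto
  have S0: "h 0 = A - 2 * (\<Sum>n<l. h (Suc n))"
    using sum_legendre_sq[of l x] by (simp add: h_def A_def)
  have S2: "(\<Sum>n<l. (real (Suc n))\<^sup>2 * h (Suc n)) = s / 4 * A"
    using sum_square_order_legendre_sq[OF x, of l] by (simp add: h_def A_def s_def)
  have S4: "(\<Sum>n<l. ((real (Suc n))^4 - (real (Suc n))\<^sup>2) * h (Suc n)) \<le> 3 / 16 * s\<^sup>2 * A"
  proof -
    have "(\<Sum>n<l. ((real (Suc n))^4 - (real (Suc n))\<^sup>2) * h (Suc n)) =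
      (1 - x\<^sup>2)\<^sup>2 * (3 * (real l - 1) * real l * (real l + 1) * (real l + 2) / 16 * A)"
      unfolding h_def A_def by (rule sum_fourth_order_legendre_sq[OF x l2])
    also have "\<dots> = 3 / 16 * s\<^sup>2 * A - 3 / 8 * (1 - x\<^sup>2)\<^sup>2 * (real l * (real l + 1)) * A"
      by (simp add: s_def field_simps power2_eq_square)
    also have "\<dots> \<le> 3 / 16 * s\<^sup>2 * A" using A by simp
    finally show ?thesis .
  qed
  have "q ((real (Suc n))\<^sup>2) * h (Suc n) \<le> (if a \<le> real (Suc n) \<and> real (Suc n) < 2 * a then 9/4 * b\<^sup>2 * h (Suc n) else 0)" for n
  proof (cases "a \<le> real (Suc n) \<and> real (Suc n) < 2 * a")
    case True
    \<comment> \<open>The maximum of \<open>q\<close> lies midway between its zeros b and 4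
      b.\<close>
    have "9/4 * b\<^sup>2 - q t = (t - 5/2 * b)\<^sup>2" for t by (simp add: q_def power2_eq_square field_simps)
    then have "q t \<le> 9/4 * b\<^sup>2" for t by (metis diff_ge_0_iff_ge zero_le_power2)
    then have "q ((real (Suc n))\<^sup>2) * h (Suc n) \<le> 9/4 * b\<^sup>2 * h (Suc n)" by (intro mult_right_mono h)
    then show ?thesis by (simp only: True if_True simp_thms)
  next
    case False
    have "q ((real (Suc n))\<^sup>2) \<le> 0"
    proof (cases "real (Suc n) < a")
      case True
      then have "(real (Suc n))\<^sup>2 \<le> b" unfolding b_def by (intro power_mono) auto
      then show ?thesis unfolding q_def using b by (intro mult_nonpos_nonneg) auto
    next
      case False
      with \<open>\<not> (a \<le> real (Suc n) \<and> real (Suc n) < 2 * a)\<close> have "(2 * a)\<^sup>2 \<le> (real (Suc n))\<^sup>2"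
        using a by (intro power_mono) auto
      then have "4 * b \<le> (real (Suc n))\<^sup>2" by (simp add: b_def power2_eq_square)
      then show ?thesis unfolding q_def using b by (intro mult_nonneg_nonpos) auto
    qed
    then have "q ((real (Suc n))\<^sup>2) * h (Suc n) \<le> 0" using h by (rule mult_nonpos_nonneg)
    then show ?thesis using False by auto
  qed
  then have "(\<Sum>n<l. q ((real (Suc n))\<^sup>2) * h (Suc n)) \<le> (\<Sum>n<l. if a \<le> real (Suc n) \<and> real (Suc n) < 2 * a then 9/4 * b\<^sup>2 * h (Suc n) else 0)"
    by (intro sum_mono)
  also have "\<dots> = (\<Sum>n\<in>{1..l}. if a \<le> real n \<and> real n < 2 * a then 9/4 * b\<^sup>2 * h n else 0)"
    using sum.atLeast1_atMost_eq[of "\<lambda>n. if a \<le> real n \<and> real n < 2 * a then 9/4 * b\<^sup>2 * h n else 0" l] by simp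
  also have "\<dots> = (\<Sum>n | a \<le> real n \<and> real n < 2 * a. 9/4 * b\<^sup>2 * h n)"
  proof -
    have "{n \<in> {1..l}. a \<le> real n \<and> real n < 2 * a} = {n. a \<le> real n \<and> real n < 2 * a}"
      using a by auto
    then show ?thesis by (simp add: sum.inter_filter[symmetric])
  qed
  finally have upper: "(\<Sum>n<l. q ((real (Suc n))\<^sup>2) * h (Suc n)) \<le> 9/4 * b\<^sup>2 * (\<Sum>n | a \<le> real n \<and> real n < 2 * a. h n)"
    by (simp add: sum_distrib_left)
  \<comment> \<open>Splitting n^4 = (n^4 - n^2) + n^2 lowers the coefficient of the second moment
    from 5 b to 5 b - 1.\<close>
  have "(\<Sum>n<l. q ((real (Suc n))\<^sup>2) * h (Suc n)) =
     (\<Sum>n<l. - 4 * b\<^sup>2 * h (Suc n) + (5 * b - 1) * ((real (Suc n))\<^sup>2 * h (Suc n)) - ((real (Suc n))^4 - (real (Suc n))\<^sup>2) * h (Suc n))"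
    by (intro sum.cong refl) (simp add: q_def power2_eq_square power4_eq_xxxx algebra_simps)
  also have "\<dots> = - 4 * b\<^sup>2 * (\<Sum>n<l. h (Suc n)) + (5 * b - 1) * (s / 4 * A) - (\<Sum>n<l. ((real (Suc n))^4 - (real (Suc n))\<^sup>2) * h (Suc n))"
    unfolding S2[symmetric] by (simp only: sum_subtractf sum.distrib sum_distrib_left)
  also have "\<dots> \<ge> - 2 * b\<^sup>2 * A + (5 * b - 1) * (s / 4 * A) - 3 / 16 * s\<^sup>2 * A"
  proof -
    \<comment> \<open>Order 0 is nonnegative, so the positive orders carry at most half of the
      total.\<close>
    have "2 * (\<Sum>n<l. h (Suc n)) \<le> A" using S0 h[of 0] by simp
    then have "2 * b\<^sup>2 * (2 * (\<Sum>n<l. h (Suc n))) \<le> 2 * b\<^sup>2 * A" by (intro mult_left_mono) auto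
    then show ?thesis using S4 by linarith
  qed
  finally have lower: "A * (- 2 * b\<^sup>2 + (5 * b - 1) * (s / 4) - 3 / 16 * s\<^sup>2) \<le> (\<Sum>n<l. q ((real (Suc n))\<^sup>2) * h (Suc n))"
    by (simp add: algebra_simps)
  have sb: "3 * b \<le> s" "s \<le> 18/5 * b" using assms(5,6) by (simp_all add: s_def b_def)
  \<comment> \<open>The leading part equals b^2 / 16 at s = 3 b and at s = 11 b / 3, hence the
    product in \<open>nonneg\<close>. The lower-order term satisfies s / 4 <= 9 b / 10 <= b^2 / 80
    once b >= 72, which 9 <= a ensures; and 1/16 - 1/80 = 1/20.\<close>
  have "b\<^sup>2 / 20 \<le> - 2 * b\<^sup>2 + (5 * b - 1) * (s / 4) - 3 / 16 * s\<^sup>2"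
  proof -
    have nonneg: "0 \<le> (s - 3 * b) * (11/3 * b - s)" using sb b by (intro mult_nonneg_nonneg) auto
    have "72 * b \<le> b * b" using b by (intro mult_right_mono) auto
    then have large: "72 * b \<le> b\<^sup>2" by (simp add: power2_eq_square)
    have "- 2 * b\<^sup>2 + (5 * b - 1) * (s / 4) - 3 / 16 * s\<^sup>2 =
        b\<^sup>2 / 16 - s / 4 + 3 / 16 * ((s - 3 * b) * (11/3 * b - s))"
      by (simp add: power2_eq_square field_simps)
    then show ?thesis using nonneg large sb by linarith
  qed
  then have "A * (b\<^sup>2 / 20) \<le> A * (- 2 * b\<^sup>2 + (5 * b - 1) * (s / 4) - 3 / 16 * s\<^sup>2)"
    using A by (intro mult_left_mono) auto
  also note lower
  also note upper
  \<comment> \<open>The constant is (1/20) / (9/4) = 1/45.\<close>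
  finally have "b\<^sup>2 * (A / 45) \<le> b\<^sup>2 * (\<Sum>n | a \<le> real n \<and> real n < 2 * a. h n)"
    by (simp add: mult_ac)
  then show ?thesis using b by (simp add: A_def h_def)
qed

lemma Lp_norm_rho_infty_ge:
  fixes p :: ereal
  assumes r: "9 \<le> r l" "r l \<le> real l / 10" and p: "2 \<le> p"
  shows "1 / (180 * pi) * real l powr (1 - real_of_ereal (4/p)) * r l powr real_of_ereal (4/p)
     \<le> Lp_norm sphere_measure (p / 2) (rho_infty r l)"
proof -
  define a where "a = r l"
  define \<theta> where "\<theta> = real_of_ereal (1 / p)"
  define \<Lambda> where "\<Lambda> = real l * (real l + 1)"
  define e where "e = a\<^sup>2 / \<Lambda>"
  define N where "N = {n. a \<le> real n \<and> real n < 2 * a}"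
  \<comment> \<open>A collar around the north pole, where sin \<theta> is of order r / l. For u = 1
    - x between 8 e / 5 and 9 e / 5, the value 1 - x^2 = 2 u - u^2 lies between 3 e and 18 e / 5,
    because u^2 <= e / 5 for e <= 1/100. This is the window of
    \<open>sum_legendre_sq_dyadic_ge\<close>, so the density is at least \<open>t\<close> at every
    point of \<open>E\<close>.\<close>
  define E where "E = {\<omega> :: real^3. \<omega> \<in> sphere 0 1 \<and> \<omega> $ 3 \<in> {1 - 9/5 * e .. 1 - 8/5 * e}}"
  define t where "t = real l / (90 * pi)"
  note \<theta> = real_of_ereal_inverse_bounds[OF p, folded \<theta>_def]
  have l: "real l \<ge> 90" "a \<le> real l / 10" "9 \<le> a" using r by (auto simp: a_def)
  have \<Lambda>: "0 < \<Lambda>" "(real l)\<^sup>2 \<le> \<Lambda>" "\<Lambda> \<le> 2 * (real l)\<^sup>2"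
    using l by (auto simp: \<Lambda>_def power2_eq_square algebra_simps intro!: mult_pos_pos add_pos_pos)
  have e0: "0 < e" using l \<Lambda> by (simp add: e_def)
  have e1: "e \<le> 1 / 100"
  proof -
    have "a\<^sup>2 \<le> (real l / 10)\<^sup>2" using l by (intro power_mono) auto
    also have "\<dots> \<le> \<Lambda> / 100" using \<Lambda> by (simp add: power_divide)
    finally show ?thesis using \<Lambda> by (simp add: e_def field_simps)
  qed
  have e2: "(a / real l)\<^sup>2 / 2 \<le> e"
    unfolding e_def power_divide using \<Lambda> l by (simp add: frac_le field_simps)
  have Nl: "N \<subseteq> {..l}" using l by (auto simp: N_def)
  have orders: "orders_infty r l = int ` N"
    unfolding N_def a_def by (rule orders_infty_eq_image) (use r in simp)
  have E: "E \<in> sets sphere_measure"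
  proof -
    have "E = (\<lambda>\<omega>. \<omega> $ 3) -` {1 - 9/5 * e .. 1 - 8/5 * e} \<inter> space sphere_measure" by (auto simp: E_def)
    then show ?thesis using measurable_sets[OF measurable_sphere_nth[of 3], of "{1 - 9/5 * e .. 1 - 8/5 * e}"] by simp
  qed
  have mE: "measure sphere_measure E = 2 * pi * (e / 5)"
    unfolding E_def measure_def using measure_sphere_slab[of "1 - 9/5 * e" "1 - 8/5 * e"] e0 e1 by simp
  have ptw: "t \<le> rho_infty r l \<omega>" if \<omega>: "\<omega> \<in> E" for \<omega>
  proof -
    define u where "u = 1 - \<omega> $ 3"
    have \<omega>s: "\<omega> \<in> sphere 0 1" and u: "8/5 * e \<le> u" "u \<le> 9/5 * e" using \<omega> by (auto simp: E_def u_def)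
    have x: "-1 < \<omega> $ 3" "\<omega> $ 3 < 1" using u e0 e1 by (auto simp: u_def)
    have w: "1 - (\<omega> $ 3)\<^sup>2 = 2 * u - u\<^sup>2" by (simp add: u_def power2_eq_square algebra_simps)
    have u2: "u\<^sup>2 \<le> e / 5"
    proof -
      have "u\<^sup>2 \<le> (9/5 * e)\<^sup>2" using u e0 by (intro power_mono) auto
      also have "\<dots> = 81/25 * e * e" by (simp add: power2_eq_square)
      also have "\<dots> \<le> 81/25 * e * (1/100)" using e0 e1 by (intro mult_left_mono) auto
      finally show ?thesis using e0 by simp
    qed
    have "3 * e \<le> 1 - (\<omega> $ 3)\<^sup>2" "1 - (\<omega> $ 3)\<^sup>2 \<le> 18/5 * e"
      unfolding w using u u2 zero_le_power2[of u] by linarith+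
    then have "3 * e * \<Lambda> \<le> (1 - (\<omega> $ 3)\<^sup>2) * \<Lambda>" "(1 - (\<omega> $ 3)\<^sup>2) * \<Lambda> \<le> 18/5 * e * \<Lambda>"
      using \<Lambda>(1) by (intro mult_right_mono; simp)+
    moreover have "e * \<Lambda> = a\<^sup>2" using \<Lambda>(1) by (simp add: e_def)
    ultimately have "3 * a\<^sup>2 \<le> (1 - (\<omega> $ 3)\<^sup>2) * (real l * (real l + 1))"
       "(1 - (\<omega> $ 3)\<^sup>2) * (real l * (real l + 1)) \<le> 18/5 * a\<^sup>2"
      by (simp_all add: \<Lambda>_def mult.assoc)
    from sum_legendre_sq_dyadic_ge[OF l(3) _ x this] l
    have "(2 ^ l * fact l)\<^sup>2 / 45 \<le> (\<Sum>n\<in>N. legendre_sq 0 l n (\<omega> $ 3))" by (simp add: N_def)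
    then have "(2 * real l + 1) / (4 * pi * (2 ^ l * fact l)\<^sup>2) * ((2 ^ l * fact l)\<^sup>2 / 45) \<le> rho_infty r l \<omega>"
      unfolding orders sph_density_eq[OF Nl \<omega>s] by (intro mult_left_mono) auto
    moreover have "t \<le> (2 * real l + 1) / (4 * pi * (2 ^ l * fact l)\<^sup>2) * ((2 ^ l * fact l)\<^sup>2 / 45)"
      by (simp add: t_def field_simps)
    ultimately show ?thesis by linarith
  qed
  interpret finite_measure sphere_measure by (rule finite_measure_sphere)
  have meas: "rho_infty r l \<in> borel_measurable sphere_measure"
    unfolding orders by (rule measurable_sph_density)
  have bd: "rho_infty r l \<omega> \<le> (2 * real l + 1) / (4 * pi)" if "\<omega> \<in> space sphere_measure" for \<omega>
    unfolding orders using that by (intro sph_density_le Nl) simp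
  have avg: "t * measure sphere_measure E \<le> (LINT \<omega>|sphere_measure. indicator E \<omega> * rho_infty r l \<omega>)"
  proof -
    have "t * measure sphere_measure E = (LINT \<omega>|sphere_measure. t * indicator E \<omega>)"
    proof -
      have "E \<inter> sphere 0 1 = E" by (auto simp: E_def)
      then show ?thesis using E by simp
    qed
    also have "\<dots> \<le> (LINT \<omega>|sphere_measure. indicator E \<omega> * rho_infty r l \<omega>)"
    proof (rule integral_mono)
      show "integrable sphere_measure (\<lambda>\<omega>. t * indicator E \<omega>)"
        using E by (intro integrable_const_bound[of _ "\<bar>t\<bar>"]) (auto simp: indicator_def)
      show "integrable sphere_measure (\<lambda>\<omega>. indicator E \<omega> * rho_infty r l \<omega>)"
        using E meas bd sph_density_nonneg[of l "orders_infty r l"]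
        by (intro integrable_const_bound[of _ "(2 * real l + 1) / (4 * pi)"] AE_I2 borel_measurable_times borel_measurable_indicator)
          (auto simp: indicator_def)
      show "t * indicator E \<omega> \<le> indicator E \<omega> * rho_infty r l \<omega>" for \<omega>
        using ptw by (simp add: indicator_def)
    qed
    finally show ?thesis .
  qed
  have t: "0 < t" using l by (simp add: t_def)
  have "t * measure sphere_measure E powr (2 * \<theta>) \<le> Lp_norm sphere_measure (p / 2) (rho_infty r l)"
    unfolding \<theta>_def
    by (rule Lp_norm_half_ge_average[OF finite_measure_sphere meas sph_density_nonneg bd E _ t avg p])
      (use e0 in \<open>auto simp: mE\<close>)
  moreover have "1 / (180 * pi) * real l powr (1 - real_of_ereal (4/p)) * r l powr real_of_ereal (4/p) \<le> t * measure sphere_measure E powr (2 * \<theta>)"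
  proof -
    \<comment> \<open>As 2 \<theta> <= 1, the factor 1/2 in the lower bound of the area costs at
      most 1/2, which turns 1 / (90 pi) into 1 / (180 pi).\<close>
    have "(1/2) powr 1 \<le> (1/2 :: real) powr (2 * \<theta>)" using \<theta> by (intro powr_mono') auto
    then have "1/2 * ((a / real l)\<^sup>2) powr (2 * \<theta>) \<le> (1/2) powr (2 * \<theta>) * ((a / real l)\<^sup>2) powr (2 * \<theta>)"
      by (intro mult_right_mono) auto
    also have "(1/2) powr (2 * \<theta>) * ((a / real l)\<^sup>2) powr (2 * \<theta>) = ((a / real l)\<^sup>2 / 2) powr (2 * \<theta>)"
      by (simp add: powr_mult[symmetric])
    also have "\<dots> \<le> (measure sphere_measure E) powr (2 * \<theta>)"
    proof (rule powr_mono2)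
      have "e * 1 \<le> e * (2 * pi / 5)" using e0 pi_gt3 by (intro mult_left_mono) auto
      also have "\<dots> = measure sphere_measure E" unfolding mE by simp
      finally show "(a / real l)\<^sup>2 / 2 \<le> measure sphere_measure E" using e2 by simp
    qed (use \<theta> in auto)
    also have "((a / real l)\<^sup>2) powr (2 * \<theta>) = (a / real l) powr (4 * \<theta>)"
      using l by (simp add: powr_numeral[symmetric] powr_powr del: powr_numeral)
    finally have "t * (1/2 * (a / real l) powr (4 * \<theta>)) \<le> t * measure sphere_measure E powr (2 * \<theta>)"
      using t by (intro mult_left_mono) auto
    moreover have "t * (1/2 * (a / real l) powr (4 * \<theta>)) = 1 / (180 * pi) * real l powr (1 - real_of_ereal (4/p)) * r l powr real_of_ereal (4/p)"
      unfolding \<theta>(3) using l by (simp add: t_def a_def powr_divide powr_diff)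
    ultimately show ?thesis by (simp only:)
  qed
  ultimately show ?thesis by linarith
qed

text \<open>Chebyshev's inequality: the indicator of \<open>\<bar>x\<bar> \<le> \<kappa>\<close> is bounded below by \<open>1 - x\<^sup>2 / \<kappa>\<^sup>2\<close>.\<close>

lemma integral_sph_density_slab_ge:
  assumes N: "N \<subseteq> {1..l}" and \<kappa>: "0 < \<kappa>"
    and \<beta>: "\<And>n. n \<in> N \<Longrightarrow> (2 * (real l - real n) + 1) / (2 * real n) \<le> \<kappa>\<^sup>2 / 2"
  shows "real (card N) / 2 \<le> (LINT \<omega>|sphere_measure.
     indicator {\<omega> \<in> sphere 0 1. \<omega> $ 3 \<in> {-\<kappa>..\<kappa>}} \<omega> * sph_density l (int ` N) \<omega>)"
proof -
  interpret finite_measure sphere_measure by (rule finite_measure_sphere)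
  define K where "K = (2 * real l + 1) / (4 * pi * (2 ^ l * fact l)\<^sup>2)"
  define H where "H = 2 * (2 ^ l * fact l)\<^sup>2 / (2 * real l + 1)"
  define E where "E = {\<omega> :: real^3. \<omega> \<in> sphere 0 1 \<and> \<omega> $ 3 \<in> {-\<kappa>..\<kappa>}}"
  \<comment> \<open>The Chebyshev minorant of the density restricted to the slab: at most the
    density inside, at most 0 outside. Its integral is the mass of each order minus its second
    moment over \<kappa>^2, and \<open>\<beta>\<close> keeps at least half of the mass.\<close>
  define \<phi> where "\<phi> x = (\<Sum>n\<in>N. K * (legendre_sq 0 l n x - x\<^sup>2 * legendre_sq 0 l n x / \<kappa>\<^sup>2))" for x
  have Nl: "N \<subseteq> {..l}" and finN: "finite N" using N finite_subset[OF N] by auto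
  have K: "0 \<le> K" by (simp add: K_def)
  have KH: "2 * pi * (K * H) = 1"
  proof -
    have "(2 ^ l * fact l :: real)\<^sup>2 \<noteq> 0" "2 * real l + 1 \<noteq> 0" by auto
    then show ?thesis unfolding K_def H_def by (simp only: field_simps) simp
  qed
  have E: "E \<in> sets sphere_measure"
  proof -
    have "E = (\<lambda>\<omega>. \<omega> $ 3) -` {-\<kappa>..\<kappa>} \<inter> space sphere_measure" by (auto simp: E_def)
    then show ?thesis using measurable_sets[OF measurable_sphere_nth[of 3], of "{-\<kappa>..\<kappa>}"] by simp
  qed
  have \<phi>: "continuous_on {-1..1} \<phi>" unfolding \<phi>_def using \<kappa> by (intro continuous_intros) auto
  have "real (card N) / 2 = (\<Sum>n\<in>N. 2 * pi * (K * H) / 2)" unfolding KH by simp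
  also have "\<dots> \<le> (\<Sum>n\<in>N. 2 * pi * (K * (H - integral {-1..1} (\<lambda>x. x\<^sup>2 * legendre_sq 0 l n x) / \<kappa>\<^sup>2)))"
  proof (rule sum_mono)
    fix n assume n: "n \<in> N"
    then have nl: "1 \<le> n" "n \<le> l" using N by auto
    have "integral {-1..1} (\<lambda>x. x\<^sup>2 * legendre_sq 0 l n x) \<le> (2 * (real l - real n) + 1) / (2 * real n) * H"
      using integral_square_times_legendre_sq[OF nl] unfolding integral_legendre_sq[OF nl(2)] H_def .
    also have "\<dots> \<le> \<kappa>\<^sup>2 / 2 * H" using \<beta>[OF n] by (intro mult_right_mono) (auto simp: H_def)
    finally have "integral {-1..1} (\<lambda>x. x\<^sup>2 * legendre_sq 0 l n x) / \<kappa>\<^sup>2 \<le> H / 2"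
      using \<kappa> by (simp add: field_simps)
    then have "2 * pi * (K * (H / 2)) \<le> 2 * pi * (K * (H - integral {-1..1} (\<lambda>x. x\<^sup>2 * legendre_sq 0 l n x) / \<kappa>\<^sup>2))"
      using K by (intro mult_left_mono) auto
    then show "2 * pi * (K * H) / 2 \<le> 2 * pi * (K * (H - integral {-1..1} (\<lambda>x. x\<^sup>2 * legendre_sq 0 l n x) / \<kappa>\<^sup>2))"
      by simp
  qed
  also have "\<dots> = 2 * pi * integral {-1..1} \<phi>"
  proof -
    have int: "legendre_sq 0 l n integrable_on {-1..1}" "(\<lambda>x. x\<^sup>2 * legendre_sq 0 l n x / \<kappa>\<^sup>2) integrable_on {-1..1}" for n
      using \<kappa> by (intro integrable_continuous_real continuous_intros; auto)+
    have "integral {-1..1} \<phi> = (\<Sum>n\<in>N. integral {-1..1} (\<lambda>x. K * (legendre_sq 0 l n x - x\<^sup>2 * legendre_sq 0 l n x / \<kappa>\<^sup>2)))"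
      unfolding \<phi>_def
      by (rule integral_sum[OF finN]) (use \<kappa> in \<open>auto intro!: integrable_continuous_real continuous_intros\<close>)
    also have "\<dots> = (\<Sum>n\<in>N. K * (H - integral {-1..1} (\<lambda>x. x\<^sup>2 * legendre_sq 0 l n x) / \<kappa>\<^sup>2))"
    proof (rule sum.cong[OF refl])
      fix n assume "n \<in> N"
      then have "n \<le> l" using Nl by auto
      have "integral {-1..1} (\<lambda>x. K * (legendre_sq 0 l n x - x\<^sup>2 * legendre_sq 0 l n x / \<kappa>\<^sup>2))
        = K * integral {-1..1} (\<lambda>x. legendre_sq 0 l n x - x\<^sup>2 * legendre_sq 0 l n x / \<kappa>\<^sup>2)" by simp
      also have "\<dots> = K * (H - integral {-1..1} (\<lambda>x. x\<^sup>2 * legendre_sq 0 l n x / \<kappa>\<^sup>2))"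
        unfolding integral_diff[OF int] integral_legendre_sq[OF \<open>n \<le> l\<close>] H_def ..
      finally show "integral {-1..1} (\<lambda>x. K * (legendre_sq 0 l n x - x\<^sup>2 * legendre_sq 0 l n x / \<kappa>\<^sup>2)) =
         K * (H - integral {-1..1} (\<lambda>x. x\<^sup>2 * legendre_sq 0 l n x) / \<kappa>\<^sup>2)" by simp
    qed
    finally show ?thesis by (simp add: sum_distrib_left)
  qed
  also have "\<dots> = (LINT \<omega>|sphere_measure. \<phi> (\<omega> $ 3))" by (rule integral_sphere_height(2)[OF \<phi>, symmetric])
  also have "\<dots> \<le> (LINT \<omega>|sphere_measure. indicator E \<omega> * sph_density l (int ` N) \<omega>)"
  proof (rule integral_mono)
    show "integrable sphere_measure (\<lambda>\<omega>. \<phi> (\<omega> $ 3))" by (rule integral_sphere_height(1)[OF \<phi>])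
    show "integrable sphere_measure (\<lambda>\<omega>. indicator E \<omega> * sph_density l (int ` N) \<omega>)"
      using E measurable_sph_density sph_density_le[OF Nl] sph_density_nonneg[of l "int ` N"]
      by (intro integrable_const_bound[of _ "(2 * real l + 1) / (4 * pi)"] AE_I2 borel_measurable_times borel_measurable_indicator)
        (auto simp: indicator_def)
    fix \<omega> assume "\<omega> \<in> space sphere_measure"
    then have \<omega>: "\<omega> \<in> sphere 0 1" by simp
    define y where "y = \<omega> $ 3"
    have "y \<in> {-1..1}" using sphere_abs_nth_le_1[OF \<omega>, of 3] by (auto simp: y_def)
    then have h: "0 \<le> legendre_sq 0 l n y" for n by (rule legendre_sq_nonneg)
    have dens: "sph_density l (int ` N) \<omega> = (\<Sum>n\<in>N. K * legendre_sq 0 l n y)"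
      unfolding sph_density_eq[OF Nl \<omega>] by (simp add: K_def y_def sum_distrib_left)
    show "\<phi> (\<omega> $ 3) \<le> indicator E \<omega> * sph_density l (int ` N) \<omega>"
    proof (cases "\<omega> \<in> E")
      case True
      have "\<phi> y \<le> (\<Sum>n\<in>N. K * legendre_sq 0 l n y)"
        unfolding \<phi>_def using K h by (intro sum_mono mult_left_mono) auto
      then show ?thesis using True by (simp add: dens y_def)
    next
      case False
      then have "\<kappa> \<le> \<bar>y\<bar>" using \<omega> by (auto simp: E_def y_def)
      then have "\<kappa>\<^sup>2 \<le> \<bar>y\<bar>\<^sup>2" using \<kappa> by (intro power_mono) auto
      then have y: "1 \<le> y\<^sup>2 / \<kappa>\<^sup>2" using \<kappa> by simp
      have "legendre_sq 0 l n y - y\<^sup>2 * legendre_sq 0 l n y / \<kappa>\<^sup>2 \<le> 0" for n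
        using mult_right_mono[OF y h[of n]] by simp
      then have "\<phi> y \<le> 0" unfolding \<phi>_def using K by (intro sum_nonpos mult_nonneg_nonpos) auto
      then show ?thesis using False by (simp add: y_def)
    qed
  qed
  finally show ?thesis by (simp add: E_def)
qed

lemma Lp_norm_rho_two_ge:
  fixes p :: ereal
  assumes r: "9 \<le> r l" "r l \<le> real l / 10" and p: "2 \<le> p"
  shows "1 / (16 * pi * sqrt 10) * real l powr (1/2 - real_of_ereal (1/p)) * r l powr (1/2 + real_of_ereal (1/p))
     \<le> Lp_norm sphere_measure (p / 2) (rho_two r l)"
proof -
  define a where "a = r l"
  define \<theta> where "\<theta> = real_of_ereal (1 / p)"
  \<comment> \<open>For n in \<open>N\<close> one has n > 4 l / 5 and l - n < 2 a, so the ratio in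
    \<open>integral_square_times_legendre_sq\<close> is at most 5 a / l, which is \<kappa>^2 /
    2.\<close>
  define \<kappa> where "\<kappa> = sqrt (10 * a / real l)"
  define N where "N = {n. real l - 2 * a < real n \<and> real n \<le> real l - a}"
  define E where "E = {\<omega> :: real^3. \<omega> \<in> sphere 0 1 \<and> \<omega> $ 3 \<in> {-\<kappa>..\<kappa>}}"
  \<comment> \<open>The band has area 4 pi \<kappa> and contains mass at least card N / 2 >= a / 4;
    \<open>t\<close> is the quotient.\<close>
  define t where "t = a / (16 * pi * \<kappa>)"
  note \<theta> = real_of_ereal_inverse_bounds[OF p, folded \<theta>_def]
  have l: "real l \<ge> 90" "a \<le> real l / 10" "9 \<le> a" using r by (auto simp: a_def)
  have \<kappa>: "0 < \<kappa>" "\<kappa> \<le> 1" "\<kappa>\<^sup>2 = 10 * a / real l" using l by (auto simp: \<kappa>_def)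
  have orders: "orders_two r l = int ` N"
    unfolding N_def a_def by (rule orders_two_eq_image) (use l in \<open>simp add: a_def\<close>)
  have N: "N \<subseteq> {1..l}"
  proof
    fix n assume "n \<in> N"
    then have "0 < real n" "real n \<le> real l" using l by (auto simp: N_def)
    then show "n \<in> {1..l}" by auto
  qed
  then have Nl: "N \<subseteq> {..l}" by auto
  have cardN: "a / 2 \<le> real (card N)"
    using card_orders_two(1)[of r l] l by (simp add: orders card_image a_def)
  have E: "E \<in> sets sphere_measure"
  proof -
    have "E = (\<lambda>\<omega>. \<omega> $ 3) -` {-\<kappa>..\<kappa>} \<inter> space sphere_measure" by (auto simp: E_def)
    then show ?thesis using measurable_sets[OF measurable_sphere_nth[of 3], of "{-\<kappa>..\<kappa>}"] by simp
  qed
  have mE: "measure sphere_measure E = 4 * pi * \<kappa>"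
    unfolding E_def measure_def using measure_sphere_slab[of "-\<kappa>" \<kappa>] \<kappa> by simp
  have meas: "rho_two r l \<in> borel_measurable sphere_measure"
    unfolding orders by (rule measurable_sph_density)
  have bd: "rho_two r l \<omega> \<le> (2 * real l + 1) / (4 * pi)" if "\<omega> \<in> space sphere_measure" for \<omega>
    unfolding orders using that by (intro sph_density_le Nl) simp
  have "(2 * (real l - real n) + 1) / (2 * real n) \<le> \<kappa>\<^sup>2 / 2" if "n \<in> N" for n
  proof -
    have n: "real l - 2 * a < real n" using that by (auto simp: N_def)
    have "(2 * (real l - real n) + 1) / (2 * real n) \<le> (5 * a) / real l"
      using n l by (intro frac_le) auto
    then show ?thesis unfolding \<kappa>(3) by simp
  qed
  from integral_sph_density_slab_ge[OF N \<kappa>(1) this]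
  have "real (card N) / 2 \<le> (LINT \<omega>|sphere_measure. indicator E \<omega> * rho_two r l \<omega>)"
    unfolding orders E_def .
  moreover have "t * measure sphere_measure E = a / 4"
    using \<kappa>(1) by (simp add: mE t_def)
  ultimately have "t * measure sphere_measure E \<le> (LINT \<omega>|sphere_measure. indicator E \<omega> * rho_two r l \<omega>)"
    using cardN by linarith
  then have "t * measure sphere_measure E powr (2 * \<theta>) \<le> Lp_norm sphere_measure (p / 2) (rho_two r l)"
    unfolding \<theta>_def
    by (intro Lp_norm_half_ge_average[OF finite_measure_sphere meas sph_density_nonneg bd E] p)
      (use \<kappa> l in \<open>auto simp: mE t_def\<close>)
  moreover have "1 / (16 * pi * sqrt 10) * real l powr (1/2 - \<theta>) * r l powr (1/2 + \<theta>) \<le> t * measure sphere_measure E powr (2 * \<theta>)"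
  proof -
    have "1 \<le> 4 * pi * sqrt 10" using pi_gt3 real_sqrt_ge_1_iff[of 10]
      by (intro order_trans[OF _ mult_mono[of 1 "4 * pi" 1 "sqrt 10"]]) auto
    then have one: "1 \<le> (4 * pi * sqrt 10) powr (2 * \<theta>)" using \<theta> by (intro ge_one_powr_ge_zero) auto
    have \<kappa>': "\<kappa> = sqrt 10 * (a / real l) powr (1/2)"
      using l by (simp add: \<kappa>_def powr_half_sqrt real_sqrt_mult real_sqrt_divide)
    have "t * measure sphere_measure E powr (2 * \<theta>) =
       a / (16 * pi * sqrt 10) / (a / real l) powr (1/2) * ((4 * pi * sqrt 10) powr (2 * \<theta>) * ((a / real l) powr (1/2)) powr (2 * \<theta>))"
      unfolding mE t_def \<kappa>' by (simp add: powr_mult mult.assoc)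
    also have "\<dots> = (4 * pi * sqrt 10) powr (2 * \<theta>) * (1 / (16 * pi * sqrt 10) * (a * (a / real l) powr (\<theta> - 1/2)))"
      by (simp add: powr_powr powr_diff)
    also have "a * (a / real l) powr (\<theta> - 1/2) = real l powr (1/2 - \<theta>) * a powr (1/2 + \<theta>)"
    proof -
      have "a powr 1 * a powr (\<theta> - 1/2) = a powr (1 + (\<theta> - 1/2))" by (simp only: powr_add)
      then have "a * a powr (\<theta> - 1/2) = a powr (1/2 + \<theta>)" using l by simp
      moreover have "(a / real l) powr (\<theta> - 1/2) = a powr (\<theta> - 1/2) * real l powr (1/2 - \<theta>)"
        using l powr_minus_divide[of "real l" "\<theta> - 1/2"] by (simp add: powr_divide)
      ultimately show ?thesis by (simp add: mult.commute mult.left_commute)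
    qed
    also have "(4 * pi * sqrt 10) powr (2 * \<theta>) * (1 / (16 * pi * sqrt 10) * (real l powr (1/2 - \<theta>) * a powr (1/2 + \<theta>)))
      \<ge> 1 * (1 / (16 * pi * sqrt 10) * (real l powr (1/2 - \<theta>) * a powr (1/2 + \<theta>)))"
      by (intro mult_right_mono one) auto
    finally show ?thesis by (simp add: a_def mult.assoc)
  qed
  ultimately show ?thesis unfolding \<theta>_def by linarith
qed

section \<open>Upper bounds for the Schatten norms and conclusion\<close>

lemma card_powr_le:
  assumes "9 \<le> x" "real n \<le> x + 1" "0 \<le> s" "s \<le> 1"
  shows "real n powr s \<le> 2 * x powr s"
proof -
  have "real n powr s \<le> (2 * x) powr s" using assms by (intro powr_mono2) auto
  also have "\<dots> = 2 powr s * x powr s" using assms by (simp add: powr_mult)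
  also have "\<dots> \<le> 2 powr 1 * x powr s" using assms by (intro mult_right_mono powr_mono) auto
  finally show ?thesis by simp
qed

text \<open>The inverse Schatten exponent is 1/2 + 1/p, precisely the power of r in the lower bound
  for the density, so the two estimates combine with the loss of a constant only.\<close>

lemma schatten_norm_gamma_two_le:
  fixes p :: ereal
  assumes r: "9 \<le> r l" "r l \<le> real l / 10" and p: "2 \<le> p" "p \<le> 6"
  shows "schatten_norm sphere_measure (2 * p / (p + 2)) (gamma_two r l) \<le> 2 * r l powr (1/2 + real_of_ereal (1/p))"
proof -
  obtain a where a: "p = ereal a" "2 \<le> a" using p by (cases p) auto
  have \<alpha>: "2 * p / (p + 2) = ereal (2 * a / (a + 2))" "1 / p = ereal (1 / a)"
    using a by (simp_all add: numeral_eq_ereal one_ereal_def)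
  have "orders_two r l \<subseteq> {0..int l}"
    using r by (auto simp: orders_two_def)
  then have "schatten_norm sphere_measure (2 * p / (p + 2)) (gamma_two r l) \<le> real (card (orders_two r l)) powr (1 / (2 * a / (a + 2)))"
    unfolding \<alpha> using a by (intro schatten_norm_sph_operator_le) auto
  also have "1 / (2 * a / (a + 2)) = 1/2 + 1/a" using a by (simp add: field_simps)
  also have "real (card (orders_two r l)) powr (1/2 + 1/a) \<le> 2 * r l powr (1/2 + 1/a)"
    using r a card_orders_two(2)[of r l] by (intro card_powr_le) (auto simp: field_simps)
  finally show ?thesis using \<alpha> by simp
qed

text \<open>Again the inverse Schatten exponent, 4/p, is the power of r in the density bound. At p =
  \<infinity> the operator norm is at most 1, in accordance with r^0.\<close>

lemma schatten_norm_gamma_infty_le: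
  fixes p :: ereal
  assumes r: "9 \<le> r l" "r l \<le> real l / 10" and p: "6 \<le> p"
  shows "schatten_norm sphere_measure (p / 4) (gamma_infty r l) \<le> 2 * r l powr real_of_ereal (4/p)"
proof -
  have sub: "orders_infty r l \<subseteq> {0..int l}"
    using r by (auto simp: orders_infty_def)
  show ?thesis
  proof (cases p)
    case (real a)
    then have a: "6 \<le> a" using p by simp
    have \<alpha>: "p / 4 = ereal (a / 4)" "4 / p = ereal (4 / a)"
      using real a by (simp_all add: numeral_eq_ereal)
    have "schatten_norm sphere_measure (p / 4) (gamma_infty r l) \<le> real (card (orders_infty r l)) powr (1 / (a / 4))"
      unfolding \<alpha> using a by (intro schatten_norm_sph_operator_le sub) auto
    also have "1 / (a / 4) = 4 / a" by simp
    also have "real (card (orders_infty r l)) powr (4 / a) \<le> 2 * r l powr (4 / a)"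
      using r a card_orders_infty[of r l] by (intro card_powr_le) auto
    finally show ?thesis using \<alpha> by simp
  next
    case PInf
    then have "p / 4 = \<infinity>" "4 / p = 0" by (simp_all add: numeral_eq_ereal)
    then show ?thesis using schatten_norm_infinity_sph_operator_le[OF sub] r by simp
  qed (use p in auto)
qed

theorem theorem4:
  fixes r :: "nat \<Rightarrow> real"
  assumes nonneg: "\<And>l. 0 \<le> r l"
    and lim_infty: "filterlim r at_top sequentially"
    and lim_ratio: "(\<lambda>l. r l / real l) \<longlonglongrightarrow> 0"
  shows "(\<exists>c>0. \<exists>L\<ge>1. \<forall>l\<ge>L. r l \<le> real l / 2 \<and>
            (\<forall>p::ereal. 2 \<le> p \<and> p \<le> \<infinity> \<longrightarrow>
               Lp_norm sphere_measure (p / 2) (rho_two r l)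
                 \<ge> c * real l powr (1/2 - real_of_ereal (1/p)) * r l powr (1/2 + real_of_ereal (1/p)) \<and>
               Lp_norm sphere_measure (p / 2) (rho_infty r l)
                 \<ge> c * real l powr (1 - real_of_ereal (4/p)) * r l powr real_of_ereal (4/p)))
       \<and> (\<exists>c'>0. \<forall>\<^sub>F l in sequentially.
            (\<forall>p::ereal. 2 \<le> p \<and> p \<le> 6 \<longrightarrow>
               Lp_norm sphere_measure (p / 2) (rho_two r l)
                 \<ge> c' * real l powr (1/2 - real_of_ereal (1/p))
                      * schatten_norm sphere_measure (2 * p / (p + 2)) (gamma_two r l)) \<and>
            (\<forall>p::ereal. 6 \<le> p \<and> p \<le> \<infinity> \<longrightarrow>
               Lp_norm sphere_measure (p / 2) (rho_infty r l)
                 \<ge> c' * real l powr (1 - real_of_ereal (4/p))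
                      * schatten_norm sphere_measure (p / 4) (gamma_infty r l)))"
proof -
  define c where "c = min (1 / (16 * pi * sqrt 10)) (1 / (180 * pi))"
  have c: "0 < c" by (simp add: c_def)
  have c_le: "c \<le> 1 / (16 * pi * sqrt 10)" "c \<le> 1 / (180 * pi)" by (simp_all add: c_def)
  \<comment> \<open>The threshold 9 absorbs the lower-order term of the moment estimate; r <= l / 10
    keeps the polar collar small and the orders of the equatorial band above 4 l / 5.\<close>
  have large: "\<forall>\<^sub>F l in sequentially. 9 \<le> r l \<and> r l \<le> real l / 10"
  proof -
    have "\<forall>\<^sub>F l in sequentially. 9 \<le> r l" using lim_infty by (simp add: filterlim_at_top)
    moreover have "\<forall>\<^sub>F l in sequentially. r l / real l < 1 / 10"
      using order_tendstoD(2)[OF lim_ratio, of "1/10"] by simp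
    ultimately show ?thesis
      using eventually_gt_at_top[of 0] by eventually_elim (auto simp: field_simps)
  qed
  have two: "c * real l powr (1/2 - real_of_ereal (1/p)) * r l powr (1/2 + real_of_ereal (1/p))
      \<le> Lp_norm sphere_measure (p / 2) (rho_two r l)" if "9 \<le> r l \<and> r l \<le> real l / 10" "2 \<le> p" for l p
    by (rule order_trans[OF _ Lp_norm_rho_two_ge]) (use that in \<open>auto intro!: mult_right_mono c_le(1) simp del: times_divide_eq_left\<close>)
  have infty: "c * real l powr (1 - real_of_ereal (4/p)) * r l powr real_of_ereal (4/p)
      \<le> Lp_norm sphere_measure (p / 2) (rho_infty r l)" if "9 \<le> r l \<and> r l \<le> real l / 10" "2 \<le> p" for l p
    by (rule order_trans[OF _ Lp_norm_rho_infty_ge]) (use that in \<open>auto intro!: mult_right_mono c_le(2) simp del: times_divide_eq_left\<close>)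
  \<comment> \<open>The Schatten norms are at most twice the power of r, which is why c' = c /
    2.\<close>
  have half: "c / 2 * u * s \<le> z" if "c * u * v \<le> z" "s \<le> 2 * v" "0 \<le> u" for u v s z :: real
  proof -
    have "c / 2 * u * s \<le> c / 2 * u * (2 * v)" using that c by (intro mult_left_mono) auto
    with that show ?thesis by simp
  qed
  show ?thesis
  proof (intro conjI)
    obtain L where L: "\<And>l. L \<le> l \<Longrightarrow> 9 \<le> r l \<and> r l \<le> real l / 10"
      using large by (auto simp: eventually_sequentially)
    show "\<exists>c>0. \<exists>L\<ge>1. \<forall>l\<ge>L. r l \<le> real l / 2 \<and>
            (\<forall>p::ereal. 2 \<le> p \<and> p \<le> \<infinity> \<longrightarrow>
               Lp_norm sphere_measure (p / 2) (rho_two r l)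
                 \<ge> c * real l powr (1/2 - real_of_ereal (1/p)) * r l powr (1/2 + real_of_ereal (1/p)) \<and>
               Lp_norm sphere_measure (p / 2) (rho_infty r l)
                 \<ge> c * real l powr (1 - real_of_ereal (4/p)) * r l powr real_of_ereal (4/p))"
    proof (intro exI[of _ c] exI[of _ "max 1 L"] conjI allI impI c)
      fix l assume "max 1 L \<le> l"
      then have l: "9 \<le> r l \<and> r l \<le> real l / 10" using L by simp
      then show "r l \<le> real l / 2" by simp
      fix p :: ereal assume p: "2 \<le> p \<and> p \<le> \<infinity>"
      show "c * real l powr (1/2 - real_of_ereal (1/p)) * r l powr (1/2 + real_of_ereal (1/p))
          \<le> Lp_norm sphere_measure (p / 2) (rho_two r l)" using two[OF l] p by blast
      show "c * real l powr (1 - real_of_ereal (4/p)) * r l powr real_of_ereal (4/p)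
          \<le> Lp_norm sphere_measure (p / 2) (rho_infty r l)" using infty[OF l] p by blast
    qed simp
    show "\<exists>c'>0. \<forall>\<^sub>F l in sequentially.
            (\<forall>p::ereal. 2 \<le> p \<and> p \<le> 6 \<longrightarrow>
               Lp_norm sphere_measure (p / 2) (rho_two r l)
                 \<ge> c' * real l powr (1/2 - real_of_ereal (1/p))
                      * schatten_norm sphere_measure (2 * p / (p + 2)) (gamma_two r l)) \<and>
            (\<forall>p::ereal. 6 \<le> p \<and> p \<le> \<infinity> \<longrightarrow>
               Lp_norm sphere_measure (p / 2) (rho_infty r l)
                 \<ge> c' * real l powr (1 - real_of_ereal (4/p))
                      * schatten_norm sphere_measure (p / 4) (gamma_infty r l))"
    proof (intro exI[of _ "c / 2"] conjI)
      show "0 < c / 2" using c by simp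
      show "\<forall>\<^sub>F l in sequentially.
            (\<forall>p::ereal. 2 \<le> p \<and> p \<le> 6 \<longrightarrow>
               Lp_norm sphere_measure (p / 2) (rho_two r l)
                 \<ge> c / 2 * real l powr (1/2 - real_of_ereal (1/p))
                      * schatten_norm sphere_measure (2 * p / (p + 2)) (gamma_two r l)) \<and>
            (\<forall>p::ereal. 6 \<le> p \<and> p \<le> \<infinity> \<longrightarrow>
               Lp_norm sphere_measure (p / 2) (rho_infty r l)
                 \<ge> c / 2 * real l powr (1 - real_of_ereal (4/p))
                      * schatten_norm sphere_measure (p / 4) (gamma_infty r l))"
        using large
      proof (eventually_elim, intro conjI allI impI)
        fix l and p :: ereal assume l: "9 \<le> r l \<and> r l \<le> real l / 10"
        {
          assume p: "2 \<le> p \<and> p \<le> 6"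
          show "c / 2 * real l powr (1/2 - real_of_ereal (1/p))
              * schatten_norm sphere_measure (2 * p / (p + 2)) (gamma_two r l) \<le> Lp_norm sphere_measure (p / 2) (rho_two r l)"
            using l p by (intro half[OF two[OF l]] schatten_norm_gamma_two_le) auto
        next
          assume p: "6 \<le> p \<and> p \<le> \<infinity>"
          then have "2 \<le> p" by (intro order_trans[of 2 6 p]) auto
          then show "c / 2 * real l powr (1 - real_of_ereal (4/p))
              * schatten_norm sphere_measure (p / 4) (gamma_infty r l) \<le> Lp_norm sphere_measure (p / 2) (rho_infty r l)"
            using l p by (intro half[OF infty[OF l]] schatten_norm_gamma_infty_le) auto
        }
      qed
    qed
  qed
qed

end
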